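(* Let $N\geqslant1$. The set $\mathrm{GRTM}_{(\bar1,1)}(N,\mathbf k)$ forms a group under the multiplication $$(g_1,h_1)\circ(g_2,h_2)=\Big(g_2(A,B)\cdot g_1\big(A,\mathrm{Ad}(g_2^{-1})(B)\big),\ h_2\cdot h_1\big(A\,\big|\,\mathrm{Ad}(\tau_ih_2^{-1})(B(i))\big)\Big).$$
   Context: Let $\mathbf k$ be a field of characteristic $0$. **Lie algebras.** For $n\geqslant2$, $N\geqslant1$, $\mathfrak t_{n,N}$ is the completed (with respect to the grading where generators have degree 1) $\mathbf k$-Lie algebra with generators $t^{1i}$ ($2\leqslant i\leqslant n$) and $t(a)^{ij}$ ($i\ne j$, $2\leqslant i,j\leqslant n$, $a\in\mathbf Z/N\mathbf Z$) and relations, for all $a,b\in\mathbf Z/N\mathbf Z$ and all distinct $i,j,k,l\in\{2,\dots,n\}$: $t(a)^{ij}=t(-a)^{ji}$; $[t(a)^{ij},t(a+b)^{ik}+t(b)^{jk}]=0$; $[t^{1i}+t^{1j}+\sum_c t(c)^{ij},t(a)^{ij}]=0$; $[t^{1i},t^{1j}+\sum_c t(c)^{ij}]=0$; $[t^{1i},t(a)^{jk}]=0$; $[t(a)^{ij},t(b)^{kl}]=0$ (sums over $c\in\mathbf Z/N\mathbf Z$, here and below). $\mathfrak t^0_{n,N}\subset\mathfrak t_{n,N}$ is the (completed) Lie subalgebra generated by these generators except $t^{1n}$. For $N=1$ write $\mathfrak t^0_n=\mathfrak t^0_{n,1}$, $t^{ij}=t(0)^{ij}$. $\mathfrak t^0_3$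 is completed free on $A=t^{12},B=t^{23}$; $\mathfrak t^0_{3,N}$ is completed free on $A=t^{12}$, $B(a)=t(a)^{23}$ ($a\in\mathbf Z/N\mathbf Z$). **Notation.** $\exp\mathfrak g$ is the group of group-like elements in the completed enveloping algebra of $\mathfrak g$; $\mathrm{Ad}(u)(x)=uxu^{-1}$. $g(X,Y)$ is the image of $g$ under $A\mapsto X,B\mapsto Y$; for $h\in\exp\mathfrak t^0_{3,N}$, $h(X\,|\,Y_i)$ is the image of $h$ under $A\mapsto X$, $B(i)\mapsto Y_i$ ($i\in\mathbf Z/N\mathbf Z$). $\tau_a$ ($a\in\mathbf Z/N\mathbf Z$) is the automorphism with $A\mapsto A$, $B(c)\mapsto B(c+a)$. $c_W$ is the coefficient of the noncommutative monomial $W$. Put $C=-A-B$ in $\mathfrak t^0_3$ and $C=-A-\sum_aB(a)$ in $\mathfrak t^0_{3,N}$. **$\mathrm{GRT}_1(\mathbf k)$** is the set of $g\in\exp\mathfrak t^0_3$ with $g(A,B)g(B,A)=1$, $g(C,A)g(B,C)g(A,B)=1$, $A+g(A,B)^{-1}Bg(A,B)+g(A,C)^{-1}Cg(A,C)=0$ and, in $\exp\mathfrak t^0_4$, $g(t^{12},t^{23}+t^{24})g(t^{13}+t^{23},t^{34})=g(t^{23},t^{34})g(t^{12}+t^{13},t^{24}+t^{34})g(t^{12},t^{23})$. **$\mathrm{GRTM}_{(\bar1,1)}(N,\mathbf k)$** is the set of $(g,h)\in\exp\mathfrak t^0_3\times\exp\mathfrak t^0_{3,N}$ with $g\in\mathrm{GRT}_1(\mathbf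 k)$, $c_{B(0)}(h)=0$, and - mixed pentagon in $\exp\mathfrak t^0_{4,N}$: $h(t^{12}|t(a)^{23}+t(a)^{24})\,h(t^{13}+\sum_ct(c)^{23}|t(a)^{34})=g(t(0)^{23},t(0)^{34})\,h(t^{12}+t^{13}+\sum_ct(c)^{23}|t(a)^{24}+t(a)^{34})\,h(t^{12}|t(a)^{23})$; - octagon: $h(A|B(i+1))^{-1}\,h(C|B(1-i))\,h(C|B(-i))^{-1}\,h(A|B(i))=1$; - special action condition: $A+\sum_{a\in\mathbf Z/N\mathbf Z}\mathrm{Ad}(\tau_ah^{-1})(B(a))+\mathrm{Ad}\big(h^{-1}\cdot h(C|B(-i))\big)(C)=0$. *)

theory Defs
  imports Complex_Main "HOL-Algebra.Group"
begin

typedef ('x, 'k) ncs = "UNIV :: ('x list \<Rightarrow> 'k) set"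
  morphisms nc_coeff Abs_ncs
  by simp

lemma nc_coeff_Abs [simp]: "nc_coeff (Abs_ncs f) = f"
  by (simp add: Abs_ncs_inverse)

lemma ncs_eqI: "(\<And>w. nc_coeff f w = nc_coeff g w) \<Longrightarrow> f = g"
  by (metis ext nc_coeff_inject)

instantiation ncs :: (type, ring_1) ring_1
begin

definition zero_ncs :: "('a, 'b) ncs"
  where "0 = Abs_ncs (\<lambda>_. 0)"
definition one_ncs :: "('a, 'b) ncs"
  where "1 = Abs_ncs (\<lambda>w. if w = [] then 1 else 0)"
definition plus_ncs :: "('a, 'b) ncs \<Rightarrow> ('a, 'b) ncs \<Rightarrow> ('a, 'b) ncs"
  where "f + g = Abs_ncs (\<lambda>w. nc_coeff f w + nc_coeff g w)"
definition uminus_ncs :: "('a, 'b) ncs \<Rightarrow> ('a, 'b) ncs"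
  where "- f = Abs_ncs (\<lambda>w. - nc_coeff f w)"
definition minus_ncs :: "('a, 'b) ncs \<Rightarrow> ('a, 'b) ncs \<Rightarrow> ('a, 'b) ncs"
  where "f - g = Abs_ncs (\<lambda>w. nc_coeff f w - nc_coeff g w)"
definition times_ncs :: "('a, 'b) ncs \<Rightarrow> ('a, 'b) ncs \<Rightarrow> ('a, 'b) ncs"
  where "f * g =
    Abs_ncs (\<lambda>w. \<Sum>i\<le>length w. nc_coeff f (take i w) * nc_coeff g (drop i w))"

instance
proof
  fix f g h :: "('a, 'b) ncs"
  note defs = zero_ncs_def one_ncs_def plus_ncs_def uminus_ncs_def minus_ncs_def times_ncs_def
  show "f * g * h = f * (g * h)"
  proof (rule ncs_eqI)
    fix w :: "'a list"
    let ?n = "length w"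
    let ?F = "\<lambda>i j. nc_coeff f (take j w) * nc_coeff g (take (i - j) (drop j w)) * nc_coeff h (drop i w)"
    have "nc_coeff (f * g * h) w = (\<Sum>i\<le>?n. \<Sum>j\<le>i. ?F i j)"
      by (auto simp: defs sum_distrib_right min_def drop_take intro!: sum.cong)
    also have "\<dots> = (\<Sum>(i, j)\<in>(SIGMA i:{..?n}. {..i}). ?F i j)"
      by (rule sum.Sigma) auto
    also have "\<dots> = (\<Sum>(j, k)\<in>(SIGMA j:{..?n}. {..?n - j}). ?F (j + k) j)"
      by (rule sum.reindex_bij_witness[of _ "\<lambda>(j, k). (j + k, j)" "\<lambda>(i, j). (j, i - j)"]) auto
    also have "\<dots> = (\<Sum>j\<le>?n. \<Sum>k\<le>?n - j. ?F (j + k) j)"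
      by (rule sum.Sigma [symmetric]) auto
    also have "\<dots> = nc_coeff (f * (g * h)) w"
      by (auto simp: defs sum_distrib_left mult.assoc add.commute intro!: sum.cong)
    finally show "nc_coeff (f * g * h) w = nc_coeff (f * (g * h)) w" .
  qed
  show "1 * f = f"
  proof (rule ncs_eqI)
    fix w :: "'a list"
    have "nc_coeff (1 * f) w = (\<Sum>i\<le>length w. if i = 0 then nc_coeff f w else 0)"
      unfolding defs nc_coeff_Abs by (rule sum.cong) auto
    then show "nc_coeff (1 * f) w = nc_coeff f w" by simp
  qed
  show "f * 1 = f"
  proof (rule ncs_eqI)
    fix w :: "'a list"
    have "nc_coeff (f * 1) w = (\<Sum>i\<le>length w. if i = length w then nc_coeff f w else 0)"
      unfolding defs nc_coeff_Abs by (rule sum.cong) auto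
    then show "nc_coeff (f * 1) w = nc_coeff f w" by simp
  qed
  show "(0 :: ('a, 'b) ncs) \<noteq> 1"
  proof
    assume "(0 :: ('a, 'b) ncs) = 1"
    then have "nc_coeff (0 :: ('a, 'b) ncs) [] = nc_coeff 1 []" by simp
    then show False by (simp add: defs)
  qed
qed (auto intro!: ncs_eqI simp: zero_ncs_def plus_ncs_def uminus_ncs_def minus_ncs_def
    times_ncs_def distrib_left distrib_right sum.distrib)

end

definition nc_var :: "'x \<Rightarrow> ('x, 'k::ring_1) ncs"
  where "nc_var x = Abs_ncs (\<lambda>w. if w = [x] then 1 else 0)"

definition nc_over :: "'x set \<Rightarrow> ('x, 'k::ring_1) ncs set"
  where "nc_over X = {f. \<forall>w. nc_coeff f w \<noteq> 0 \<longrightarrow> set w \<subseteq> X}"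

definition nc_inv :: "('x, 'k::ring_1) ncs \<Rightarrow> ('x, 'k) ncs"
  where "nc_inv f = (THE g. f * g = 1 \<and> g * f = 1)"

definition nc_Ad :: "('x, 'k::ring_1) ncs \<Rightarrow> ('x, 'k) ncs \<Rightarrow> ('x, 'k) ncs"
  where "nc_Ad u x = u * x * nc_inv u"

definition nc_lie :: "('x, 'k::ring_1) ncs \<Rightarrow> ('x, 'k) ncs \<Rightarrow> ('x, 'k) ncs"
  where "nc_lie x y = x * y - y * x"

text \<open>
  The continuous algebra homomorphism sending each letter \<open>x\<close> to \<open>\<phi> x\<close>. It is meaningful when
  \<open>f\<close> involves finitely many letters and every \<open>\<phi> x\<close> has constant term 0: then a word \<open>w\<close> of \<open>f\<close>
  contributes only to words at least as long as \<open>w\<close>, and the index set below is finite.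
\<close>
definition nc_subst :: "('x \<Rightarrow> ('y, 'k::ring_1) ncs) \<Rightarrow> ('x, 'k) ncs \<Rightarrow> ('y, 'k) ncs"
  where "nc_subst \<phi> f = Abs_ncs (\<lambda>v.
    \<Sum>w | nc_coeff f w \<noteq> 0 \<and> length w \<le> length v.
      nc_coeff f w * nc_coeff (prod_list (map \<phi> w)) v)"

text \<open>
  The coproduct is the continuous algebra homomorphism with
  \<open>\<Delta> x = x \<otimes> 1 + 1 \<otimes> x\<close> on letters, so \<open>\<Delta> (x w) = (x \<otimes> 1 + 1 \<otimes> x) \<Delta> w\<close> on words;
  \<open>unshuffles w\<close> lists the tensors \<open>u \<otimes> v\<close> in \<open>\<Delta> w\<close>, with multiplicity.
\<close>
fun unshuffles :: "'x list \<Rightarrow> ('x list \<times> 'x list) list"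
  where
    "unshuffles [] = [([], [])]"
  | "unshuffles (x # w) =
      map (\<lambda>(u, v). (x # u, v)) (unshuffles w) @ map (\<lambda>(u, v). (u, x # v)) (unshuffles w)"

text \<open>\<open>nc_coprod f u v\<close> is the coefficient of \<open>u \<otimes> v\<close> in \<open>\<Delta> f\<close>.\<close>
definition nc_coprod :: "('x, 'k::ring_1) ncs \<Rightarrow> 'x list \<Rightarrow> 'x list \<Rightarrow> 'k"
  where "nc_coprod f u v =
    (\<Sum>w | (u, v) \<in> set (unshuffles w). nc_coeff f w * of_nat (count_list (unshuffles w) (u, v)))"

definition grouplike :: "('x, 'k::ring_1) ncs \<Rightarrow> bool"
  where "grouplike f \<longleftrightarrow>
    nc_coeff f [] = 1 \<and> (\<forall>u v. nc_coprod f u v = nc_coeff f u * nc_coeff f v)"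

text \<open>
  \<open>T1 i\<close> stands for \<open>t\<^sup>1\<^sup>i\<close> and \<open>T a i j\<close> for \<open>t(a)\<^sup>i\<^sup>j\<close>; residue classes modulo \<open>N\<close> are
  represented by the integers in \<open>{0..<N}\<close>.
\<close>
datatype tgen = T1 nat | T int nat nat

definition tgens :: "nat \<Rightarrow> nat \<Rightarrow> tgen set"
  where "tgens n N = {T1 i | i. i \<in> {2..n}} \<union>
    {T a i j | a i j. a \<in> {0..<int N} \<and> i \<in> {2..n} \<and> j \<in> {2..n} \<and> i \<noteq> j}"

definition t1 :: "nat \<Rightarrow> (tgen, 'k::ring_1) ncs"
  where "t1 i = nc_var (T1 i)"

definition tt :: "nat \<Rightarrow> int \<Rightarrow> nat \<Rightarrow> nat \<Rightarrow> (tgen, 'k::ring_1) ncs"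
  where "tt N a i j = nc_var (T (a mod int N) i j)"

definition ttsum :: "nat \<Rightarrow> nat \<Rightarrow> nat \<Rightarrow> (tgen, 'k::ring_1) ncs"
  where "ttsum N i j = (\<Sum>c\<in>{0..<int N}. tt N c i j)"

text \<open>
  In each family only the indices that actually occur are required to be distinct elements of
  \<open>{2..n}\<close>.
\<close>
definition trels :: "nat \<Rightarrow> nat \<Rightarrow> (tgen, 'k::ring_1) ncs set"
  where "trels n N =
    {tt N a i j - tt N (- a) j i | a i j. distinct [i, j] \<and> {i, j} \<subseteq> {2..n}} \<union>
    {nc_lie (tt N a i j) (tt N (a + b) i k + tt N b j k) | a b i j k.
      distinct [i, j, k] \<and> {i, j, k} \<subseteq> {2..n}} \<union>
    {nc_lie (t1 i + t1 j + ttsum N i j) (tt N a i j) | a i j.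
      distinct [i, j] \<and> {i, j} \<subseteq> {2..n}} \<union>
    {nc_lie (t1 i) (t1 j + ttsum N i j) | i j. distinct [i, j] \<and> {i, j} \<subseteq> {2..n}} \<union>
    {nc_lie (t1 i) (tt N a j k) | a i j k. distinct [i, j, k] \<and> {i, j, k} \<subseteq> {2..n}} \<union>
    {nc_lie (tt N a i j) (tt N b k l) | a b i j k l.
      distinct [i, j, k, l] \<and> {i, j, k, l} \<subseteq> {2..n}}"

inductive_set nc_ideal :: "'x set \<Rightarrow> ('x, 'k::ring_1) ncs set \<Rightarrow> ('x, 'k) ncs set"
  for X :: "'x set" and R :: "('x, 'k) ncs set"
  where
    zero: "0 \<in> nc_ideal X R"
  | gen: "r \<in> R \<Longrightarrow> p \<in> nc_over X \<Longrightarrow> q \<in> nc_over X \<Longrightarrow> p * r * q \<in> nc_ideal X R"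
  | add: "f \<in> nc_ideal X R \<Longrightarrow> g \<in> nc_ideal X R \<Longrightarrow> f + g \<in> nc_ideal X R"

text \<open>Closure in the topology defined by the grading in which letters have degree 1.\<close>
definition nc_closure :: "('x, 'k::ring_1) ncs set \<Rightarrow> ('x, 'k) ncs set"
  where "nc_closure I = {f. \<forall>d. \<exists>g\<in>I. \<forall>w. length w \<le> d \<longrightarrow> nc_coeff f w = nc_coeff g w}"

text \<open>
  A Lie algebra given by generators and relations has as enveloping algebra the associative
  algebra with the same generators and relations, brackets being read as commutators. The
  completed enveloping algebra of \<open>t\<^sub>n\<^sub>,\<^sub>N\<close> is thus the quotient of the series
  in \<open>tgens n N\<close> by the closed ideal generated by \<open>trels n N\<close>, and \<open>U_eq n N\<close> is equality in that
  quotient. The enveloping algebra of the Lie subalgebra \<open>t\<^sup>0\<^sub>n\<^sub>,\<^sub>N\<close> (no generator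
  \<open>t\<^sup>1\<^sup>n\<close>) embeds in it, so \<open>U_eq n N\<close> is also equality in \<open>exp t\<^sup>0\<^sub>n\<^sub>,\<^sub>N\<close>.
\<close>
definition U_eq :: "nat \<Rightarrow> nat \<Rightarrow> (tgen, 'k::ring_1) ncs \<Rightarrow> (tgen, 'k) ncs \<Rightarrow> bool"
  where "U_eq n N f g \<longleftrightarrow> f - g \<in> nc_closure (nc_ideal (tgens n N) (trels n N))"

text \<open>
  \<open>t\<^sup>0\<^sub>3\<^sub>,\<^sub>N\<close> is completed free on \<open>A\<close> and the \<open>B(a)\<close>, so its completed
  enveloping algebra consists of the series in these letters; \<open>N = 1\<close> gives
  \<open>t\<^sup>0\<^sub>3\<close>, with \<open>B = B(0)\<close>.
\<close>
datatype ab = LA | LB int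

type_synonym 'k ab_series = "(ab, 'k) ncs"

definition exp_t03 :: "nat \<Rightarrow> 'k::ring_1 ab_series set"
  where "exp_t03 N = {f \<in> nc_over ({LA} \<union> LB ` {0..<int N}). grouplike f}"

definition sA :: "'k::ring_1 ab_series"
  where "sA = nc_var LA"

definition sB :: "nat \<Rightarrow> int \<Rightarrow> 'k::ring_1 ab_series"
  where "sB N a = nc_var (LB (a mod int N))"

definition sC :: "nat \<Rightarrow> 'k::ring_1 ab_series"
  where "sC N = - sA - (\<Sum>a\<in>{0..<int N}. sB N a)"

text \<open>\<open>hsub h X Y\<close> is \<open>h(X | Y\<^sub>i)\<close>, and \<open>gsub g X Y\<close> is \<open>g(X, Y)\<close>.\<close>
definition hsub :: "'k::ring_1 ab_series \<Rightarrow> ('y, 'k) ncs \<Rightarrow> (int \<Rightarrow> ('y, 'k) ncs) \<Rightarrow> ('y, 'k) ncs"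
  where "hsub h X Y = nc_subst (\<lambda>l. case l of LA \<Rightarrow> X | LB i \<Rightarrow> Y i) h"

definition gsub :: "'k::ring_1 ab_series \<Rightarrow> ('y, 'k) ncs \<Rightarrow> ('y, 'k) ncs \<Rightarrow> ('y, 'k) ncs"
  where "gsub g X Y = hsub g X (\<lambda>_. Y)"

definition tau :: "nat \<Rightarrow> int \<Rightarrow> 'k::ring_1 ab_series \<Rightarrow> 'k ab_series"
  where "tau N a h = hsub h sA (\<lambda>c. sB N (c + a))"

definition GRT1 :: "'k::field_char_0 ab_series set"
  where "GRT1 = {g \<in> exp_t03 1.
    (let A = sA; B = sB 1 0; C = sC 1; t = tt 1 0 in
      gsub g A B * gsub g B A = 1 \<and>
      gsub g C A * gsub g B C * gsub g A B = 1 \<and>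
      A + nc_inv (gsub g A B) * B * gsub g A B + nc_inv (gsub g A C) * C * gsub g A C = 0 \<and>
      U_eq 4 1
        (gsub g (t1 2) (t 2 3 + t 2 4) * gsub g (t1 3 + t 2 3) (t 3 4))
        (gsub g (t 2 3) (t 3 4) * gsub g (t1 2 + t1 3) (t 2 4 + t 3 4) * gsub g (t1 2) (t 2 3)))}"

definition mixed_pentagon :: "nat \<Rightarrow> 'k::field_char_0 ab_series \<Rightarrow> 'k ab_series \<Rightarrow> bool"
  where "mixed_pentagon N g h \<longleftrightarrow>
    U_eq 4 N
      (hsub h (t1 2) (\<lambda>a. tt N a 2 3 + tt N a 2 4) *
       hsub h (t1 3 + ttsum N 2 3) (\<lambda>a. tt N a 3 4))
      (gsub g (tt N 0 2 3) (tt N 0 3 4) *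
       hsub h (t1 2 + t1 3 + ttsum N 2 3) (\<lambda>a. tt N a 2 4 + tt N a 3 4) *
       hsub h (t1 2) (\<lambda>a. tt N a 2 3))"

definition octagon :: "nat \<Rightarrow> 'k::field_char_0 ab_series \<Rightarrow> bool"
  where "octagon N h \<longleftrightarrow>
    nc_inv (hsub h sA (\<lambda>i. sB N (i + 1))) *
    hsub h (sC N) (\<lambda>i. sB N (1 - i)) *
    nc_inv (hsub h (sC N) (\<lambda>i. sB N (- i))) *
    hsub h sA (\<lambda>i. sB N i) = 1"

definition special_action :: "nat \<Rightarrow> 'k::field_char_0 ab_series \<Rightarrow> bool"
  where "special_action N h \<longleftrightarrow>
    sA + (\<Sum>a\<in>{0..<int N}. nc_Ad (tau N a (nc_inv h)) (sB N a)) +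
    nc_Ad (nc_inv h * hsub h (sC N) (\<lambda>i. sB N (- i))) (sC N) = 0"

definition GRTM :: "nat \<Rightarrow> ('k::field_char_0 ab_series \<times> 'k ab_series) set"
  where "GRTM N = {(g, h). g \<in> GRT1 \<and> h \<in> exp_t03 N \<and> nc_coeff h [LB 0] = 0 \<and>
    mixed_pentagon N g h \<and> octagon N h \<and> special_action N h}"

definition GRTM_mult ::
  "nat \<Rightarrow> 'k::field_char_0 ab_series \<times> 'k ab_series \<Rightarrow> 'k ab_series \<times> 'k ab_series \<Rightarrow> 'k ab_series \<times> 'k ab_series"
  where "GRTM_mult N = (\<lambda>(g\<^sub>1, h\<^sub>1) (g\<^sub>2, h\<^sub>2).
    (gsub g\<^sub>2 sA (sB 1 0) * gsub g\<^sub>1 sA (nc_Ad (nc_inv g\<^sub>2) (sB 1 0)),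
     h\<^sub>2 * hsub h\<^sub>1 sA (\<lambda>i. nc_Ad (tau N i (nc_inv h\<^sub>2)) (sB N i))))"

definition GRTM_group :: "nat \<Rightarrow> ('k::field_char_0 ab_series \<times> 'k ab_series) monoid"
  where "GRTM_group N = \<lparr>carrier = GRTM N, mult = GRTM_mult N, one = (1, 1)\<rparr>"

end

(*
For h in exp t^0_{3,N} let S_h be the endomorphism A -> A, B(i) -> Ad(tau_i h^{-1})(B(i)). Then
h1 o h2 = h2 S_{h2}(h1) satisfies S_{h1 o h2} = S_{h2} S_{h1}, which makes exp t^0_{3,N} a group; inverses
are fixed points of the contraction x -> S_x(h^{-1}). Let theta be A -> C, B(i) -> B(-i), and put
k_h = h^{-1} theta(h). The octagon says that k_h is invariant under tau_1 and the special action condition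
that S_h(C) = Ad(k_h)(C); both pass to products because theta S_h = Ad(k_h^{-1}) S_h theta implies
k_{h1 o h2} = S_{h2}(k_{h1}) k_{h2}. The 2-cycle and hexagon relations of GRT_1 are treated in the same way.

For the pentagons, a solution (g, h) transforms every system of elements satisfying the relations of t_{4,N}
into another such system, by conjugating each generator with the associators along a path of parenthesisations.
The pentagon of (g', h') on the transformed system is equivalent to the pentagon of (g', h') o (g, h) on the
original one. Since the transformed generators agree with the original ones to leading order, an identity that
holds in the transformed universal system holds in the universal system, so the equivalence also covers inverses.
*)
theory Submission
  imports Defs
begin

section \<open>Series and continuous homomorphisms\<close>

text \<open>Evaluation of series is set up for arbitrary complete filtered algebras because three
  targets occur: series themselves, the tensor square that carries the coproduct, and the quotient
  for t_{4,N}. The coefficient of \<open>A\<close> in \<open>h\<close> vanishes; this is derived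
  from the mixed pentagon. Consequently \<open>h\<close> does not notice when something commuting
  with all its arguments is added to the first one. So inside t_{4,N} the element C = -A -
  \<Sum>B(a) may be replaced by any element that completes the sum of the arguments to one commuting
  with them, and this is how the octagon and the special action condition, which concern a free
  algebra, act on systems in which no such C is singled out. The obstacle on the side of the
  pentagons is that passing to the transformed generators is not visibly injective: the target is a
  quotient and no inverse transformation is at hand. Injectivity is replaced by approximation: an
  element that evaluates to 0 is congruent to elements of ever higher degree, and the ideal of
  relations is closed.\<close>

lemma nc_coeff_zero [simp]: "nc_coeff 0 w = 0"
  and nc_coeff_one: "nc_coeff 1 w = (if w = [] then 1 else 0)"
  and nc_coeff_add [simp]: "nc_coeff (f + g) w = nc_coeff f w + nc_coeff g w"
  and nc_coeff_uminus [simp]: "nc_coeff (- f) w = - nc_coeff f w"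
  and nc_coeff_diff [simp]: "nc_coeff (f - g) w = nc_coeff f w - nc_coeff g w"
  and nc_coeff_mult:
    "nc_coeff (f * g) w = (\<Sum>i\<le>length w. nc_coeff f (take i w) * nc_coeff g (drop i w))"
  and nc_coeff_var: "nc_coeff (nc_var x) w = (if w = [x] then 1 else 0)"
  by (simp_all add: zero_ncs_def one_ncs_def plus_ncs_def uminus_ncs_def minus_ncs_def
      times_ncs_def nc_var_def)

lemma nc_coeff_sum: "nc_coeff (sum f A) w = (\<Sum>a\<in>A. nc_coeff (f a) w)"
  by (induction A rule: infinite_finite_induct) auto

text \<open>The type of series carries no scalar multiplication, so scalars act as constant series.
  With series as coefficients the same map is later the second tensor factor.\<close>

definition nc_const :: "'k::ring_1 \<Rightarrow> ('x, 'k) ncs"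
  where "nc_const c = Abs_ncs (\<lambda>w. if w = [] then c else 0)"

lemma nc_coeff_const: "nc_coeff (nc_const c) w = (if w = [] then c else 0)"
  by (simp add: nc_const_def)

lemma nc_coeff_const_mult [simp]: "nc_coeff (nc_const c * f) w = c * nc_coeff f w"
proof -
  have "nc_coeff (nc_const c * f) w = (\<Sum>i\<le>length w. if i = 0 then c * nc_coeff f w else 0)"
    unfolding nc_coeff_mult by (rule sum.cong) (auto simp: nc_coeff_const)
  then show ?thesis by simp
qed

lemma nc_coeff_mult_const [simp]: "nc_coeff (f * nc_const c) w = nc_coeff f w * c"
proof -
  have "nc_coeff (f * nc_const c) w = (\<Sum>i\<le>length w. if i = length w then nc_coeff f w * c else 0)"
    unfolding nc_coeff_mult by (rule sum.cong) (auto simp: nc_coeff_const)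
  then show ?thesis by simp
qed

lemma nc_const_0 [simp]: "nc_const 0 = 0"
  and nc_const_1 [simp]: "nc_const 1 = 1"
  and nc_const_add: "nc_const (a + b) = nc_const a + nc_const b"
  and nc_const_mult: "nc_const (a * b) = nc_const a * nc_const b"
  by (rule ncs_eqI, simp add: nc_coeff_const nc_coeff_one)+

lemma nc_coeff_mult_Nil: "nc_coeff (f * g) [] = nc_coeff f [] * nc_coeff g []"
  by (simp add: nc_coeff_mult)

lemma nc_coeff_mult_single:
  "nc_coeff (f * g) [x] = nc_coeff f [] * nc_coeff g [x] + nc_coeff f [x] * nc_coeff g []"
  by (simp add: nc_coeff_mult)

section \<open>Degree filtration, alphabets and truncation\<close>

definition nc_deg :: "nat \<Rightarrow> ('x, 'k::ring_1) ncs set"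
  where "nc_deg n = {f. \<forall>w. length w < n \<longrightarrow> nc_coeff f w = 0}"

lemma nc_degD: "f \<in> nc_deg n \<Longrightarrow> length w < n \<Longrightarrow> nc_coeff f w = 0"
  by (simp add: nc_deg_def)

lemma nc_deg_mult:
  fixes f g :: "('x, 'k::ring_1) ncs"
  shows "f \<in> nc_deg m \<Longrightarrow> g \<in> nc_deg n \<Longrightarrow> f * g \<in> nc_deg (m + n)"
  unfolding nc_deg_def nc_coeff_mult mem_Collect_eq
proof (intro allI impI sum.neutral ballI)
  fix w :: "'x list" and i
  assume f: "\<forall>w. length w < m \<longrightarrow> nc_coeff f w = 0" and g: "\<forall>w. length w < n \<longrightarrow> nc_coeff g w = 0"
    and w: "length w < m + n" and i: "i \<in> {..length w}"
  show "nc_coeff f (take i w) * nc_coeff g (drop i w) = 0"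
    using f[rule_format, of "take i w"] g[rule_format, of "drop i w"] w i
    by (cases "i < m") auto
qed

lemma nc_deg_Suc_0_iff: "f \<in> nc_deg (Suc 0) \<longleftrightarrow> nc_coeff f [] = 0"
  by (auto simp: nc_deg_def)

lemma nc_var_deg [simp]: "nc_var x \<in> nc_deg (Suc 0)"
  by (simp add: nc_deg_def nc_coeff_var)

lemma nc_overD: "f \<in> nc_over X \<Longrightarrow> \<not> set w \<subseteq> X \<Longrightarrow> nc_coeff f w = 0"
  by (auto simp: nc_over_def)

lemma nc_over_mono: "f \<in> nc_over X \<Longrightarrow> X \<subseteq> Y \<Longrightarrow> f \<in> nc_over Y"
  by (force simp: nc_over_def)

lemma nc_over_UNIV [simp]: "f \<in> nc_over UNIV"
  by (simp add: nc_over_def)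

lemma nc_over_zero [simp]: "0 \<in> nc_over X"
  and nc_over_one [simp]: "1 \<in> nc_over X"
  and nc_over_const [simp]: "nc_const c \<in> nc_over X"
  and nc_over_var: "x \<in> X \<Longrightarrow> nc_var x \<in> nc_over X"
  by (auto simp: nc_over_def nc_coeff_one nc_coeff_const nc_coeff_var split: if_splits)

lemma nc_over_add: "f \<in> nc_over X \<Longrightarrow> g \<in> nc_over X \<Longrightarrow> f + g \<in> nc_over X"
  unfolding nc_over_def mem_Collect_eq nc_coeff_add by (metis add_0)

lemma nc_over_uminus: "f \<in> nc_over X \<Longrightarrow> - f \<in> nc_over X"
  by (simp add: nc_over_def)

lemma nc_over_diff: "f \<in> nc_over X \<Longrightarrow> g \<in> nc_over X \<Longrightarrow> f - g \<in> nc_over X"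
  using nc_over_add[of f X "- g"] by (simp add: nc_over_uminus)

lemma nc_over_mult:
  assumes "f \<in> nc_over X" "g \<in> nc_over X" shows "f * g \<in> nc_over X"
  unfolding nc_over_def mem_Collect_eq
proof (intro allI impI)
  fix w assume "nc_coeff (f * g) w \<noteq> 0"
  then obtain i where "nc_coeff f (take i w) * nc_coeff g (drop i w) \<noteq> 0"
    unfolding nc_coeff_mult by (meson sum.neutral)
  then have "set (take i w) \<subseteq> X" "set (drop i w) \<subseteq> X"
    using assms nc_overD by fastforce+
  then show "set w \<subseteq> X"
    by (metis append_take_drop_id set_append Un_least)
qed

lemma nc_over_sum: "(\<And>a. a \<in> A \<Longrightarrow> f a \<in> nc_over X) \<Longrightarrow> sum f A \<in> nc_over X"
  by (induction A rule: infinite_finite_induct) (auto simp: nc_over_add)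

lemma nc_over_prod_list: "(\<And>x. x \<in> set w \<Longrightarrow> \<phi> x \<in> nc_over X) \<Longrightarrow> prod_list (map \<phi> w) \<in> nc_over X"
  by (induction w) (auto simp: nc_over_mult)

text \<open>A relation rather than an operation: \<open>nc_inv\<close> is a definite description,
  and its values are obtained from two-sided inverses already known.\<close>

definition is_inverse :: "'r::ring_1 \<Rightarrow> 'r \<Rightarrow> bool"
  where "is_inverse u v \<longleftrightarrow> u * v = 1 \<and> v * u = 1"

definition words :: "'x set \<Rightarrow> nat \<Rightarrow> 'x list set"
  where "words X m = {w. set w \<subseteq> X \<and> length w < m}"

lemma finite_words [simp]: "finite X \<Longrightarrow> finite (words X m)"
  unfolding words_def
  by (rule finite_subset[OF _ finite_lists_length_le[of X m]]) auto

lemma nc_coeff_word: "nc_coeff (prod_list (map nc_var w)) v = (if v = w then 1 else (0 :: 'k::ring_1))"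
proof (induction w arbitrary: v)
  case (Cons x w)
  show ?case
  proof (cases v)
    case Nil
    then show ?thesis by (simp add: nc_coeff_mult nc_coeff_var)
  next
    case v: (Cons y u)
    have "nc_coeff (prod_list (map nc_var (x # w))) v
      = (\<Sum>i\<le>length v. if i = 1 then (if v = x # w then 1 else (0 :: 'k)) else 0)" (is "_ = ?r")
      unfolding list.map prod_list.Cons nc_coeff_mult
      by (rule sum.cong[OF refl]) (auto simp: nc_coeff_var Cons.IH v take_Cons drop_Cons split: nat.splits)
    also have "?r = (if v = x # w then 1 else 0)"
      by (subst sum.delta) (auto simp: v)
    finally show ?thesis .
  qed
qed (simp add: nc_coeff_one)

text \<open>In finitely many letters there are finitely many words of length below \<open>m\<close>,
  so every series is a limit of polynomials; continuity then carries identities from letters to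
  series.\<close>

lemma nc_trunc_diff_deg:
  fixes f :: "('x, 'k::ring_1) ncs"
  assumes "finite X" "f \<in> nc_over X"
  shows "f - (\<Sum>w\<in>words X m. nc_const (nc_coeff f w) * prod_list (map nc_var w)) \<in> nc_deg m"
  unfolding nc_deg_def mem_Collect_eq
proof (intro allI impI)
  fix v :: "'x list" assume "length v < m"
  then have "(\<Sum>w\<in>words X m. if v = w then nc_coeff f w else 0) = nc_coeff f v"
    using assms by (subst sum.delta'[OF finite_words]) (auto simp: words_def dest: nc_overD)
  moreover have "(\<Sum>w\<in>words X m. nc_coeff f w * (if v = w then 1 else 0))
      = (\<Sum>w\<in>words X m. if v = w then nc_coeff f w else 0)"
    by (rule sum.cong) auto
  ultimately show "nc_coeff (f - (\<Sum>w\<in>words X m. nc_const (nc_coeff f w) * prod_list (map nc_var w))) v = 0"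
    by (simp add: nc_coeff_sum nc_coeff_word)
qed

section \<open>Evaluation of series in complete filtered algebras\<close>

locale complete_filtered_algebra =
  fixes fil :: "nat \<Rightarrow> 'r::ring_1 set" and sc :: "'k::comm_ring_1 \<Rightarrow> 'r"
  assumes fil_0 [simp]: "x \<in> fil 0"
    and fil_Suc: "x \<in> fil (Suc n) \<Longrightarrow> x \<in> fil n"
    and fil_zero [simp]: "0 \<in> fil n"
    and fil_add: "x \<in> fil n \<Longrightarrow> y \<in> fil n \<Longrightarrow> x + y \<in> fil n"
    and fil_mult: "x \<in> fil m \<Longrightarrow> y \<in> fil n \<Longrightarrow> x * y \<in> fil (m + n)"
    and fil_hausdorff: "(\<And>n. x \<in> fil n) \<Longrightarrow> x = 0"
    and fil_complete: "(\<And>n. u n \<in> fil n) \<Longrightarrow> \<exists>s. \<forall>m. s - (\<Sum>n<m. u n) \<in> fil m"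
    and sc_0 [simp]: "sc 0 = 0" and sc_1 [simp]: "sc 1 = 1"
    and sc_add: "sc (a + b) = sc a + sc b" and sc_mult: "sc (a * b) = sc a * sc b"
    and sc_central: "sc a * x = x * sc a"
begin

lemma fil_mult_left: "x \<in> fil n \<Longrightarrow> y * x \<in> fil n"
  using fil_mult[of y 0 x n] by simp

lemma fil_mult_right: "x \<in> fil n \<Longrightarrow> x * y \<in> fil n"
  using fil_mult[of x n y 0] by simp

lemma fil_conj: "x \<in> fil n \<Longrightarrow> u * x * v \<in> fil n"
  by (intro fil_mult_left fil_mult_right)

lemma fil_uminus: "x \<in> fil n \<Longrightarrow> - x \<in> fil n"
  using fil_mult_left[of x n "- 1"] by simp

lemma fil_diff: "x \<in> fil n \<Longrightarrow> y \<in> fil n \<Longrightarrow> x - y \<in> fil n"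
  using fil_add[of x n "- y"] by (simp add: fil_uminus)

lemma fil_diff_trans: "x - y \<in> fil n \<Longrightarrow> y - z \<in> fil n \<Longrightarrow> x - z \<in> fil n"
  using fil_add[of "x - y" n "y - z"] by simp

lemma fil_diff_sym: "x - y \<in> fil n \<Longrightarrow> y - x \<in> fil n"
  using fil_uminus[of "x - y" n] by simp

lemma fil_diff_mult: "x - x' \<in> fil n \<Longrightarrow> y - y' \<in> fil n \<Longrightarrow> x * y - x' * y' \<in> fil n"
  using fil_add[OF fil_mult_right[of "x - x'" n y] fil_mult_left[of "y - y'" n x']]
  by (simp add: algebra_simps)

lemma fil_mono: "x \<in> fil n \<Longrightarrow> m \<le> n \<Longrightarrow> x \<in> fil m"
  by (induction n) (auto simp: le_Suc_eq dest: fil_Suc)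

lemma fil_sum: "(\<And>a. a \<in> A \<Longrightarrow> f a \<in> fil n) \<Longrightarrow> sum f A \<in> fil n"
  by (induction A rule: infinite_finite_induct) (auto simp: fil_add)

lemma eqI_fil: "(\<And>n. x - y \<in> fil n) \<Longrightarrow> x = y"
  using fil_hausdorff[of "x - y"] by simp

lemma sc_sum: "sc (sum f A) = (\<Sum>a\<in>A. sc (f a))"
  by (induction A rule: infinite_finite_induct) (auto simp: sc_add)

definition word_ev :: "('x \<Rightarrow> 'r) \<Rightarrow> 'x list \<Rightarrow> 'r"
  where "word_ev \<phi> w = prod_list (map \<phi> w)"

lemma word_ev_append: "word_ev \<phi> (u @ v) = word_ev \<phi> u * word_ev \<phi> v"
  by (simp add: word_ev_def)

lemma word_ev_fil:
  assumes "\<And>x. x \<in> set w \<Longrightarrow> \<phi> x \<in> fil (Suc 0)" shows "word_ev \<phi> w \<in> fil (length w)"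
  using assms
proof (induction w)
  case (Cons x w)
  then show ?case using fil_mult[of "\<phi> x" "Suc 0" "word_ev \<phi> w" "length w"] by (simp add: word_ev_def)
qed simp

text \<open>Words are grouped by length because \<open>fil_complete\<close> sums a sequence whose
  n-th term lies in \<open>fil n\<close>. Selecting words by their nonzero coefficients keeps
  \<open>ev\<close> independent of the alphabet that a proof chooses.\<close>

definition ev_hom_part :: "('x \<Rightarrow> 'r) \<Rightarrow> ('x, 'k) ncs \<Rightarrow> nat \<Rightarrow> 'r"
  where "ev_hom_part \<phi> f n = (\<Sum>w | nc_coeff f w \<noteq> 0 \<and> length w = n. sc (nc_coeff f w) * word_ev \<phi> w)"

text \<open>As for \<^const>\<open>nc_subst\<close>, the value is meaningful for series in finitely many letters, each sent
  into \<open>fil 1\<close>.\<close>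
definition ev :: "('x \<Rightarrow> 'r) \<Rightarrow> ('x, 'k) ncs \<Rightarrow> 'r"
  where "ev \<phi> f = (THE s. \<forall>m. s - (\<Sum>n<m. ev_hom_part \<phi> f n) \<in> fil m)"

definition ev_trunc :: "'x set \<Rightarrow> ('x \<Rightarrow> 'r) \<Rightarrow> ('x, 'k) ncs \<Rightarrow> nat \<Rightarrow> 'r"
  where "ev_trunc X \<phi> f m = (\<Sum>w\<in>words X m. sc (nc_coeff f w) * word_ev \<phi> w)"

lemma sum_ev_hom_part:
  assumes "finite X" "f \<in> nc_over X"
  shows "(\<Sum>n<m. ev_hom_part \<phi> f n) = ev_trunc X \<phi> f m"
proof -
  have "ev_hom_part \<phi> f n = (\<Sum>w\<in>{w. set w \<subseteq> X \<and> length w = n}. sc (nc_coeff f w) * word_ev \<phi> w)" for n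
    unfolding ev_hom_part_def
    by (rule sum.mono_neutral_left) (use assms finite_lists_length_eq[of X n] in \<open>auto simp: nc_over_def\<close>)
  then have "(\<Sum>n<m. ev_hom_part \<phi> f n)
      = (\<Sum>(n, w)\<in>(SIGMA n:{..<m}. {w. set w \<subseteq> X \<and> length w = n}). sc (nc_coeff f w) * word_ev \<phi> w)"
    using finite_lists_length_eq[OF assms(1)] by (simp add: sum.Sigma)
  also have "\<dots> = ev_trunc X \<phi> f m"
    unfolding ev_trunc_def
    by (rule sum.reindex_bij_witness[of _ "\<lambda>w. (length w, w)" snd]) (auto simp: words_def)
  finally show ?thesis .
qed

text \<open>The Hausdorff property makes the limit unique, so a value of \<open>ev\<close> is found
  by exhibiting a candidate and estimating its distance to the finite truncations.\<close>

lemma ev_eqI: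
  assumes "finite X" "f \<in> nc_over X" "\<And>m. s - ev_trunc X \<phi> f m \<in> fil m"
  shows "ev \<phi> f = s"
  unfolding ev_def
proof (rule the_equality)
  show "\<forall>m. s - (\<Sum>n<m. ev_hom_part \<phi> f n) \<in> fil m"
    using assms by (simp add: sum_ev_hom_part)
next
  fix s' assume "\<forall>m. s' - (\<Sum>n<m. ev_hom_part \<phi> f n) \<in> fil m"
  then have "s' - ev_trunc X \<phi> f m \<in> fil m" for m
    using assms by (simp add: sum_ev_hom_part)
  then show "s' = s"
    using assms(3) by (intro eqI_fil) (metis fil_diff_trans fil_diff_sym)
qed

lemma ev_trunc_fil:
  assumes "finite X" "f \<in> nc_over X" "\<And>x. x \<in> X \<Longrightarrow> \<phi> x \<in> fil (Suc 0)"
  shows "ev \<phi> f - ev_trunc X \<phi> f m \<in> fil m"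
proof -
  have "ev_hom_part \<phi> f n \<in> fil n" for n
    unfolding ev_hom_part_def
    using assms by (intro fil_sum fil_mult_left) (auto simp: nc_over_def intro!: word_ev_fil)
  then obtain s where s: "\<And>m. s - ev_trunc X \<phi> f m \<in> fil m"
    using fil_complete[of "ev_hom_part \<phi> f"] assms by (auto simp: sum_ev_hom_part)
  then show ?thesis using ev_eqI[OF assms(1,2)] by metis
qed

lemma ev_cong:
  assumes "finite X" "f \<in> nc_over X" "\<And>x. x \<in> X \<Longrightarrow> \<phi> x \<in> fil (Suc 0)" "\<And>x. x \<in> X \<Longrightarrow> \<phi> x = \<psi> x"
  shows "ev \<phi> f = ev \<psi> f"
proof (rule ev_eqI[symmetric, OF assms(1,2)])
  have "word_ev \<phi> w = word_ev \<psi> w" if "set w \<subseteq> X" for w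
    unfolding word_ev_def using that assms(4) by (metis map_cong subsetD)
  then have "ev_trunc X \<phi> f m = ev_trunc X \<psi> f m" for m
    unfolding ev_trunc_def by (intro sum.cong) (auto simp: words_def)
  then show "ev \<phi> f - ev_trunc X \<psi> f m \<in> fil m" for m
    using ev_trunc_fil[where \<phi> = \<phi> and m = m, OF assms(1-3)] by metis
qed

lemma sum_words_append:
  assumes "finite X"
  shows "(\<Sum>w\<in>words X m. \<Sum>i\<le>length w. F (take i w) (drop i w))
    = (\<Sum>(u, v)\<in>{(u, v). u \<in> words X m \<and> v \<in> words X m \<and> length u + length v < m}. (F u v :: 'r))"
proof -
  have "(\<Sum>w\<in>words X m. \<Sum>i\<le>length w. F (take i w) (drop i w))
      = (\<Sum>(w, i)\<in>(SIGMA w:words X m. {..length w}). F (take i w) (drop i w))"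
    using assms by (simp add: sum.Sigma)
  also have "\<dots> = (\<Sum>(u, v)\<in>{(u, v). u \<in> words X m \<and> v \<in> words X m \<and> length u + length v < m}. F u v)"
    by (rule sum.reindex_bij_witness[of _ "\<lambda>(u, v). (u @ v, length u)" "\<lambda>(w, i). (take i w, drop i w)"])
       (auto simp: words_def dest: in_set_takeD in_set_dropD)
  finally show ?thesis .
qed

lemma ev_add:
  assumes "finite X" "f \<in> nc_over X" "g \<in> nc_over X" "\<And>x. x \<in> X \<Longrightarrow> \<phi> x \<in> fil (Suc 0)"
  shows "ev \<phi> (f + g) = ev \<phi> f + ev \<phi> g"
proof (rule ev_eqI[OF assms(1) nc_over_add[OF assms(2,3)]])
  fix m :: nat
  have "ev_trunc X \<phi> (f + g) m = ev_trunc X \<phi> f m + ev_trunc X \<phi> g m"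
    by (simp add: ev_trunc_def sc_add distrib_right sum.distrib)
  then have "ev \<phi> f + ev \<phi> g - ev_trunc X \<phi> (f + g) m = (ev \<phi> f - ev_trunc X \<phi> f m) + (ev \<phi> g - ev_trunc X \<phi> g m)"
    by simp
  also have "\<dots> \<in> fil m"
    using assms by (intro fil_add ev_trunc_fil)
  finally show "ev \<phi> f + ev \<phi> g - ev_trunc X \<phi> (f + g) m \<in> fil m" .
qed

lemma ev_mult:
  assumes "finite X" "f \<in> nc_over X" "g \<in> nc_over X" "\<And>x. x \<in> X \<Longrightarrow> \<phi> x \<in> fil (Suc 0)"
  shows "ev \<phi> (f * g) = ev \<phi> f * ev \<phi> g"
proof (rule ev_eqI[OF assms(1) nc_over_mult[OF assms(2,3)]])
  fix m :: nat
  let ?F = "\<lambda>u v. (sc (nc_coeff f u) * word_ev \<phi> u) * (sc (nc_coeff g v) * word_ev \<phi> v)"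
  \<comment> \<open>Pairs whose concatenation has length below \<open>m\<close>: these are the
    factorisations that occur in the truncated product. The other pairs of short words contribute
    only to \<open>fil m\<close>.\<close>
  let ?D = "{(u, v). u \<in> words X m \<and> v \<in> words X m \<and> length u + length v < m}"
  have fin: "finite (words X m \<times> words X m)" using assms by simp
  have "ev_trunc X \<phi> (f * g) m = (\<Sum>w\<in>words X m. \<Sum>i\<le>length w. ?F (take i w) (drop i w))"
    unfolding ev_trunc_def nc_coeff_mult sc_sum sum_distrib_right
  proof (intro sum.cong refl)
    fix w and i :: nat
    have "sc (nc_coeff f (take i w) * nc_coeff g (drop i w)) * word_ev \<phi> w
        = sc (nc_coeff f (take i w)) * (sc (nc_coeff g (drop i w)) * word_ev \<phi> (take i w)) * word_ev \<phi> (drop i w)"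
      by (metis sc_mult word_ev_append append_take_drop_id mult.assoc)
    then show "sc (nc_coeff f (take i w) * nc_coeff g (drop i w)) * word_ev \<phi> w
        = sc (nc_coeff f (take i w)) * word_ev \<phi> (take i w) * (sc (nc_coeff g (drop i w)) * word_ev \<phi> (drop i w))"
      by (simp only: sc_central[of "nc_coeff g (drop i w)" "word_ev \<phi> (take i w)"] mult.assoc)
  qed
  also have "\<dots> = (\<Sum>(u, v)\<in>?D. ?F u v)"
    by (rule sum_words_append[OF assms(1)])
  finally have T: "ev_trunc X \<phi> (f * g) m = (\<Sum>(u, v)\<in>?D. ?F u v)" .
  have "ev_trunc X \<phi> f m * ev_trunc X \<phi> g m = (\<Sum>(u, v)\<in>words X m \<times> words X m. ?F u v)"
    by (simp add: ev_trunc_def sum_product sum.cartesian_product)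
  also have "\<dots> = (\<Sum>(u, v)\<in>(words X m \<times> words X m - ?D). ?F u v) + (\<Sum>(u, v)\<in>?D. ?F u v)"
    by (rule sum.subset_diff[OF _ fin]) auto
  finally have "ev_trunc X \<phi> f m * ev_trunc X \<phi> g m - ev_trunc X \<phi> (f * g) m
      = (\<Sum>(u, v)\<in>(words X m \<times> words X m - ?D). ?F u v)"
    using T by simp
  also have "\<dots> \<in> fil m"
  proof (rule fil_sum)
    fix p assume p: "p \<in> words X m \<times> words X m - ?D"
    obtain u v where uv: "p = (u, v)" by (cases p)
    have "word_ev \<phi> u \<in> fil (length u)" "word_ev \<phi> v \<in> fil (length v)"
      using p uv assms(4) by (auto simp: words_def intro!: word_ev_fil)
    then have "?F u v \<in> fil (length u + length v)"
      by (intro fil_mult fil_mult_left)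
    then show "(case p of (u, v) \<Rightarrow> ?F u v) \<in> fil m"
      using p uv by (auto intro: fil_mono)
  qed
  finally have 1: "ev_trunc X \<phi> f m * ev_trunc X \<phi> g m - ev_trunc X \<phi> (f * g) m \<in> fil m" .
  have "ev \<phi> f - ev_trunc X \<phi> f m \<in> fil m" "ev \<phi> g - ev_trunc X \<phi> g m \<in> fil m"
    using assms by (auto intro!: ev_trunc_fil)
  from fil_diff_trans[OF fil_diff_mult[OF this] 1]
  show "ev \<phi> f * ev \<phi> g - ev_trunc X \<phi> (f * g) m \<in> fil m" .
qed

lemma ev_deg:
  assumes "finite X" "f \<in> nc_over X" "\<And>x. x \<in> X \<Longrightarrow> \<phi> x \<in> fil (Suc 0)" "f \<in> nc_deg m"
  shows "ev \<phi> f \<in> fil m"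
proof -
  have "ev_trunc X \<phi> f m = 0"
    unfolding ev_trunc_def using assms(4) by (auto simp: words_def dest: nc_degD intro!: sum.neutral)
  then show ?thesis using ev_trunc_fil[where \<phi> = \<phi> and m = m, OF assms(1-3)] by simp
qed

lemma ev_trunc_one_word:
  assumes "finite X" "w0 \<in> words X m" "\<And>w. w \<noteq> w0 \<Longrightarrow> nc_coeff f w = 0"
  shows "ev_trunc X \<phi> f m = sc (nc_coeff f w0) * word_ev \<phi> w0"
proof -
  have "ev_trunc X \<phi> f m = (\<Sum>w\<in>words X m. if w = w0 then sc (nc_coeff f w0) * word_ev \<phi> w0 else 0)"
    unfolding ev_trunc_def by (rule sum.cong) (use assms in auto)
  then show ?thesis using assms by simp
qed

lemma ev_const [simp]: "ev \<phi> (nc_const c) = sc c"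
proof (rule ev_eqI[of "{}"])
  show "sc c - ev_trunc {} \<phi> (nc_const c) m \<in> fil m" for m
    by (cases m) (simp_all add: ev_trunc_one_word[of "{}" "[]"] words_def nc_coeff_const word_ev_def)
qed auto

lemma ev_one [simp]: "ev \<phi> 1 = 1"
  using ev_const[of \<phi> 1] by simp

lemma ev_zero [simp]: "ev \<phi> 0 = 0"
  using ev_const[of \<phi> 0] by simp

lemma ev_var:
  assumes "\<phi> x \<in> fil (Suc 0)"
  shows "ev \<phi> (nc_var x) = \<phi> x"
proof (rule ev_eqI[of "{x}"])
  fix m :: nat
  \<comment> \<open>At \<open>m = 1\<close> the truncation does not contain the word
    \<open>[x]\<close> yet; there the estimate holds because \<open>\<phi> x\<close> lies in
    \<open>fil 1\<close>.\<close>
  consider "m = 0" | "m = 1" | "m > 1" by linarith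
  then show "\<phi> x - ev_trunc {x} \<phi> (nc_var x) m \<in> fil m"
  proof cases
    case 2
    have "ev_trunc {x} \<phi> (nc_var x) m = 0"
      unfolding ev_trunc_def by (rule sum.neutral) (auto simp: words_def nc_coeff_var 2)
    with 2 assms show ?thesis by simp
  next
    case 3
    then have "ev_trunc {x} \<phi> (nc_var x) m = sc (nc_coeff (nc_var x) [x]) * word_ev \<phi> [x]"
      by (intro ev_trunc_one_word) (auto simp: words_def nc_coeff_var)
    then show ?thesis by (simp add: nc_coeff_var word_ev_def)
  qed auto
qed (simp_all add: nc_over_var)

section \<open>Continuous homomorphisms and their values on letters\<close>

definition continuous_hom :: "'x set \<Rightarrow> (('x, 'k) ncs \<Rightarrow> 'r) \<Rightarrow> bool"
  where "continuous_hom X H \<longleftrightarrow>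
    (\<forall>f\<in>nc_over X. \<forall>g\<in>nc_over X. H (f + g) = H f + H g \<and> H (f * g) = H f * H g) \<and>
    (\<forall>c. H (nc_const c) = sc c) \<and> (\<forall>m. \<forall>f\<in>nc_over X. f \<in> nc_deg m \<longrightarrow> H f \<in> fil m)"

context
  fixes X :: "'x set" and H :: "('x, 'k) ncs \<Rightarrow> 'r"
  assumes H: "continuous_hom X H"
begin

lemma chom_add: "f \<in> nc_over X \<Longrightarrow> g \<in> nc_over X \<Longrightarrow> H (f + g) = H f + H g"
  and chom_mult: "f \<in> nc_over X \<Longrightarrow> g \<in> nc_over X \<Longrightarrow> H (f * g) = H f * H g"
  and chom_const: "H (nc_const c) = sc c"
  and chom_deg: "f \<in> nc_over X \<Longrightarrow> f \<in> nc_deg m \<Longrightarrow> H f \<in> fil m"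
  using H by (auto simp: continuous_hom_def)

lemma chom_0: "H 0 = 0" and chom_1: "H 1 = 1"
  using chom_const[of 0] chom_const[of 1] by simp_all

lemma chom_uminus: "f \<in> nc_over X \<Longrightarrow> H (- f) = - H f"
  using chom_add[of f "- f"] chom_0 by (simp add: nc_over_uminus eq_neg_iff_add_eq_0 add.commute)

lemma chom_diff: "f \<in> nc_over X \<Longrightarrow> g \<in> nc_over X \<Longrightarrow> H (f - g) = H f - H g"
  using chom_add[of f "- g"] chom_uminus[of g] by (simp add: nc_over_uminus)

lemma chom_sum: "(\<And>a. a \<in> A \<Longrightarrow> f a \<in> nc_over X) \<Longrightarrow> H (sum f A) = (\<Sum>a\<in>A. H (f a))"
  by (induction A rule: infinite_finite_induct) (auto simp: chom_0 chom_add nc_over_sum)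

lemma chom_word: "set w \<subseteq> X \<Longrightarrow> H (prod_list (map nc_var w)) = word_ev (\<lambda>x. H (nc_var x)) w"
proof (induction w)
  case (Cons x w)
  have "(prod_list (map nc_var w) :: ('x, 'k) ncs) \<in> nc_over X"
    using Cons.prems by (intro nc_over_prod_list nc_over_var) auto
  then show ?case using Cons by (simp add: chom_mult nc_over_var word_ev_def)
qed (simp add: chom_1 word_ev_def)

text \<open>On polynomials both sides agree by multiplicativity, and the degree condition carries
  this to limits. Identities between homomorphisms thereby reduce to identities on letters.\<close>

lemma chom_eq_ev:
  assumes "finite X" "f \<in> nc_over X"
  shows "H f = ev (\<lambda>x. H (nc_var x)) f"
proof (rule ev_eqI[OF assms, symmetric])
  fix m :: nat
  let ?t = "\<Sum>w\<in>words X m. nc_const (nc_coeff f w) * prod_list (map nc_var w)"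
  have o: "nc_const (nc_coeff f w) * prod_list (map nc_var w) \<in> nc_over X" if "w \<in> words X m" for w
    using that by (intro nc_over_mult nc_over_prod_list nc_over_var nc_over_const) (auto simp: words_def)
  have "H ?t = (\<Sum>w\<in>words X m. H (nc_const (nc_coeff f w) * prod_list (map nc_var w)))"
    using o by (rule chom_sum)
  also have "\<dots> = ev_trunc X (\<lambda>x. H (nc_var x)) f m"
    unfolding ev_trunc_def
  proof (rule sum.cong[OF refl])
    fix w assume w: "w \<in> words X m"
    then have "(prod_list (map nc_var w) :: ('x, 'k) ncs) \<in> nc_over X"
      by (intro nc_over_prod_list nc_over_var) (auto simp: words_def)
    then show "H (nc_const (nc_coeff f w) * prod_list (map nc_var w)) = sc (nc_coeff f w) * word_ev (\<lambda>x. H (nc_var x)) w"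
      using w by (simp add: chom_mult chom_const chom_word words_def)
  qed
  finally have "H f - ev_trunc X (\<lambda>x. H (nc_var x)) f m = H (f - ?t)"
    using assms o by (simp add: chom_diff nc_over_sum)
  also have "\<dots> \<in> fil m"
    using nc_trunc_diff_deg[OF assms] assms o by (intro chom_deg nc_over_diff nc_over_sum) auto
  finally show "H f - ev_trunc X (\<lambda>x. H (nc_var x)) f m \<in> fil m" .
qed

end

lemma continuous_hom_ev:
  assumes "finite X" "\<And>x. x \<in> X \<Longrightarrow> \<phi> x \<in> fil (Suc 0)"
  shows "continuous_hom X (ev \<phi>)"
  unfolding continuous_hom_def using assms by (auto simp: ev_add ev_mult ev_deg)

lemma continuous_hom_conj:
  assumes "continuous_hom X H" "is_inverse u v"
  shows "continuous_hom X (\<lambda>f. u * H f * v)"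
proof -
  have uv: "u * v = 1" "v * u = 1" using assms(2) by (auto simp: is_inverse_def)
  have "u * (a * b) * v = u * a * v * (u * b * v)" for a b
    by (metis mult.assoc uv(2) mult_1_right)
  moreover have "u * sc c * v = sc c" for c
    by (metis mult.assoc sc_central uv(1) mult_1_right)
  ultimately show ?thesis
    using assms(1) unfolding continuous_hom_def
    by (auto simp: distrib_left distrib_right intro!: fil_conj)
qed

text \<open>Conjugation by a unit after \<open>ev \<phi>\<close> is again a continuous homomorphism,
  so its values on the letters determine it.\<close>

lemma ev_conj:
  assumes "finite X" "f \<in> nc_over X" "\<And>x. x \<in> X \<Longrightarrow> \<phi> x \<in> fil (Suc 0)" "is_inverse u v"
  shows "ev (\<lambda>x. u * \<phi> x * v) f = u * ev \<phi> f * v"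
proof -
  have "u * ev \<phi> f * v = ev (\<lambda>x. u * ev \<phi> (nc_var x) * v) f"
    by (rule chom_eq_ev[OF continuous_hom_conj[OF continuous_hom_ev]]) (use assms in auto)
  also have "\<dots> = ev (\<lambda>x. u * \<phi> x * v) f"
    by (rule ev_cong[OF assms(1,2)])
       (use assms(3) in \<open>auto simp: ev_var intro!: fil_conj\<close>)
  finally show ?thesis by simp
qed

lemma ev_commute:
  assumes "finite X" "f \<in> nc_over X" "\<And>x. x \<in> X \<Longrightarrow> \<phi> x \<in> fil (Suc 0)" "\<And>x. x \<in> X \<Longrightarrow> z * \<phi> x = \<phi> x * z"
  shows "z * ev \<phi> f = ev \<phi> f * z"
proof (rule eqI_fil)
  fix m :: nat
  have "z * word_ev \<phi> w = word_ev \<phi> w * z" if "set w \<subseteq> X" for w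
    using that
  proof (induction w)
    case (Cons x w)
    then show ?case using assms(4)[of x] by (simp add: word_ev_def mult.assoc) (metis mult.assoc)
  qed (simp add: word_ev_def)
  then have "z * ev_trunc X \<phi> f m = ev_trunc X \<phi> f m * z"
    unfolding ev_trunc_def sum_distrib_left sum_distrib_right
    by (intro sum.cong refl) (metis (mono_tags, lifting) words_def mem_Collect_eq mult.assoc sc_central)
  then have "z * ev \<phi> f - ev \<phi> f * z = z * (ev \<phi> f - ev_trunc X \<phi> f m) - (ev \<phi> f - ev_trunc X \<phi> f m) * z"
    by (simp add: algebra_simps)
  also have "\<dots> \<in> fil m"
    by (intro fil_diff fil_mult_left[of _ _ z] fil_mult_right[of _ _ z] ev_trunc_fil[where \<phi> = \<phi>, OF assms(1-3)])
  finally show "z * ev \<phi> f - ev \<phi> f * z \<in> fil m" .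
qed

text \<open>Letters are changed one at a time, and each change in a word of length l improves the
  degree from l to l + k. The estimate drives both the contraction that yields inverses and the
  comparison of a transformed system with the original one.\<close>

lemma ev_diff_fil:
  assumes "finite X" "f \<in> nc_over X" "\<And>x. x \<in> X \<Longrightarrow> \<phi> x \<in> fil (Suc 0)" "\<And>x. x \<in> X \<Longrightarrow> \<psi> x \<in> fil (Suc 0)"
    and d: "\<And>x. x \<in> X \<Longrightarrow> \<phi> x - \<psi> x \<in> fil (Suc k)" and f: "f \<in> nc_deg n"
  shows "ev \<phi> f - ev \<psi> f \<in> fil (n + k)"
proof -
  have w: "word_ev \<phi> w - word_ev \<psi> w \<in> fil (length w + k)" if "set w \<subseteq> X" for w
    using that
  proof (induction w)
    case (Cons x w)
    have "word_ev \<phi> (x # w) - word_ev \<psi> (x # w) = (\<phi> x - \<psi> x) * word_ev \<phi> w + \<psi> x * (word_ev \<phi> w - word_ev \<psi> w)"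
      by (simp add: word_ev_def algebra_simps)
    moreover have "(\<phi> x - \<psi> x) * word_ev \<phi> w \<in> fil (Suc k + length w)"
      using Cons.prems assms(3) by (intro fil_mult d word_ev_fil) auto
    moreover have "\<psi> x * (word_ev \<phi> w - word_ev \<psi> w) \<in> fil (Suc 0 + (length w + k))"
      using Cons assms(4) by (intro fil_mult) auto
    ultimately show ?case by (simp add: fil_add add.commute)
  qed (simp add: word_ev_def)
  have "ev_trunc X \<phi> f (n + k) - ev_trunc X \<psi> f (n + k)
      = (\<Sum>w\<in>words X (n + k). sc (nc_coeff f w) * (word_ev \<phi> w - word_ev \<psi> w))"
    by (simp add: ev_trunc_def sum_subtractf right_diff_distrib)
  also have "\<dots> \<in> fil (n + k)"
  proof (rule fil_sum)
    fix v assume v: "v \<in> words X (n + k)"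
    show "sc (nc_coeff f v) * (word_ev \<phi> v - word_ev \<psi> v) \<in> fil (n + k)"
    proof (cases "length v < n")
      case True then show ?thesis using f by (simp add: nc_degD)
    next
      case False then show ?thesis
        using w[of v] v by (intro fil_mult_left) (auto simp: words_def intro: fil_mono)
    qed
  qed
  finally have "ev_trunc X \<phi> f (n + k) - ev_trunc X \<psi> f (n + k) \<in> fil (n + k)" .
  moreover have "ev \<phi> f - ev_trunc X \<phi> f (n + k) \<in> fil (n + k)"
    "ev_trunc X \<psi> f (n + k) - ev \<psi> f \<in> fil (n + k)"
    using assms by (auto intro!: ev_trunc_fil intro: fil_diff_sym)
  ultimately show ?thesis
    by (metis fil_diff_trans)
qed

end

section \<open>Group-like series\<close>

interpretation ncs: complete_filtered_algebra
  "nc_deg :: nat \<Rightarrow> ('x, 'k::comm_ring_1) ncs set" nc_const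
proof
  fix u :: "nat \<Rightarrow> ('x, 'k) ncs" assume u: "\<And>n. u n \<in> nc_deg n"
  define s where "s = Abs_ncs (\<lambda>w. \<Sum>n\<le>length w. nc_coeff (u n) w)"
  have "s - (\<Sum>n<m. u n) \<in> nc_deg m" for m
    unfolding nc_deg_def mem_Collect_eq
  proof (intro allI impI)
    fix w :: "'x list" assume "length w < m"
    then have "(\<Sum>n\<le>length w. nc_coeff (u n) w) = (\<Sum>n<m. nc_coeff (u n) w)"
      by (intro sum.mono_neutral_left) (auto intro!: nc_degD[OF u])
    then show "nc_coeff (s - (\<Sum>n<m. u n)) w = 0"
      by (simp add: s_def nc_coeff_sum)
  qed
  then show "\<exists>s. \<forall>m. s - (\<Sum>n<m. u n) \<in> nc_deg m" by blast
next
  fix x :: "('x, 'k) ncs" assume "\<And>n. x \<in> nc_deg n"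
  then show "x = 0" by (intro ncs_eqI) (metis lessI nc_degD nc_coeff_zero)
next
  fix a and x :: "('x, 'k) ncs"
  show "nc_const a * x = x * nc_const a"
    by (rule ncs_eqI) (simp add: mult.commute)
qed (auto simp: nc_const_add nc_const_mult intro: nc_deg_mult, auto simp: nc_deg_def)

section \<open>Substitution as evaluation\<close>

lemma nc_subst_over:
  assumes "f \<in> nc_over X" "\<And>x. x \<in> X \<Longrightarrow> \<phi> x \<in> nc_over Y"
  shows "nc_subst \<phi> f \<in> nc_over Y"
  unfolding nc_over_def mem_Collect_eq
proof (intro allI impI, rule ccontr)
  fix v assume v: "nc_coeff (nc_subst \<phi> f) v \<noteq> 0" "\<not> set v \<subseteq> Y"
  have "nc_coeff f w * nc_coeff (prod_list (map \<phi> w)) v = 0" if "nc_coeff f w \<noteq> 0" for w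
  proof -
    have "set w \<subseteq> X" using that assms(1) by (auto simp: nc_over_def)
    then have "prod_list (map \<phi> w) \<in> nc_over Y"
      using assms(2) by (intro nc_over_prod_list) auto
    then show ?thesis using v(2) by (simp add: nc_overD)
  qed
  then have "nc_coeff (nc_subst \<phi> f) v = 0"
    unfolding nc_subst_def nc_coeff_Abs by (intro sum.neutral) auto
  with v(1) show False by simp
qed

lemma nc_coeff_nc_subst_Nil: "nc_coeff (nc_subst \<phi> f) [] = nc_coeff f []"
proof -
  have "{w. nc_coeff f w \<noteq> 0 \<and> length w \<le> length ([] :: 'b list)} = (if nc_coeff f [] = 0 then {} else {[]})"
    by auto
  then show ?thesis by (simp add: nc_subst_def nc_coeff_one)
qed

text \<open>A word longer than \<open>v\<close> evaluates to a series whose coefficient at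
  \<open>v\<close> is 0, so the length bound in the definition of \<open>nc_subst\<close> discards
  only zeros.\<close>

lemma nc_subst_eq_ev:
  fixes f :: "('x, 'k::comm_ring_1) ncs" and \<phi> :: "'x \<Rightarrow> ('y, 'k) ncs"
  assumes "finite X" "f \<in> nc_over X" "\<And>x. x \<in> X \<Longrightarrow> \<phi> x \<in> nc_deg (Suc 0)"
  shows "nc_subst \<phi> f = ncs.ev \<phi> f"
proof (rule ncs.ev_eqI[symmetric, OF assms(1,2)])
  fix m
  show "nc_subst \<phi> f - ncs.ev_trunc X \<phi> f m \<in> nc_deg m"
    unfolding nc_deg_def mem_Collect_eq
  proof (intro allI impI)
    fix v :: "'y list" assume v: "length v < m"
    have "(\<Sum>w | nc_coeff f w \<noteq> 0 \<and> length w \<le> length v. nc_coeff f w * nc_coeff (prod_list (map \<phi> w)) v)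
        = (\<Sum>w\<in>words X m. nc_coeff f w * nc_coeff (prod_list (map \<phi> w)) v)"
    proof (rule sum.mono_neutral_left)
      show "\<forall>w\<in>words X m - {w. nc_coeff f w \<noteq> 0 \<and> length w \<le> length v}.
          nc_coeff f w * nc_coeff (prod_list (map \<phi> w)) v = 0"
      proof
        fix w assume w: "w \<in> words X m - {w. nc_coeff f w \<noteq> 0 \<and> length w \<le> length v}"
        then have "ncs.word_ev \<phi> w \<in> nc_deg (length w)"
          using assms(3) by (intro ncs.word_ev_fil) (auto simp: words_def)
        then show "nc_coeff f w * nc_coeff (prod_list (map \<phi> w)) v = 0"
          using w by (cases "length w \<le> length v") (auto simp: ncs.word_ev_def nc_degD)
      qed
      show "{w. nc_coeff f w \<noteq> 0 \<and> length w \<le> length v} \<subseteq> words X m"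
        using assms v by (auto simp: words_def nc_over_def)
    qed (use assms in simp)
    then show "nc_coeff (nc_subst \<phi> f - ncs.ev_trunc X \<phi> f m) v = 0"
      by (simp add: nc_subst_def ncs.ev_trunc_def nc_coeff_sum ncs.word_ev_def)
  qed
qed

context complete_filtered_algebra
begin

lemma continuous_hom_nc_subst:
  fixes \<phi> :: "'x \<Rightarrow> ('y, 'k) ncs"
  assumes "finite X" "\<And>x. x \<in> X \<Longrightarrow> \<phi> x \<in> nc_over Y" "\<And>x. x \<in> X \<Longrightarrow> \<phi> x \<in> nc_deg (Suc 0)"
    and H: "continuous_hom Y H"
  shows "continuous_hom X (\<lambda>f. H (nc_subst \<phi> f))"
proof -
  have eq: "nc_subst \<phi> f = ncs.ev \<phi> f" if "f \<in> nc_over X" for f :: "('x, 'k) ncs"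
    using nc_subst_eq_ev[OF assms(1) that, of \<phi>] assms(3) by simp
  have o: "nc_subst \<phi> f \<in> nc_over Y" if "f \<in> nc_over X" for f :: "('x, 'k) ncs"
    using nc_subst_over[OF that, of \<phi> Y] assms(2) by simp
  have S: "ncs.continuous_hom X (ncs.ev \<phi>)"
    using assms by (intro ncs.continuous_hom_ev)
  show ?thesis
    unfolding continuous_hom_def
  proof (intro conjI ballI allI impI)
    fix f g :: "('x, 'k) ncs" assume fg: "f \<in> nc_over X" "g \<in> nc_over X"
    show "H (nc_subst \<phi> (f + g)) = H (nc_subst \<phi> f) + H (nc_subst \<phi> g)"
      using chom_add[OF H o[OF fg(1)] o[OF fg(2)]] ncs.chom_add[OF S fg] fg by (simp add: eq nc_over_add)
    show "H (nc_subst \<phi> (f * g)) = H (nc_subst \<phi> f) * H (nc_subst \<phi> g)"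
      using chom_mult[OF H o[OF fg(1)] o[OF fg(2)]] ncs.chom_mult[OF S fg] fg by (simp add: eq nc_over_mult)
  next
    fix c show "H (nc_subst \<phi> (nc_const c)) = sc c"
      by (simp add: eq chom_const[OF H])
  next
    fix m and f :: "('x, 'k) ncs" assume "f \<in> nc_over X" "f \<in> nc_deg m"
    then show "H (nc_subst \<phi> f) \<in> fil m"
      using ncs.chom_deg[OF S, of f m] chom_deg[OF H o[of f]] by (simp add: eq)
  qed
qed

text \<open>A substitution followed by a continuous homomorphism is evaluation at the images of the
  letters. It is applied with the tensor square and with the quotient for t_{4,N} as
  targets.\<close>

lemma chom_nc_subst:
  assumes "finite X" "f \<in> nc_over X"
    and \<phi>: "\<And>x. x \<in> X \<Longrightarrow> \<phi> x \<in> nc_over Y" "\<And>x. x \<in> X \<Longrightarrow> \<phi> x \<in> nc_deg (Suc 0)"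
    and H: "continuous_hom Y H"
  shows "H (nc_subst \<phi> f) = ev (\<lambda>x. H (\<phi> x)) f"
proof -
  have "H (nc_subst \<phi> f) = ev (\<lambda>x. H (nc_subst \<phi> (nc_var x))) f"
    by (rule chom_eq_ev[OF continuous_hom_nc_subst[where \<phi> = \<phi>, OF assms(1) \<phi> H] assms(1,2)])
  also have "\<dots> = ev (\<lambda>x. H (\<phi> x)) f"
  proof (rule ev_cong[OF assms(1,2)])
    fix x assume x: "x \<in> X"
    have 1: "nc_subst \<phi> (nc_var x) = \<phi> x"
      using nc_subst_eq_ev[OF assms(1) nc_over_var[OF x], of \<phi>] \<phi>(2) x by (simp add: ncs.ev_var)
    show "H (nc_subst \<phi> (nc_var x)) = H (\<phi> x)" "H (nc_subst \<phi> (nc_var x)) \<in> fil (Suc 0)"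
      unfolding 1 by (rule refl, rule chom_deg[OF H \<phi>(1)[OF x] \<phi>(2)[OF x]])
  qed
  finally show ?thesis .
qed

lemma is_inverse_one_minus:
  assumes "z \<in> fil (Suc 0)"
  shows "\<exists>v. is_inverse (1 - z) v"
proof -
  \<comment> \<open>The inverse is the geometric series in \<open>z\<close>, which converges since
    \<open>z\<close> has positive degree.\<close>
  have zn: "z ^ n \<in> fil n" for n
    using assms by (induction n) (use fil_mult[of z "Suc 0"] in auto)
  then obtain s where s: "\<And>m. s - (\<Sum>n<m. z ^ n) \<in> fil m"
    using fil_complete[of "\<lambda>n. z ^ n"] by blast
  have geo: "(1 - z) * (\<Sum>n<m. z ^ n) = 1 - z ^ m" "(\<Sum>n<m. z ^ n) * (1 - z) = 1 - z ^ m" for m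
    by (induction m)
      (simp_all add: distrib_left distrib_right left_diff_distrib[of _ _ "z ^ _"] right_diff_distrib[of "z ^ _"] power_commutes)
  have "(1 - z) * s = 1"
  proof (rule eqI_fil)
    fix m
    have "(1 - z) * s - 1 = (1 - z) * (s - (\<Sum>n<m. z ^ n)) - z ^ m"
      using geo(1)[of m] by (simp add: right_diff_distrib)
    then show "(1 - z) * s - 1 \<in> fil m" using s zn by (simp add: fil_diff fil_mult_left)
  qed
  moreover have "s * (1 - z) = 1"
  proof (rule eqI_fil)
    fix m
    have "s * (1 - z) - 1 = (s - (\<Sum>n<m. z ^ n)) * (1 - z) - z ^ m"
      using geo(2)[of m] by (simp add: left_diff_distrib)
    then show "s * (1 - z) - 1 \<in> fil m" using s zn by (simp add: fil_diff fil_mult_right)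
  qed
  ultimately show ?thesis by (auto simp: is_inverse_def)
qed

end

section \<open>Inverses of series with constant term 1\<close>

lemma is_inverse_unique: "is_inverse u v \<Longrightarrow> is_inverse u w \<Longrightarrow> v = w"
  unfolding is_inverse_def by (metis mult.assoc mult_1_left mult_1_right)

lemma nc_inv_eqI: "is_inverse f g \<Longrightarrow> nc_inv f = g"
  unfolding nc_inv_def is_inverse_def[symmetric] by (rule the_equality) (auto dest: is_inverse_unique)

lemma is_inverse_nc_inv:
  fixes f :: "('x, 'k::comm_ring_1) ncs"
  assumes "nc_coeff f [] = 1" shows "is_inverse f (nc_inv f)"
proof -
  have "1 - f \<in> nc_deg (Suc 0)" using assms by (simp add: nc_deg_Suc_0_iff nc_coeff_one)
  from ncs.is_inverse_one_minus[OF this] obtain g where "is_inverse f g" by auto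
  then show ?thesis using nc_inv_eqI by metis
qed

text \<open>This is the homomorphism that kills the letters outside \<open>X\<close> and fixes the
  others; it projects an identity in too many letters to the intended alphabet.\<close>

definition nc_restrict :: "'x set \<Rightarrow> ('x, 'k::ring_1) ncs \<Rightarrow> ('x, 'k) ncs"
  where "nc_restrict X f = Abs_ncs (\<lambda>w. if set w \<subseteq> X then nc_coeff f w else 0)"

lemma nc_coeff_restrict: "nc_coeff (nc_restrict X f) w = (if set w \<subseteq> X then nc_coeff f w else 0)"
  by (simp add: nc_restrict_def)

lemma nc_restrict_over [simp]: "nc_restrict X f \<in> nc_over X"
  by (simp add: nc_over_def nc_coeff_restrict)

lemma nc_restrict_id: "f \<in> nc_over X \<Longrightarrow> nc_restrict X f = f"
  by (rule ncs_eqI) (auto simp: nc_coeff_restrict dest: nc_overD)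

lemma nc_restrict_add: "nc_restrict X (f + g) = nc_restrict X f + nc_restrict X g"
  by (rule ncs_eqI) (simp add: nc_coeff_restrict)

lemma nc_restrict_mult: "nc_restrict X (f * g) = nc_restrict X f * nc_restrict X g"
proof (rule ncs_eqI)
  fix w
  show "nc_coeff (nc_restrict X (f * g)) w = nc_coeff (nc_restrict X f * nc_restrict X g) w"
  proof (cases "set w \<subseteq> X")
    case True
    then have "set (take i w) \<subseteq> X" "set (drop i w) \<subseteq> X" for i
      using set_take_subset set_drop_subset by fast+
    then show ?thesis using True by (simp add: nc_coeff_mult nc_coeff_restrict)
  next
    case False
    then show ?thesis
      using nc_overD[OF nc_over_mult[OF nc_restrict_over[of X f] nc_restrict_over[of X g]], of w]
      by (auto simp: nc_coeff_restrict)
  qed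
qed

text \<open>Restricting both factors of \<open>f * nc_inv f = 1\<close> gives another inverse of
  \<open>f\<close>, and inverses are unique.\<close>

lemma nc_inv_over:
  fixes f :: "('x, 'k::comm_ring_1) ncs"
  assumes "f \<in> nc_over X" "nc_coeff f [] = 1" shows "nc_inv f \<in> nc_over X"
proof -
  have "is_inverse f (nc_inv f)" by (rule is_inverse_nc_inv[OF assms(2)])
  then have "is_inverse (nc_restrict X f) (nc_restrict X (nc_inv f))"
    unfolding is_inverse_def using nc_restrict_mult nc_restrict_id[OF nc_over_one] by metis
  then have "nc_restrict X (nc_inv f) = nc_inv f"
    using nc_inv_eqI nc_restrict_id[OF assms(1)] by metis
  then show ?thesis using nc_restrict_over[of X "nc_inv f"] by (simp only:)
qed

section \<open>Unshuffles and sums of commuting substitutions\<close>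

lemma unshuffles_length: "(u, v) \<in> set (unshuffles w) \<Longrightarrow> length u + length v = length w"
  by (induction w arbitrary: u v) auto

lemma unshuffles_set: "(u, v) \<in> set (unshuffles w) \<Longrightarrow> set u \<union> set v = set w"
proof (induction w arbitrary: u v)
  case (Cons x w)
  then consider u' where "u = x # u'" "(u', v) \<in> set (unshuffles w)"
    | v' where "v = x # v'" "(u, v') \<in> set (unshuffles w)" by auto
  then show ?case by cases (use Cons.IH in force)+
qed simp

lemma sum_list_eq_sum_count:
  "sum_list (map F xs) = (\<Sum>p\<in>set xs. of_nat (count_list xs p) * (F p :: 'r::ring_1))"
proof (induction xs)
  case (Cons x xs)
  have *: "(\<Sum>p\<in>set (x # xs). of_nat (count_list xs p) * F p) = (\<Sum>p\<in>set xs. of_nat (count_list xs p) * F p)"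
    by (rule sum.mono_neutral_right) (auto simp: count_list_0_iff)
  have "(\<Sum>p\<in>set (x # xs). of_nat (count_list (x # xs) p) * F p)
      = (\<Sum>p\<in>set (x # xs). (if p = x then F p else 0) + of_nat (count_list xs p) * F p)"
    by (rule sum.cong) (auto simp: distrib_right)
  also have "\<dots> = F x + (\<Sum>p\<in>set (x # xs). of_nat (count_list xs p) * F p)"
    unfolding sum.distrib by simp
  finally show ?case unfolding * using Cons by simp
qed simp

definition word_pairs :: "'x set \<Rightarrow> nat \<Rightarrow> ('x list \<times> 'x list) set"
  where "word_pairs X m = {(u, v). set u \<subseteq> X \<and> set v \<subseteq> X \<and> length u + length v < m}"

lemma finite_word_pairs: "finite X \<Longrightarrow> finite (word_pairs X m)"
  by (rule finite_subset[of _ "words X m \<times> words X m"], force simp: word_pairs_def words_def, simp)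

context complete_filtered_algebra
begin

lemma sc_of_nat: "sc (of_nat n) = of_nat n"
  by (induction n) (simp_all add: sc_add)

text \<open>Expanding the product chooses \<open>\<phi>\<close> or \<open>\<psi>\<close> at each
  letter. Commutation collects the \<open>\<phi>\<close> factors on the left, and
  \<open>unshuffles\<close> enumerates the choices.\<close>

lemma word_ev_add:
  assumes "set w \<subseteq> X" "\<And>x y. x \<in> X \<Longrightarrow> y \<in> X \<Longrightarrow> \<phi> x * \<psi> y = \<psi> y * \<phi> x"
  shows "word_ev (\<lambda>x. \<phi> x + \<psi> x) w = (\<Sum>(u, v)\<leftarrow>unshuffles w. word_ev \<phi> u * word_ev \<psi> v)"
  using assms(1)
proof (induction w)
  case (Cons x w)
  have comm: "\<psi> x * word_ev \<phi> u = word_ev \<phi> u * \<psi> x" if "set u \<subseteq> X" for u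
    using that
  proof (induction u)
    case (Cons y u)
    then show ?case using assms(2)[of y x] \<open>set (x # w) \<subseteq> X\<close>
      by (simp add: word_ev_def mult.assoc) (metis mult.assoc)
  qed (simp add: word_ev_def)
  have "word_ev (\<lambda>x. \<phi> x + \<psi> x) (x # w) = (\<phi> x + \<psi> x) * (\<Sum>(u, v)\<leftarrow>unshuffles w. word_ev \<phi> u * word_ev \<psi> v)"
    using Cons by (simp add: word_ev_def)
  also have "\<dots> = (\<Sum>(u, v)\<leftarrow>unshuffles w. word_ev \<phi> (x # u) * word_ev \<psi> v)
      + (\<Sum>(u, v)\<leftarrow>unshuffles w. \<psi> x * (word_ev \<phi> u * word_ev \<psi> v))"
    by (simp add: distrib_right sum_list_addf sum_list_const_mult[symmetric] case_prod_unfold word_ev_def mult.assoc)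
  also have "map (\<lambda>(u, v). \<psi> x * (word_ev \<phi> u * word_ev \<psi> v)) (unshuffles w)
      = map (\<lambda>(u, v). word_ev \<phi> u * word_ev \<psi> (x # v)) (unshuffles w)"
  proof (rule map_cong[OF refl], clarify)
    fix u v assume "(u, v) \<in> set (unshuffles w)"
    then have "set u \<subseteq> X" using unshuffles_set Cons.prems by fastforce
    then have "\<psi> x * word_ev \<phi> u * word_ev \<psi> v = word_ev \<phi> u * \<psi> x * word_ev \<psi> v"
      by (simp add: comm)
    then show "\<psi> x * (word_ev \<phi> u * word_ev \<psi> v) = word_ev \<phi> u * word_ev \<psi> (x # v)"
      by (simp add: word_ev_def mult.assoc)
  qed
  finally show ?case by (simp add: case_prod_unfold comp_def)
qed (simp add: word_ev_def)

text \<open>Interchanging the sums over words and over pairs turns numbers of unshuffles into the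
  coefficients \<open>nc_coprod\<close>. It serves twice: for group-like series, and to recognise
  the coproduct of any series as an evaluation.\<close>

lemma ev_trunc_add_letters:
  assumes X: "finite X" and comm: "\<And>x y. x \<in> X \<Longrightarrow> y \<in> X \<Longrightarrow> \<phi> x * \<psi> y = \<psi> y * \<phi> x"
  shows "ev_trunc X (\<lambda>x. \<phi> x + \<psi> x) f m
    = (\<Sum>(u, v)\<in>word_pairs X m. sc (nc_coprod f u v) * (word_ev \<phi> u * word_ev \<psi> v))"
proof -
  let ?F = "\<lambda>(u, v). word_ev \<phi> u * word_ev \<psi> v"
  let ?n = "\<lambda>w p. of_nat (count_list (unshuffles w) p)"
  have "ev_trunc X (\<lambda>x. \<phi> x + \<psi> x) f m
      = (\<Sum>w\<in>words X m. \<Sum>p | p \<in> word_pairs X m \<and> p \<in> set (unshuffles w). sc (nc_coeff f w * ?n w p) * ?F p)"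
    unfolding ev_trunc_def
  proof (rule sum.cong[OF refl])
    fix w assume w: "w \<in> words X m"
    have set: "set (unshuffles w) = {p. p \<in> word_pairs X m \<and> p \<in> set (unshuffles w)}"
      using w unshuffles_set[of _ _ w] unshuffles_length[of _ _ w]
      by (fastforce simp: words_def word_pairs_def)
    have "word_ev (\<lambda>x. \<phi> x + \<psi> x) w = sum_list (map ?F (unshuffles w))"
      by (rule word_ev_add[of w X]) (use w comm in \<open>auto simp: words_def\<close>)
    also have "\<dots> = (\<Sum>p | p \<in> word_pairs X m \<and> p \<in> set (unshuffles w). ?n w p * ?F p)"
      unfolding sum_list_eq_sum_count by (rule sum.cong[OF set]) simp
    finally show "sc (nc_coeff f w) * word_ev (\<lambda>x. \<phi> x + \<psi> x) w
        = (\<Sum>p | p \<in> word_pairs X m \<and> p \<in> set (unshuffles w). sc (nc_coeff f w * ?n w p) * ?F p)"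
      by (simp add: sum_distrib_left sc_mult sc_of_nat mult.assoc)
  qed
  also have "\<dots> = (\<Sum>p\<in>word_pairs X m. \<Sum>w | w \<in> words X m \<and> p \<in> set (unshuffles w). sc (nc_coeff f w * ?n w p) * ?F p)"
    by (rule sum.swap_restrict) (use X finite_word_pairs in auto)
  also have "\<dots> = (\<Sum>(u, v)\<in>word_pairs X m. sc (nc_coprod f u v) * (word_ev \<phi> u * word_ev \<psi> v))"
  proof (rule sum.cong[OF refl])
    fix p assume p: "p \<in> word_pairs X m"
    obtain u v where uv: "p = (u, v)" by (cases p)
    have "{w. w \<in> words X m \<and> p \<in> set (unshuffles w)} = {w. (u, v) \<in> set (unshuffles w)}"
      using p uv unshuffles_set[of u v] unshuffles_length[of u v]
      by (fastforce simp: words_def word_pairs_def)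
    then show "(\<Sum>w | w \<in> words X m \<and> p \<in> set (unshuffles w). sc (nc_coeff f w * ?n w p) * ?F p)
        = (case p of (u, v) \<Rightarrow> sc (nc_coprod f u v) * (word_ev \<phi> u * word_ev \<psi> v))"
      by (simp add: uv nc_coprod_def sc_sum sum_distrib_right)
  qed
  finally show ?thesis .
qed

text \<open>\<open>\<Delta> f = f \<otimes> f\<close> is turned into a product by any pair of commuting substitutions.\<close>
lemma ev_add_letters:
  assumes X: "finite X" "f \<in> nc_over X"
    and \<phi>: "\<And>x. x \<in> X \<Longrightarrow> \<phi> x \<in> fil (Suc 0)" and \<psi>: "\<And>x. x \<in> X \<Longrightarrow> \<psi> x \<in> fil (Suc 0)"
    and comm: "\<And>x y. x \<in> X \<Longrightarrow> y \<in> X \<Longrightarrow> \<phi> x * \<psi> y = \<psi> y * \<phi> x"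
    and f: "grouplike f"
  shows "ev (\<lambda>x. \<phi> x + \<psi> x) f = ev \<phi> f * ev \<psi> f"
proof (rule ev_eqI[OF X])
  fix m :: nat
  let ?F = "\<lambda>u v. (sc (nc_coeff f u) * word_ev \<phi> u) * (sc (nc_coeff f v) * word_ev \<psi> v)"
  have F: "sc (nc_coprod f u v) * (word_ev \<phi> u * word_ev \<psi> v) = ?F u v" for u v
  proof -
    have "sc (nc_coprod f u v) = sc (nc_coeff f u) * sc (nc_coeff f v)"
      using f by (simp add: grouplike_def sc_mult)
    then show ?thesis
      by (metis sc_central mult.assoc)
  qed
  have "ev_trunc X (\<lambda>x. \<phi> x + \<psi> x) f m
      = (\<Sum>(u, v)\<in>word_pairs X m. sc (nc_coprod f u v) * (word_ev \<phi> u * word_ev \<psi> v))"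
    by (rule ev_trunc_add_letters[OF X(1)]) (rule comm)
  then have T: "ev_trunc X (\<lambda>x. \<phi> x + \<psi> x) f m = (\<Sum>(u, v)\<in>word_pairs X m. ?F u v)"
    unfolding F .
  have P: "ev_trunc X \<phi> f m * ev_trunc X \<psi> f m = (\<Sum>(u, v)\<in>words X m \<times> words X m. ?F u v)"
    by (simp add: ev_trunc_def sum_product sum.cartesian_product)
  have "word_pairs X m \<subseteq> words X m \<times> words X m"
    by (auto simp: words_def word_pairs_def)
  then have S: "(\<Sum>(u, v)\<in>words X m \<times> words X m. ?F u v) = (\<Sum>(u, v)\<in>(words X m \<times> words X m - word_pairs X m). ?F u v)
      + (\<Sum>(u, v)\<in>word_pairs X m. ?F u v)"
    using X(1) by (intro sum.subset_diff) simp_all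
  have D: "(\<Sum>(u, v)\<in>(words X m \<times> words X m - word_pairs X m). ?F u v) \<in> fil m"
  proof (rule fil_sum)
    fix p assume p: "p \<in> words X m \<times> words X m - word_pairs X m"
    obtain u v where uv: "p = (u, v)" by (cases p)
    have "word_ev \<phi> u \<in> fil (length u)" "word_ev \<psi> v \<in> fil (length v)"
      using p uv \<phi> \<psi> by (auto simp: words_def intro!: word_ev_fil)
    then have "?F u v \<in> fil (length u + length v)"
      by (intro fil_mult fil_mult_left)
    then show "(case p of (u, v) \<Rightarrow> ?F u v) \<in> fil m"
      using p uv by (auto simp: words_def word_pairs_def intro: fil_mono)
  qed
  have 1: "ev_trunc X \<phi> f m * ev_trunc X \<psi> f m - ev_trunc X (\<lambda>x. \<phi> x + \<psi> x) f m \<in> fil m"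
    unfolding P S T add_diff_cancel_right' by (rule D)
  have 2: "ev \<phi> f - ev_trunc X \<phi> f m \<in> fil m"
    by (rule ev_trunc_fil[OF X]) (rule \<phi>)
  have 3: "ev \<psi> f - ev_trunc X \<psi> f m \<in> fil m"
    by (rule ev_trunc_fil[OF X]) (rule \<psi>)
  show "ev \<phi> f * ev \<psi> f - ev_trunc X (\<lambda>x. \<phi> x + \<psi> x) f m \<in> fil m"
    by (rule fil_diff_trans[OF fil_diff_mult[OF 2 3] 1])
qed

end

text \<open>The completed tensor square of the series in letters \<open>'x\<close> is realised as the series whose
  coefficients are again series; \<open>u \<otimes> v\<close> has degree \<open>length u + length v\<close>.\<close>

definition tensor_deg :: "nat \<Rightarrow> ('x, ('x, 'k::ring_1) ncs) ncs set"
  where "tensor_deg n = {F. \<forall>u v. length u + length v < n \<longrightarrow> nc_coeff (nc_coeff F u) v = 0}"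

lemma tensor_degD: "F \<in> tensor_deg n \<Longrightarrow> length u + length v < n \<Longrightarrow> nc_coeff (nc_coeff F u) v = 0"
  by (simp add: tensor_deg_def)

interpretation tensor: complete_filtered_algebra
  "tensor_deg :: nat \<Rightarrow> ('x, ('x, 'k::comm_ring_1) ncs) ncs set" "\<lambda>c. nc_const (nc_const c)"
proof
  fix U :: "nat \<Rightarrow> ('x, ('x, 'k) ncs) ncs" assume U: "\<And>n. U n \<in> tensor_deg n"
  define s where "s = Abs_ncs (\<lambda>u. Abs_ncs (\<lambda>v. \<Sum>n\<le>length u + length v. nc_coeff (nc_coeff (U n) u) v))"
  have "s - (\<Sum>n<m. U n) \<in> tensor_deg m" for m
    unfolding tensor_deg_def mem_Collect_eq
  proof (intro allI impI)
    fix u v :: "'x list" assume "length u + length v < m"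
    then have "(\<Sum>n\<le>length u + length v. nc_coeff (nc_coeff (U n) u) v) = (\<Sum>n<m. nc_coeff (nc_coeff (U n) u) v)"
      by (intro sum.mono_neutral_left) (auto intro!: tensor_degD[OF U])
    then show "nc_coeff (nc_coeff (s - (\<Sum>n<m. U n)) u) v = 0"
      by (simp add: s_def nc_coeff_sum)
  qed
  then show "\<exists>s. \<forall>m. s - (\<Sum>n<m. U n) \<in> tensor_deg m" by blast
next
  fix F :: "('x, ('x, 'k) ncs) ncs" assume "\<And>n. F \<in> tensor_deg n"
  then have "nc_coeff (nc_coeff F u) v = 0" for u v by (metis lessI tensor_degD)
  then show "F = 0" by (intro ncs_eqI) simp
next
  fix a and F :: "('x, ('x, 'k) ncs) ncs"
  show "nc_const (nc_const a) * F = F * nc_const (nc_const a)"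
    by (rule ncs_eqI, rule ncs_eqI) (simp add: mult.commute)
next
  fix F G :: "('x, ('x, 'k) ncs) ncs" and m n
  assume F: "F \<in> tensor_deg m" and G: "G \<in> tensor_deg n"
  show "F * G \<in> tensor_deg (m + n)"
    unfolding tensor_deg_def mem_Collect_eq nc_coeff_mult nc_coeff_sum
  proof (intro allI impI sum.neutral ballI)
    fix u v :: "'x list" and i j
    assume *: "length u + length v < m + n" "i \<in> {..length u}" "j \<in> {..length v}"
    then have "length (take i u) + length (take j v) < m \<or> length (drop i u) + length (drop j v) < n"
      by auto
    then show "nc_coeff (nc_coeff F (take i u)) (take j v) * nc_coeff (nc_coeff G (drop i u)) (drop j v) = 0"
      using tensor_degD[OF F] tensor_degD[OF G] by (metis mult_zero_left mult_zero_right)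
  qed
qed (simp_all add: nc_const_add nc_const_mult, auto simp: tensor_deg_def)

section \<open>The coproduct as a homomorphism; group-like and primitive series\<close>

definition tensor1 :: "('x, 'k::ring_1) ncs \<Rightarrow> ('x, ('x, 'k) ncs) ncs"
  where "tensor1 f = Abs_ncs (\<lambda>u. nc_const (nc_coeff f u))"

abbreviation tensor2 :: "('x, 'k::ring_1) ncs \<Rightarrow> ('x, ('x, 'k) ncs) ncs"
  where "tensor2 \<equiv> nc_const"

definition coproduct :: "('x, 'k::ring_1) ncs \<Rightarrow> ('x, ('x, 'k) ncs) ncs"
  where "coproduct f = Abs_ncs (\<lambda>u. Abs_ncs (nc_coprod f u))"

definition primitive :: "('x, 'k::ring_1) ncs \<Rightarrow> bool"
  where "primitive p \<longleftrightarrow> coproduct p = tensor1 p + tensor2 p"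

lemma nc_coeff_tensor1: "nc_coeff (tensor1 f) u = nc_const (nc_coeff f u)"
  by (simp add: tensor1_def)

lemma tensor1_mult: "tensor1 (f * g) = tensor1 f * tensor1 g"
proof (rule ncs_eqI)
  fix u
  have "nc_const (sum F A) = (\<Sum>a\<in>A. (nc_const (F a) :: ('a, 'b) ncs))" for F and A :: "nat set"
    by (induction A rule: infinite_finite_induct) (auto simp: nc_const_add)
  then show "nc_coeff (tensor1 (f * g)) u = nc_coeff (tensor1 f * tensor1 g) u"
    by (simp add: nc_coeff_tensor1 nc_coeff_mult nc_const_mult)
qed

lemma continuous_hom_tensor1: "tensor.continuous_hom X tensor1"
  unfolding tensor.continuous_hom_def
  by (auto simp: tensor1_mult tensor_deg_def nc_deg_def nc_coeff_tensor1 nc_const_add nc_coeff_const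
      intro!: ncs_eqI)

lemma continuous_hom_tensor2: "tensor.continuous_hom X tensor2"
  unfolding tensor.continuous_hom_def
  by (auto simp: nc_const_add nc_const_mult tensor_deg_def nc_deg_def nc_coeff_const)

lemma tensor12_commute: "tensor1 f * tensor2 g = tensor2 g * tensor1 (f :: ('x, 'k::comm_ring_1) ncs)"
  by (rule ncs_eqI) (simp add: nc_coeff_tensor1 ncs.sc_central)

lemma grouplike_iff_coproduct:
  "grouplike f \<longleftrightarrow> nc_coeff f [] = 1 \<and> coproduct f = tensor1 f * tensor2 f"
proof -
  have "coproduct f = tensor1 f * tensor2 f \<longleftrightarrow> (\<forall>u v. nc_coprod f u v = nc_coeff f u * nc_coeff f v)"
  proof
    assume "coproduct f = tensor1 f * tensor2 f"
    then have "nc_coeff (nc_coeff (coproduct f) u) v = nc_coeff (nc_coeff (tensor1 f * tensor2 f) u) v" for u v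
      by simp
    then show "\<forall>u v. nc_coprod f u v = nc_coeff f u * nc_coeff f v"
      by (simp add: coproduct_def nc_coeff_tensor1)
  qed (intro ncs_eqI, simp add: coproduct_def nc_coeff_tensor1)
  then show ?thesis by (simp add: grouplike_def)
qed

text \<open>The coproduct is given coefficientwise; recognising it as the continuous homomorphism
  with primitive letters makes it multiplicative. The expansion over unshuffles applies because the
  two tensor factors commute.\<close>

lemma coproduct_eq_ev:
  assumes "finite X" "f \<in> nc_over X"
  shows "coproduct f = tensor.ev (\<lambda>x. tensor1 (nc_var x) + tensor2 (nc_var x)) f"
proof (rule tensor.ev_eqI[symmetric, OF assms])
  fix m
  let ?e = "\<lambda>u' v'. tensor.word_ev (\<lambda>x. tensor1 (nc_var x)) u' * tensor.word_ev (\<lambda>x. tensor2 (nc_var x)) v' :: ('a, ('a, 'b) ncs) ncs"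
  have "?e u' v' = tensor1 (prod_list (map nc_var u')) * tensor2 (prod_list (map nc_var v'))" for u' v'
    by (simp add: tensor.chom_word[OF continuous_hom_tensor1[of UNIV]] tensor.chom_word[OF continuous_hom_tensor2[of UNIV]])
  then have e: "nc_coeff (nc_coeff (?e u' v') u) v = (if u = u' \<and> v = v' then 1 else 0)" for u u' v v'
    by (simp add: nc_coeff_tensor1 nc_coeff_word)
  have t: "tensor.ev_trunc X (\<lambda>x. tensor1 (nc_var x) + tensor2 (nc_var x)) f m
      = (\<Sum>(u, v)\<in>word_pairs X m. nc_const (nc_const (nc_coprod f u v)) * ?e u v)"
    by (rule tensor.ev_trunc_add_letters[OF assms(1)]) (simp add: tensor12_commute)
  show "coproduct f - tensor.ev_trunc X (\<lambda>x. tensor1 (nc_var x) + tensor2 (nc_var x)) f m \<in> tensor_deg m"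
    unfolding tensor_deg_def mem_Collect_eq
  proof (intro allI impI)
    fix u v :: "'a list" assume uv: "length u + length v < m"
    have "nc_coeff (nc_coeff (\<Sum>(u, v)\<in>word_pairs X m. nc_const (nc_const (nc_coprod f u v)) * ?e u v) u) v
        = (\<Sum>p\<in>word_pairs X m. if (u, v) = p then nc_coprod f u v else 0)"
      unfolding nc_coeff_sum by (rule sum.cong) (auto simp: e split: if_splits)
    also have "\<dots> = (if (u, v) \<in> word_pairs X m then nc_coprod f u v else 0)"
      by (rule sum.delta'[OF finite_word_pairs[OF assms(1)]])
    also have "\<dots> = nc_coprod f u v"
    proof (cases "(u, v) \<in> word_pairs X m")
      case False
      then have "\<not> (set u \<union> set v \<subseteq> X)" using uv by (auto simp: word_pairs_def)
      then have "nc_coeff f w = 0" if "(u, v) \<in> set (unshuffles w)" for w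
        using unshuffles_set[OF that] assms(2) nc_overD by metis
      then show ?thesis by (simp add: nc_coprod_def)
    qed simp
    finally show "nc_coeff (nc_coeff (coproduct f - tensor.ev_trunc X (\<lambda>x. tensor1 (nc_var x) + tensor2 (nc_var x)) f m) u) v = 0"
      unfolding t by (simp add: coproduct_def)
  qed
qed

lemma tensor_letter_deg:
  "tensor1 (nc_var x) + tensor2 (nc_var x) \<in> (tensor_deg (Suc 0) :: ('x, ('x, 'k::comm_ring_1) ncs) ncs set)"
  by (rule tensor.fil_add[OF tensor.chom_deg[OF continuous_hom_tensor1[of UNIV]]
        tensor.chom_deg[OF continuous_hom_tensor2[of UNIV]]]) simp_all

lemma continuous_hom_coproduct: "finite X \<Longrightarrow> tensor.continuous_hom X coproduct"
  using tensor.continuous_hom_ev[of X "\<lambda>x. tensor1 (nc_var x) + tensor2 (nc_var x)", OF _ tensor_letter_deg]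
  unfolding tensor.continuous_hom_def
  by (auto simp: coproduct_eq_ev[of X] nc_over_add nc_over_mult)

lemma coproduct_mult:
  fixes f g :: "('x, 'k::comm_ring_1) ncs"
  assumes "finite X" "f \<in> nc_over X" "g \<in> nc_over X"
  shows "coproduct (f * g) = coproduct f * coproduct g"
  using tensor.chom_mult[OF continuous_hom_coproduct[OF assms(1)] assms(2,3)] .

lemma coproduct_add: "coproduct (f + g) = coproduct f + coproduct (g :: ('x, 'k::comm_ring_1) ncs)"
  by (intro ncs_eqI) (simp add: coproduct_def nc_coprod_def distrib_right sum.distrib)

lemma coproduct_1: "coproduct (1 :: ('x, 'k::comm_ring_1) ncs) = 1"
  using tensor.chom_1[OF continuous_hom_coproduct[of "{}"]] by simp

lemma grouplike_1: "grouplike (1 :: ('x, 'k::comm_ring_1) ncs)"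
  by (simp add: grouplike_iff_coproduct coproduct_1 nc_coeff_one tensor.chom_1[OF continuous_hom_tensor1[of UNIV]])

lemma grouplike_mult:
  fixes f g :: "('x, 'k::comm_ring_1) ncs"
  assumes "finite X" "f \<in> nc_over X" "g \<in> nc_over X" "grouplike f" "grouplike g"
  shows "grouplike (f * g)"
proof -
  have "coproduct (f * g) = tensor1 f * (tensor2 f * tensor1 g) * tensor2 g"
    using assms by (simp add: coproduct_mult[OF assms(1-3)] grouplike_iff_coproduct mult.assoc)
  also have "\<dots> = tensor1 (f * g) * tensor2 (f * g)"
    by (simp add: tensor12_commute[symmetric] tensor1_mult nc_const_mult mult.assoc)
  finally show ?thesis using assms by (simp add: grouplike_iff_coproduct nc_coeff_mult_Nil)
qed

lemma is_inverse_mult: "is_inverse u u' \<Longrightarrow> is_inverse v v' \<Longrightarrow> is_inverse (u * v) (v' * u')"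
  unfolding is_inverse_def by (metis mult.assoc mult_1_left)

lemma is_inverse_sym: "is_inverse u v \<Longrightarrow> is_inverse v u"
  by (simp add: is_inverse_def)

lemma is_inverse_tensor:
  assumes "is_inverse f (g :: ('x, 'k::comm_ring_1) ncs)"
  shows "is_inverse (tensor1 f) (tensor1 g)" "is_inverse (tensor2 f) (tensor2 g)"
  using assms tensor.chom_1[OF continuous_hom_tensor1[of UNIV]]
  by (simp_all add: is_inverse_def tensor1_mult[symmetric] nc_const_mult[symmetric])

lemma grouplike_Nil: "grouplike f \<Longrightarrow> nc_coeff f [] = 1"
  by (simp add: grouplike_def)

text \<open>The coproduct of the inverse and the tensor product of two copies of the inverse both
  invert the coproduct of \<open>f\<close>.\<close>

lemma grouplike_nc_inv:
  fixes f :: "('x, 'k::comm_ring_1) ncs"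
  assumes "finite X" "f \<in> nc_over X" "grouplike f"
  shows "grouplike (nc_inv f)"
proof -
  let ?g = "nc_inv f"
  have f1: "nc_coeff f [] = 1" by (rule grouplike_Nil[OF assms(3)])
  have inv: "is_inverse f ?g" by (rule is_inverse_nc_inv[OF f1])
  have o: "?g \<in> nc_over X" by (rule nc_inv_over[OF assms(2) f1])
  have "is_inverse (coproduct f) (coproduct ?g)"
    using inv unfolding is_inverse_def
    by (simp add: coproduct_mult[OF assms(1,2) o, symmetric] coproduct_mult[OF assms(1) o assms(2), symmetric] coproduct_1)
  moreover have "is_inverse (coproduct f) (tensor2 ?g * tensor1 ?g)"
    using is_inverse_mult[OF is_inverse_tensor[OF inv]] assms(3) by (simp add: grouplike_iff_coproduct)
  ultimately have "coproduct ?g = tensor1 ?g * tensor2 ?g"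
    using is_inverse_unique by (metis tensor12_commute)
  moreover have "nc_coeff ?g [] = 1"
    using inv f1 nc_coeff_mult_Nil[of f ?g] by (simp add: is_inverse_def nc_coeff_one)
  ultimately show ?thesis by (simp add: grouplike_iff_coproduct)
qed

text \<open>Primitivity of the images makes the coproduct of each of them a sum of two elements in
  commuting tensor factors; \<open>ev_add_letters\<close> then splits the evaluation of
  \<open>f\<close> into a product.\<close>

lemma grouplike_nc_subst:
  fixes f :: "('x, 'k::comm_ring_1) ncs" and \<phi> :: "'x \<Rightarrow> ('y, 'k) ncs"
  assumes X: "finite X" "f \<in> nc_over X" and Y: "finite Y" and f: "grouplike f"
    and \<phi>: "\<And>x. x \<in> X \<Longrightarrow> \<phi> x \<in> nc_over Y" "\<And>x. x \<in> X \<Longrightarrow> \<phi> x \<in> nc_deg (Suc 0)"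
    and prim: "\<And>x. x \<in> X \<Longrightarrow> primitive (\<phi> x)"
  shows "grouplike (nc_subst \<phi> f)"
proof -
  have d: "tensor1 (\<phi> x) \<in> tensor_deg (Suc 0)" "tensor2 (\<phi> x) \<in> tensor_deg (Suc 0)" if "x \<in> X" for x
    by (rule tensor.chom_deg[OF continuous_hom_tensor1 nc_over_UNIV \<phi>(2)[OF that]],
        rule tensor.chom_deg[OF continuous_hom_tensor2 nc_over_UNIV \<phi>(2)[OF that]])
  have "coproduct (nc_subst \<phi> f) = tensor.ev (\<lambda>x. coproduct (\<phi> x)) f"
    by (rule tensor.chom_nc_subst[OF X \<phi> continuous_hom_coproduct[OF Y]])
  also have "\<dots> = tensor.ev (\<lambda>x. tensor1 (\<phi> x) + tensor2 (\<phi> x)) f"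
    by (rule tensor.ev_cong[OF X]) (use prim d in \<open>auto simp: primitive_def intro: tensor.fil_add\<close>)
  also have "\<dots> = tensor.ev (\<lambda>x. tensor1 (\<phi> x)) f * tensor.ev (\<lambda>x. tensor2 (\<phi> x)) f"
    by (rule tensor.ev_add_letters[OF X]) (use d f in \<open>auto simp: tensor12_commute\<close>)
  also have "\<dots> = tensor1 (nc_subst \<phi> f) * tensor2 (nc_subst \<phi> f)"
    using tensor.chom_nc_subst[OF X \<phi> continuous_hom_tensor1[of Y]]
      tensor.chom_nc_subst[OF X \<phi> continuous_hom_tensor2[of Y]] by simp
  finally show ?thesis
    using f by (simp add: grouplike_iff_coproduct nc_coeff_nc_subst_Nil)
qed

lemma primitive_var: "primitive (nc_var x :: ('x, 'k::comm_ring_1) ncs)"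
  unfolding primitive_def
  by (simp add: coproduct_eq_ev[of "{x}"] nc_over_var tensor.ev_var tensor_letter_deg)

lemma tensor1_add: "tensor1 (f + g) = tensor1 f + tensor1 g"
  by (rule ncs_eqI) (simp add: nc_coeff_tensor1 nc_const_add)

lemma primitive_add: "primitive p \<Longrightarrow> primitive q \<Longrightarrow> primitive (p + q :: ('x, 'k::comm_ring_1) ncs)"
  by (simp add: primitive_def coproduct_add tensor1_add nc_const_add)

lemma primitive_0: "primitive (0 :: ('x, 'k::comm_ring_1) ncs)"
  using coproduct_add[of 0 "0 :: ('x, 'k) ncs"] tensor1_add[of 0 "0 :: ('x, 'k) ncs"] by (simp add: primitive_def)

lemma primitive_uminus:
  assumes "primitive (p :: ('x, 'k::comm_ring_1) ncs)" shows "primitive (- p)"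
proof -
  have "coproduct (- p) = - coproduct p"
    by (intro ncs_eqI) (simp add: coproduct_def nc_coprod_def sum_negf)
  moreover have "tensor1 (- p) = - tensor1 p" "tensor2 (- p) = - tensor2 p"
    by (intro ncs_eqI; simp add: nc_coeff_tensor1 nc_coeff_const)+
  ultimately show ?thesis using assms by (simp add: primitive_def)
qed

lemma primitive_sum: "(\<And>a. a \<in> A \<Longrightarrow> primitive (f a :: ('x, 'k::comm_ring_1) ncs)) \<Longrightarrow> primitive (sum f A)"
  by (induction A rule: infinite_finite_induct) (auto simp: primitive_0 primitive_add)

text \<open>The coproduct of \<open>u\<close> is a product of commuting factors, one in each tensor
  slot; in each summand of the coproduct of \<open>p\<close> one of them cancels against its
  inverse. This makes the images of the \<open>B(i)\<close> under the group action
  primitive.\<close>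

lemma primitive_nc_Ad:
  fixes u :: "('x, 'k::comm_ring_1) ncs"
  assumes X: "finite X" "u \<in> nc_over X" "p \<in> nc_over X" and u: "grouplike u" and p: "primitive p"
  shows "primitive (nc_Ad u p)"
proof -
  let ?v = "nc_inv u"
  have u1: "nc_coeff u [] = 1" by (rule grouplike_Nil[OF u])
  have inv: "is_inverse u ?v" by (rule is_inverse_nc_inv[OF u1])
  have v: "?v \<in> nc_over X" "grouplike ?v" using nc_inv_over[OF X(2) u1] grouplike_nc_inv[OF X(1,2) u] by auto
  have c: "tensor2 b * tensor1 a = tensor1 a * tensor2 b" for a b :: "('x, 'k) ncs"
    by (simp add: tensor12_commute)
  have c3: "tensor2 b * (tensor1 a * F) = tensor1 a * (tensor2 b * F)" for a b :: "('x, 'k) ncs" and F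
    by (simp only: mult.assoc[symmetric] c)
  have 1: "tensor1 u * tensor1 ?v = 1" "tensor2 u * tensor2 ?v = 1"
    using is_inverse_tensor[OF inv] by (auto simp: is_inverse_def)
  have 3: "tensor1 u * (tensor1 ?v * F) = F" "tensor2 u * (tensor2 ?v * F) = F" for F
    by (simp_all add: mult.assoc[symmetric] 1)
  have "coproduct (nc_Ad u p) = coproduct u * coproduct p * coproduct ?v"
    unfolding nc_Ad_def using X v by (simp add: coproduct_mult[OF X(1)] nc_over_mult)
  also have "\<dots> = tensor1 u * tensor2 u * (tensor1 p + tensor2 p) * (tensor1 ?v * tensor2 ?v)"
    using u v p by (simp add: grouplike_iff_coproduct primitive_def)
  also have "\<dots> = tensor1 u * tensor1 p * tensor1 ?v + tensor2 u * tensor2 p * tensor2 ?v"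
    by (simp add: distrib_left distrib_right mult.assoc c c3 1 3)
  also have "\<dots> = tensor1 (nc_Ad u p) + tensor2 (nc_Ad u p)"
    by (simp add: nc_Ad_def tensor1_mult nc_const_mult)
  finally show ?thesis by (simp add: primitive_def)
qed

section \<open>Units, conjugation and substitution\<close>

definition unit :: "'r::ring_1 \<Rightarrow> bool"
  where "unit u \<longleftrightarrow> (\<exists>v. is_inverse u v)"

text \<open>The same inverse as \<open>nc_inv\<close>, but in an arbitrary ring, since the
  identities for t_{4,N} live in a quotient.\<close>

definition rinv :: "'r::ring_1 \<Rightarrow> 'r"
  where "rinv u = (THE v. is_inverse u v)"

definition ad :: "'r::ring_1 \<Rightarrow> 'r \<Rightarrow> 'r"
  where "ad u x = u * x * rinv u"

lemma rinv_eqI: "is_inverse u v \<Longrightarrow> rinv u = v"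
  unfolding rinv_def by (rule the_equality) (auto dest: is_inverse_unique)

lemma is_inverse_rinv: "unit u \<Longrightarrow> is_inverse u (rinv u)"
  unfolding unit_def using rinv_eqI by metis

lemma unitI: "is_inverse u v \<Longrightarrow> unit u"
  by (auto simp: unit_def)

lemma nc_inv_eq_rinv: "nc_inv f = rinv f"
  by (simp add: nc_inv_def rinv_def is_inverse_def)

lemma nc_Ad_eq_ad: "nc_Ad u x = ad u x"
  by (simp add: nc_Ad_def ad_def nc_inv_eq_rinv)

context
  fixes u :: "'r::ring_1" assumes u: "unit u"
begin

lemma rinv_right [simp]: "u * rinv u = 1" and rinv_left [simp]: "rinv u * u = 1"
  using is_inverse_rinv[OF u] by (auto simp: is_inverse_def)

lemma rinv_right_assoc [simp]: "u * (rinv u * x) = x" and rinv_left_assoc [simp]: "rinv u * (u * x) = x"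
  by (simp_all add: mult.assoc[symmetric])

lemma unit_rinv [simp]: "unit (rinv u)"
  using is_inverse_rinv[OF u] is_inverse_sym unitI by blast

lemma rinv_rinv [simp]: "rinv (rinv u) = u"
  using is_inverse_rinv[OF u] is_inverse_sym rinv_eqI by blast

lemma mult_eq_iff_eq_rinv_mult: "u * x = y \<longleftrightarrow> x = rinv u * y"
  by auto

lemma mult_rinv_eq_iff: "y * rinv u = x \<longleftrightarrow> y = x * u"
  by (metis mult.assoc mult_1_right rinv_left rinv_right)

lemma rinv_commute: "u * x = x * u \<Longrightarrow> rinv u * x = x * rinv u"
  by (metis mult.assoc mult_1_left mult_1_right rinv_left rinv_right)

lemma ad_commute: "u * x = x * u \<Longrightarrow> ad u x = x"
  by (simp add: ad_def mult.assoc)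

lemma ad_mult_distrib: "ad u (x * y) = ad u x * ad u y"
  by (simp add: ad_def mult.assoc)

lemma ad_ad_rinv [simp]: "ad u (ad (rinv u) x) = x" and ad_rinv_ad [simp]: "ad (rinv u) (ad u x) = x"
  by (simp_all add: ad_def mult.assoc)

lemma ad_eq_iff: "ad u x = ad u y \<longleftrightarrow> x = y"
  by (metis ad_rinv_ad)

lemma ad_mult: "unit v \<Longrightarrow> ad (u * v) x = ad u (ad v x)"
  using rinv_eqI[OF is_inverse_mult[OF is_inverse_rinv[OF u] is_inverse_rinv[of v]]]
  by (simp add: ad_def mult.assoc)

lemma unit_mult [simp]: "unit v \<Longrightarrow> unit (u * v)"
  using is_inverse_mult[OF is_inverse_rinv[OF u] is_inverse_rinv[of v]] unitI by blast

lemma rinv_mult: "unit v \<Longrightarrow> rinv (u * v) = rinv v * rinv u"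
  by (rule rinv_eqI[OF is_inverse_mult[OF is_inverse_rinv[OF u] is_inverse_rinv[of v]]])

lemma ad_1_right [simp]: "ad u 1 = 1"
  by (simp add: ad_def)

lemma unit_mult_left_cancel: "u * x = u * y \<longleftrightarrow> x = y"
  by (metis rinv_left_assoc)

end

lemma unit_1 [simp]: "unit 1" and rinv_1 [simp]: "rinv 1 = 1"
  using rinv_eqI[of 1 1] unitI[of 1 1] by (simp_all add: is_inverse_def)

lemma ad_1 [simp]: "ad 1 x = x"
  by (simp add: ad_def)

lemma ad_add: "ad u (x + y) = ad u x + ad u y"
  and ad_diff: "ad u (x - y) = ad u x - ad u y"
  by (simp_all add: ad_def algebra_simps)

lemma ad_0 [simp]: "ad u 0 = 0"
  by (simp add: ad_def)

section \<open>Substitutions for \<open>A\<close> and the \<open>B(i)\<close>, with residues modulo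
  N\<close>

definition ab_letters :: "nat \<Rightarrow> ab set"
  where "ab_letters N = {LA} \<union> LB ` {0..<int N}"

lemma finite_ab_letters [simp]: "finite (ab_letters N)"
  and LA_in_ab_letters [simp]: "LA \<in> ab_letters N"
  and LB_in_ab_letters [simp]: "LB i \<in> ab_letters N \<longleftrightarrow> i \<in> {0..<int N}"
  by (auto simp: ab_letters_def)

lemma exp_t03_iff: "f \<in> exp_t03 N \<longleftrightarrow> f \<in> nc_over (ab_letters N) \<and> grouplike f"
  by (simp add: exp_t03_def ab_letters_def)

definition ab_assign :: "'r \<Rightarrow> (int \<Rightarrow> 'r) \<Rightarrow> ab \<Rightarrow> 'r"
  where "ab_assign X Y = (\<lambda>l. case l of LA \<Rightarrow> X | LB i \<Rightarrow> Y i)"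

lemma ab_assign_simps [simp]: "ab_assign X Y LA = X" "ab_assign X Y (LB i) = Y i"
  by (simp_all add: ab_assign_def)

text \<open>Functions on Z/N are kept as functions of integers with period N, so that index
  arithmetic stays free of reductions; only the letters themselves carry representatives in
  \<open>{0..<N}\<close>.\<close>

definition periodic :: "nat \<Rightarrow> (int \<Rightarrow> 'r) \<Rightarrow> bool"
  where "periodic N Y \<longleftrightarrow> (\<forall>i. Y (i mod int N) = Y i)"

lemma periodicD: "periodic N Y \<Longrightarrow> Y (i mod int N) = Y i"
  by (simp add: periodic_def)

lemma periodic_cong: "periodic N Y \<Longrightarrow> i mod int N = j mod int N \<Longrightarrow> Y i = Y j"
  by (metis periodicD)

lemma periodic_shift: "periodic N Y \<Longrightarrow> periodic N (\<lambda>i. Y (i + a))"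
  and periodic_neg: "periodic N Y \<Longrightarrow> periodic N (\<lambda>i. Y (- i))"
  and periodic_rev: "periodic N Y \<Longrightarrow> periodic N (\<lambda>i. Y (a - i))"
  unfolding periodic_def by (metis mod_add_left_eq, metis mod_minus_eq, metis mod_diff_right_eq)

lemma periodic_add: "periodic N Y \<Longrightarrow> periodic N Z \<Longrightarrow> periodic N (\<lambda>i. Y i + Z i)"
  and periodic_const [simp]: "periodic N (\<lambda>i. c)"
  by (simp_all add: periodic_def)

lemma sum_periodic_shift:
  fixes Y :: "int \<Rightarrow> 'r::comm_monoid_add"
  assumes "periodic N Y" "N \<ge> 1"
  shows "(\<Sum>c\<in>{0..<int N}. Y (c + a)) = (\<Sum>c\<in>{0..<int N}. Y c)"
  by (rule sum.reindex_bij_witness[of _ "\<lambda>c. (c - a) mod int N" "\<lambda>c. (c + a) mod int N"])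
    (use assms in \<open>auto simp: mod_simps periodicD\<close>)

lemma sum_periodic_neg:
  fixes Y :: "int \<Rightarrow> 'r::comm_monoid_add"
  assumes "periodic N Y" "N \<ge> 1"
  shows "(\<Sum>c\<in>{0..<int N}. Y (- c)) = (\<Sum>c\<in>{0..<int N}. Y c)"
  by (rule sum.reindex_bij_witness[of _ "\<lambda>c. (- c) mod int N" "\<lambda>c. (- c) mod int N"])
    (use assms in \<open>auto simp: mod_simps periodicD\<close>)

lemma periodic_sB [simp]: "periodic N (sB N)"
  by (simp add: periodic_def sB_def)

lemma hsub_eq_nc_subst: "hsub h X Y = nc_subst (ab_assign X Y) h"
  by (simp add: hsub_def ab_assign_def)

definition endo :: "'x set \<Rightarrow> (('x, 'k::comm_ring_1) ncs \<Rightarrow> ('x, 'k) ncs) \<Rightarrow> bool"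
  where "endo X E \<longleftrightarrow> ncs.continuous_hom X E \<and> (\<forall>f\<in>nc_over X. E f \<in> nc_over X)"

lemma endo_over: "endo X E \<Longrightarrow> f \<in> nc_over X \<Longrightarrow> E f \<in> nc_over X"
  and endo_hom: "endo X E \<Longrightarrow> ncs.continuous_hom X E"
  by (auto simp: endo_def)

context complete_filtered_algebra
begin

lemma ad_fil: "x \<in> fil n \<Longrightarrow> ad u x \<in> fil n"
  unfolding ad_def by (rule fil_conj)

lemma continuous_hom_comp:
  assumes E: "endo X E" and H: "continuous_hom X H"
  shows "continuous_hom X (\<lambda>f. H (E f))"
  unfolding continuous_hom_def
  using ncs.chom_add[OF endo_hom[OF E]] ncs.chom_mult[OF endo_hom[OF E]] ncs.chom_const[OF endo_hom[OF E]]
    ncs.chom_deg[OF endo_hom[OF E]] endo_over[OF E] chom_add[OF H] chom_mult[OF H] chom_const[OF H] chom_deg[OF H]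
  by simp

lemma chom_ext:
  assumes H: "continuous_hom X H" and K: "continuous_hom X K" and X: "finite X" "f \<in> nc_over X"
    and eq: "\<And>x. x \<in> X \<Longrightarrow> H (nc_var x) = K (nc_var x)"
  shows "H f = K f"
proof -
  have "ev (\<lambda>x. H (nc_var x)) f = ev (\<lambda>x. K (nc_var x)) f"
    by (rule ev_cong[OF X]) (use eq chom_deg[OF K] in \<open>auto simp: nc_over_var\<close>)
  then show ?thesis by (simp add: chom_eq_ev[OF H X] chom_eq_ev[OF K X])
qed

lemma chom_is_inverse:
  assumes "continuous_hom X H" "u \<in> nc_over X" "nc_coeff u [] = 1"
  shows "is_inverse (H u) (H (nc_inv u))"
  using is_inverse_nc_inv[OF assms(3)] chom_mult[OF assms(1)] nc_inv_over[OF assms(2,3)] assms(2) chom_1[OF assms(1)]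
  by (metis is_inverse_def)

lemma chom_unit: "continuous_hom X H \<Longrightarrow> u \<in> nc_over X \<Longrightarrow> nc_coeff u [] = 1 \<Longrightarrow> unit (H u)"
  and chom_rinv: "continuous_hom X H \<Longrightarrow> u \<in> nc_over X \<Longrightarrow> nc_coeff u [] = 1 \<Longrightarrow> H (rinv u) = rinv (H u)"
  using chom_is_inverse[of X H u] by (auto simp: nc_inv_eq_rinv rinv_eqI unitI)

lemma chom_ad:
  assumes "continuous_hom X H" "u \<in> nc_over X" "nc_coeff u [] = 1" "x \<in> nc_over X"
  shows "H (ad u x) = ad (H u) (H x)"
  using assms chom_mult[OF assms(1)] nc_inv_over[OF assms(2,3)]
  by (simp add: ad_def nc_over_mult chom_rinv nc_inv_eq_rinv)

text \<open>The value h(X | Y_i) in an arbitrary target; \<open>hsub_eq_hev\<close> gives the case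
  of series.\<close>

definition hev :: "'k ab_series \<Rightarrow> 'r \<Rightarrow> (int \<Rightarrow> 'r) \<Rightarrow> 'r"
  where "hev h X Y = ev (ab_assign X Y) h"

context
  fixes N :: nat and X :: 'r and Y :: "int \<Rightarrow> 'r"
  assumes X: "X \<in> fil (Suc 0)" and Y: "\<And>i. Y i \<in> fil (Suc 0)"
begin

lemma ab_assign_fil: "ab_assign X Y l \<in> fil (Suc 0)"
  using X Y by (cases l) auto

lemma continuous_hom_hev: "continuous_hom (ab_letters N) (\<lambda>f. hev f X Y)"
  unfolding hev_def by (rule continuous_hom_ev) (auto simp: ab_assign_fil)

lemma hev_sA: "hev sA X Y = X"
  by (simp add: hev_def sA_def ev_var X)

lemma hev_sB: "periodic N Y \<Longrightarrow> hev (sB N i) X Y = Y i"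
  by (simp add: hev_def sB_def ev_var Y periodicD)

lemma hev_ad:
  assumes "f \<in> nc_over (ab_letters N)" "unit u"
  shows "hev f (ad u X) (\<lambda>i. ad u (Y i)) = ad u (hev f X Y)"
proof -
  have "ad u (hev f X Y) = ev (\<lambda>l. u * ab_assign X Y l * rinv u) f"
    unfolding hev_def ad_def
    by (rule ev_conj[symmetric, OF _ assms(1)]) (auto simp: is_inverse_rinv assms(2) ab_assign_fil)
  also have "(\<lambda>l. u * ab_assign X Y l * rinv u) = ab_assign (ad u X) (\<lambda>i. ad u (Y i))"
    by (auto simp: fun_eq_iff ad_def ab_assign_def split: ab.splits)
  finally show ?thesis by (simp add: hev_def)
qed

lemma hev_commute:
  assumes "f \<in> nc_over (ab_letters N)" "z * X = X * z" "\<And>i. z * Y i = Y i * z"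
  shows "z * hev f X Y = hev f X Y * z"
  unfolding hev_def by (rule ev_commute[OF finite_ab_letters assms(1) ab_assign_fil]) (use assms(2,3) in \<open>auto simp: ab_assign_def split: ab.splits\<close>)

lemma unit_hev:
  assumes "f \<in> exp_t03 N" shows "unit (hev f X Y)"
  using chom_unit[OF continuous_hom_hev] assms by (auto simp: exp_t03_iff grouplike_Nil)

lemma hev_nc_inv:
  assumes "f \<in> exp_t03 N" shows "hev (nc_inv f) X Y = rinv (hev f X Y)"
  using chom_rinv[OF continuous_hom_hev] assms by (auto simp: exp_t03_iff grouplike_Nil nc_inv_eq_rinv)

end

lemma chom_hsub:
  assumes "f \<in> nc_over (ab_letters N)" and H: "continuous_hom Z H"
    and X: "X \<in> nc_over Z" "X \<in> nc_deg (Suc 0)" and Y: "\<And>i. Y i \<in> nc_over Z" "\<And>i. Y i \<in> nc_deg (Suc 0)"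
  shows "H (hsub f X Y) = hev f (H X) (\<lambda>i. H (Y i))"
proof -
  have "H (hsub f X Y) = ev (\<lambda>l. H (ab_assign X Y l)) f"
    unfolding hsub_eq_nc_subst
    by (rule chom_nc_subst[OF _ assms(1) _ _ H]) (use X Y in \<open>auto simp: ab_assign_def split: ab.splits\<close>)
  also have "(\<lambda>l. H (ab_assign X Y l)) = ab_assign (H X) (\<lambda>i. H (Y i))"
    by (auto simp: fun_eq_iff ab_assign_def split: ab.splits)
  finally show ?thesis by (simp add: hev_def)
qed

end

lemma hsub_eq_hev:
  fixes f :: "'k::comm_ring_1 ab_series"
  assumes "f \<in> nc_over (ab_letters N)" "X \<in> nc_deg (Suc 0)" "\<And>i. Y i \<in> nc_deg (Suc 0)"
  shows "hsub f X Y = ncs.hev f X Y"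
  unfolding hsub_eq_nc_subst ncs.hev_def
  by (rule nc_subst_eq_ev[OF _ assms(1)]) (use assms in \<open>auto simp: ab_assign_def split: ab.splits\<close>)

lemma sA_over [simp]: "sA \<in> nc_over (ab_letters N)"
  and sA_deg [simp]: "sA \<in> nc_deg (Suc 0)"
  and sB_deg [simp]: "sB N i \<in> nc_deg (Suc 0)"
  by (simp_all add: sA_def sB_def nc_over_var)

lemma sB_over: "N \<ge> 1 \<Longrightarrow> sB N i \<in> nc_over (ab_letters N)"
  by (simp add: sB_def nc_over_var)

lemma sC_over: "N \<ge> 1 \<Longrightarrow> sC N \<in> nc_over (ab_letters N)"
  by (auto simp: sC_def intro!: nc_over_diff nc_over_uminus nc_over_sum sB_over)

lemma sC_deg [simp]: "sC N \<in> nc_deg (Suc 0)"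
  by (simp add: nc_deg_Suc_0_iff sC_def nc_coeff_sum sA_def sB_def nc_coeff_var)

lemma endo_hsub:
  fixes X :: "'k::comm_ring_1 ab_series"
  assumes "X \<in> nc_over (ab_letters N)" "X \<in> nc_deg (Suc 0)"
    and "\<And>i. Y i \<in> nc_over (ab_letters N)" "\<And>i. Y i \<in> nc_deg (Suc 0)"
  shows "endo (ab_letters N) (\<lambda>f. hsub f X Y)"
proof -
  have "ncs.continuous_hom UNIV (\<lambda>f :: 'k ab_series. f)"
    by (simp add: ncs.continuous_hom_def)
  then have "ncs.continuous_hom (ab_letters N) (\<lambda>f. hsub f X Y)"
    unfolding hsub_eq_nc_subst
    by (intro ncs.continuous_hom_nc_subst[of _ _ UNIV "\<lambda>f. f"]) (use assms in \<open>auto simp: ab_assign_def split: ab.splits\<close>)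
  moreover have "hsub f X Y \<in> nc_over (ab_letters N)" if "f \<in> nc_over (ab_letters N)" for f
    unfolding hsub_eq_nc_subst by (rule nc_subst_over[OF that]) (use assms in \<open>auto simp: ab_assign_def split: ab.splits\<close>)
  ultimately show ?thesis by (simp add: endo_def)
qed

lemma hsub_sA:
  fixes X :: "('y, 'k::comm_ring_1) ncs"
  assumes "X \<in> nc_deg (Suc 0)" "\<And>i. Y i \<in> nc_deg (Suc 0)"
  shows "hsub sA X Y = X"
  by (simp add: hsub_eq_hev[OF sA_over assms] ncs.hev_sA assms)

lemma hsub_sB:
  fixes X :: "('y, 'k::comm_ring_1) ncs"
  assumes "N \<ge> 1" "X \<in> nc_deg (Suc 0)" "\<And>i. Y i \<in> nc_deg (Suc 0)" "periodic N Y"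
  shows "hsub (sB N i) X Y = Y i"
  by (simp add: hsub_eq_hev[OF sB_over[OF assms(1)] assms(2,3)] ncs.hev_sB assms)

context complete_filtered_algebra
begin

lemma chom_ext_ab:
  assumes "continuous_hom (ab_letters N) H" "continuous_hom (ab_letters N) K" "f \<in> nc_over (ab_letters N)"
    and "H sA = K sA" "\<And>i. H (sB N i) = K (sB N i)"
  shows "H f = K f"
proof (rule chom_ext[OF assms(1,2) _ assms(3)])
  fix l assume l: "l \<in> ab_letters N"
  show "H (nc_var l) = K (nc_var l)"
  proof (cases l)
    case (LB i)
    then show ?thesis using assms(5)[of i] l by (simp add: sB_def)
  qed (use assms(4) in \<open>simp add: sA_def\<close>)
qed simp

end

text \<open>The endomorphism \<open>A \<mapsto> A, B(i) \<mapsto> Ad(\<tau>\<^sub>i h\<^sup>-\<^sup>1)(B(i))\<close> through which the group acts; \<open>twist_mult\<close> is the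
  product of the group, and \<open>flip\<close> is \<open>A \<mapsto> C, B(i) \<mapsto> B(-i)\<close>.\<close>

definition twist :: "nat \<Rightarrow> 'k::comm_ring_1 ab_series \<Rightarrow> 'k ab_series \<Rightarrow> 'k ab_series"
  where "twist N h f = hsub f sA (\<lambda>i. nc_Ad (tau N i (nc_inv h)) (sB N i))"

definition twist_mult :: "nat \<Rightarrow> 'k::comm_ring_1 ab_series \<Rightarrow> 'k ab_series \<Rightarrow> 'k ab_series"
  where "twist_mult N h1 h2 = h2 * twist N h2 h1"

definition flip :: "nat \<Rightarrow> 'k::comm_ring_1 ab_series \<Rightarrow> 'k ab_series"
  where "flip N f = hsub f (sC N) (\<lambda>i. sB N (- i))"

section \<open>Endomorphisms of the series at level N\<close>

locale level =
  fixes N :: nat assumes N: "N \<ge> 1"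
begin

abbreviation series :: "'k::comm_ring_1 ab_series set"
  where "series \<equiv> nc_over (ab_letters N)"

lemmas sBC_over [simp] = sB_over[OF N] sC_over[OF N]

lemma exp_over [simp]: "h \<in> exp_t03 N \<Longrightarrow> h \<in> series"
  and exp_Nil [simp]: "h \<in> exp_t03 N \<Longrightarrow> nc_coeff h [] = 1"
  by (auto simp: exp_t03_iff grouplike_Nil)

lemma exp_unit [simp]: "h \<in> exp_t03 N \<Longrightarrow> unit (h :: 'k::comm_ring_1 ab_series)"
  using is_inverse_nc_inv[of h] unitI exp_Nil by blast

lemma exp_1 [simp]: "(1 :: 'k::comm_ring_1 ab_series) \<in> exp_t03 N"
  by (simp add: exp_t03_iff grouplike_1)

lemma exp_mult: "f \<in> exp_t03 N \<Longrightarrow> g \<in> exp_t03 N \<Longrightarrow> f * g \<in> exp_t03 N" for f g :: "'k::comm_ring_1 ab_series"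
  using grouplike_mult[of "ab_letters N" f g] by (simp add: exp_t03_iff nc_over_mult)

lemma exp_rinv: "f \<in> exp_t03 N \<Longrightarrow> rinv f \<in> exp_t03 N" for f :: "'k::comm_ring_1 ab_series"
  using grouplike_nc_inv[of "ab_letters N" f] nc_inv_over[of f "ab_letters N"]
  by (auto simp: exp_t03_iff nc_inv_eq_rinv grouplike_Nil)

lemma ad_over: "u \<in> exp_t03 N \<Longrightarrow> x \<in> series \<Longrightarrow> ad u x \<in> series" for u x :: "'k::comm_ring_1 ab_series"
  by (simp add: ad_def nc_over_mult exp_rinv)

lemma primitive_ad: "u \<in> exp_t03 N \<Longrightarrow> x \<in> series \<Longrightarrow> primitive x \<Longrightarrow> primitive (ad u x)"
  for u x :: "'k::comm_ring_1 ab_series"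
  using primitive_nc_Ad[of "ab_letters N" u x] by (simp add: nc_Ad_eq_ad exp_t03_iff)

lemma primitive_letters [simp]: "primitive (sA :: 'k::comm_ring_1 ab_series)" "primitive (sB N i :: 'k ab_series)"
    "primitive (sC N :: 'k ab_series)"
proof -
  show 1: "primitive (sA :: 'k ab_series)" "primitive (sB N i :: 'k ab_series)" for i
    by (simp_all add: sA_def sB_def primitive_var)
  have "primitive (- sA + - (\<Sum>a\<in>{0..<int N}. sB N a) :: 'k ab_series)"
    using 1 by (intro primitive_add primitive_uminus primitive_sum)
  then show "primitive (sC N :: 'k ab_series)" by (simp add: sC_def)
qed

lemma hsub_exp:
  fixes f :: "'k::comm_ring_1 ab_series"
  assumes "f \<in> exp_t03 N" "X \<in> series" "X \<in> nc_deg (Suc 0)" "primitive X"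
    and "\<And>i. Y i \<in> series" "\<And>i. Y i \<in> nc_deg (Suc 0)" "\<And>i. primitive (Y i)"
  shows "hsub f X Y \<in> exp_t03 N"
proof -
  have "hsub f X Y \<in> series"
    using endo_hsub[of X N Y] assms by (auto simp: endo_def)
  moreover have "grouplike (hsub f X Y)"
    unfolding hsub_eq_nc_subst
    by (rule grouplike_nc_subst[of "ab_letters N" _ "ab_letters N"])
       (use assms in \<open>auto simp: exp_t03_iff ab_assign_def split: ab.splits\<close>)
  ultimately show ?thesis by (simp add: exp_t03_iff)
qed

lemma endo_tau: "endo (ab_letters N) (tau N a :: 'k::comm_ring_1 ab_series \<Rightarrow> _)"
  and endo_flip: "endo (ab_letters N) (flip N :: 'k::comm_ring_1 ab_series \<Rightarrow> _)"
  unfolding tau_def flip_def by (rule endo_hsub; simp)+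

lemma tau_sA [simp]: "tau N a sA = (sA :: 'k::comm_ring_1 ab_series)"
  and tau_sB [simp]: "tau N a (sB N i) = (sB N (i + a) :: 'k::comm_ring_1 ab_series)"
  and flip_sA [simp]: "flip N sA = (sC N :: 'k::comm_ring_1 ab_series)"
  and flip_sB [simp]: "flip N (sB N i) = (sB N (- i) :: 'k::comm_ring_1 ab_series)"
  by (simp_all add: tau_def flip_def hsub_sA hsub_sB[OF N] periodic_shift periodic_neg)

lemma tau_exp: "h \<in> exp_t03 N \<Longrightarrow> tau N a h \<in> exp_t03 N"
  and flip_exp: "h \<in> exp_t03 N \<Longrightarrow> flip N h \<in> exp_t03 N" for h :: "'k::comm_ring_1 ab_series"
  unfolding tau_def flip_def by (rule hsub_exp; simp)+

lemma sB_mod: "sB N (i mod int N) = sB N i"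
  by (simp add: sB_def)

lemma twist_eq: "twist N h f = hsub f sA (\<lambda>i. ad (tau N i (rinv h)) (sB N i))"
  by (simp add: twist_def nc_Ad_eq_ad nc_inv_eq_rinv)

lemma tau_mod: "tau N (i mod int N) h = tau N i h"
  by (simp add: tau_def sB_def mod_simps)

context
  fixes h :: "'k::comm_ring_1 ab_series" assumes h: "h \<in> exp_t03 N"
begin

lemma twist_image: "ad (tau N i (rinv h)) (sB N i) \<in> series" "ad (tau N i (rinv h)) (sB N i) \<in> nc_deg (Suc 0)"
    "primitive (ad (tau N i (rinv h)) (sB N i))"
  using h by (simp_all add: ad_over tau_exp exp_rinv ncs.ad_fil primitive_ad)

lemma endo_twist: "endo (ab_letters N) (twist N h)"
  unfolding twist_eq by (rule endo_hsub) (simp_all add: twist_image)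

lemma twist_sA [simp]: "twist N h sA = sA"
  unfolding twist_eq by (rule hsub_sA) (simp_all add: twist_image)

lemma twist_sB: "twist N h (sB N i) = ad (tau N i (rinv h)) (sB N i)"
  unfolding twist_eq
  by (rule hsub_sB[OF N]) (simp_all add: twist_image periodic_def tau_mod sB_mod)

lemma twist_exp: "f \<in> exp_t03 N \<Longrightarrow> twist N h f \<in> exp_t03 N"
  unfolding twist_eq by (rule hsub_exp) (simp_all add: twist_image)

end

end

section \<open>The group of group-like series\<close>

context level
begin

lemma endo_comp:
  fixes E F :: "'k::comm_ring_1 ab_series \<Rightarrow> 'k ab_series"
  assumes "endo (ab_letters N) E" "endo (ab_letters N) F"
  shows "endo (ab_letters N) (\<lambda>f. E (F f))"
  using ncs.continuous_hom_comp[OF assms(2) endo_hom[OF assms(1)]] assms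
  by (simp add: endo_def)

lemma endo_id: "endo (ab_letters N) (\<lambda>f :: 'k::comm_ring_1 ab_series. f)"
  by (simp add: endo_def ncs.continuous_hom_def)

lemma series_ext:
  fixes E F :: "'k::comm_ring_1 ab_series \<Rightarrow> 'k ab_series"
  assumes "endo (ab_letters N) E" "endo (ab_letters N) F" "f \<in> series"
    and "E sA = F sA" "\<And>i. E (sB N i) = F (sB N i)"
  shows "E f = F f"
  using ncs.chom_ext_ab[OF endo_hom[OF assms(1)] endo_hom[OF assms(2)] assms(3-5)] .

lemma endo_ad:
  fixes E :: "'k::comm_ring_1 ab_series \<Rightarrow> 'k ab_series"
  assumes "endo (ab_letters N) E" "u \<in> exp_t03 N"
  shows "endo (ab_letters N) (\<lambda>f. ad u (E f))"
  using ncs.continuous_hom_conj[OF endo_hom[OF assms(1)] is_inverse_rinv[OF exp_unit[OF assms(2)]]] assms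
  by (simp add: endo_def ad_over flip: ad_def)

context
  fixes E :: "'k::comm_ring_1 ab_series \<Rightarrow> 'k ab_series"
  assumes E: "endo (ab_letters N) E"
begin

lemma endo_mult: "f \<in> series \<Longrightarrow> g \<in> series \<Longrightarrow> E (f * g) = E f * E g"
  and endo_1: "E 1 = 1"
  and endo_diff: "f \<in> series \<Longrightarrow> g \<in> series \<Longrightarrow> E (f - g) = E f - E g"
  and endo_uminus: "f \<in> series \<Longrightarrow> E (- f) = - E f"
  and endo_sum: "(\<And>a. a \<in> A \<Longrightarrow> F a \<in> series) \<Longrightarrow> E (sum F A) = (\<Sum>a\<in>A. E (F a))"
  and endo_rinv: "u \<in> exp_t03 N \<Longrightarrow> E (rinv u) = rinv (E u)"
  and endo_apply_ad: "u \<in> exp_t03 N \<Longrightarrow> f \<in> series \<Longrightarrow> E (ad u f) = ad (E u) (E f)"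
proof -
  note H = endo_hom[OF E]
  show "f \<in> series \<Longrightarrow> g \<in> series \<Longrightarrow> E (f * g) = E f * E g" by (rule ncs.chom_mult[OF H])
  show "E 1 = 1" by (rule ncs.chom_1[OF H])
  show "f \<in> series \<Longrightarrow> g \<in> series \<Longrightarrow> E (f - g) = E f - E g" by (rule ncs.chom_diff[OF H])
  show "f \<in> series \<Longrightarrow> E (- f) = - E f" by (rule ncs.chom_uminus[OF H])
  show "(\<And>a. a \<in> A \<Longrightarrow> F a \<in> series) \<Longrightarrow> E (sum F A) = (\<Sum>a\<in>A. E (F a))" by (rule ncs.chom_sum[OF H])
  show "u \<in> exp_t03 N \<Longrightarrow> E (rinv u) = rinv (E u)" by (rule ncs.chom_rinv[OF H]) simp_all
  show "u \<in> exp_t03 N \<Longrightarrow> f \<in> series \<Longrightarrow> E (ad u f) = ad (E u) (E f)" by (rule ncs.chom_ad[OF H]) simp_all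
qed

lemma endo_sC: "E (sC N) = - E sA - (\<Sum>a\<in>{0..<int N}. E (sB N a))"
  by (simp add: sC_def endo_diff endo_uminus endo_sum nc_over_uminus nc_over_sum)

end

lemmas tau_mult = endo_mult[OF endo_tau] and tau_rinv = endo_rinv[OF endo_tau] and tau_ad = endo_apply_ad[OF endo_tau]
  and tau_over = endo_over[OF endo_tau]
lemmas flip_mult = endo_mult[OF endo_flip] and flip_rinv = endo_rinv[OF endo_flip] and flip_ad = endo_apply_ad[OF endo_flip]
  and flip_over = endo_over[OF endo_flip]
lemmas twist_mult_hom = endo_mult[OF endo_twist] and twist_rinv = endo_rinv[OF endo_twist]
  and twist_ad = endo_apply_ad[OF endo_twist] and twist_over = endo_over[OF endo_twist]

lemma tau_sC: "tau N a (sC N) = (sC N :: 'k::comm_ring_1 ab_series)"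
  by (simp add: endo_sC[OF endo_tau] sum_periodic_shift[OF periodic_sB N]) (simp add: sC_def)

lemma tau_0: "f \<in> series \<Longrightarrow> tau N 0 f = f" for f :: "'k::comm_ring_1 ab_series"
  by (rule series_ext[OF endo_tau endo_id]) simp_all

lemma tau_tau: "f \<in> series \<Longrightarrow> tau N a (tau N b f) = tau N (a + b) f" for f :: "'k::comm_ring_1 ab_series"
  by (rule series_ext[OF endo_comp[OF endo_tau endo_tau] endo_tau]) (simp_all add: algebra_simps)

lemma flip_tau: "f \<in> series \<Longrightarrow> flip N (tau N a f) = tau N (- a) (flip N f)" for f :: "'k::comm_ring_1 ab_series"
  by (rule series_ext[OF endo_comp[OF endo_flip endo_tau] endo_comp[OF endo_tau endo_flip]])
     (simp_all add: tau_sC)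

text \<open>The image of \<open>B(i)\<close> is the shift by \<open>i\<close> of the image of
  \<open>B(0)\<close>, so the twist is equivariant by construction.\<close>

lemma tau_twist:
  fixes f :: "'k::comm_ring_1 ab_series"
  assumes h: "h \<in> exp_t03 N" and f: "f \<in> series"
  shows "tau N a (twist N h f) = twist N h (tau N a f)"
  by (rule series_ext[OF endo_comp[OF endo_tau endo_twist[OF h]] endo_comp[OF endo_twist[OF h] endo_tau] f])
     (simp_all add: h twist_sB tau_ad tau_exp exp_rinv tau_tau add.commute)

lemma twist_mult_exp: "h1 \<in> exp_t03 N \<Longrightarrow> h2 \<in> exp_t03 N \<Longrightarrow> twist_mult N h1 h2 \<in> exp_t03 N"
  for h1 h2 :: "'k::comm_ring_1 ab_series"
  by (simp add: twist_mult_def exp_mult twist_exp)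

lemma twist_twist_mult:
  fixes f :: "'k::comm_ring_1 ab_series"
  assumes h: "h1 \<in> exp_t03 N" "h2 \<in> exp_t03 N" and f: "f \<in> series"
  shows "twist N (twist_mult N h1 h2) f = twist N h2 (twist N h1 f)"
proof (rule series_ext[OF endo_twist[OF twist_mult_exp[OF h]] endo_comp[OF endo_twist[OF h(2)] endo_twist[OF h(1)]] f])
  fix i
  \<comment> \<open>The right factor of the inverse produces the image of \<open>B(i)\<close> under
    the twist by \<open>h2\<close>; the left factor conjugates that image.\<close>
  have "rinv (twist_mult N h1 h2) = twist N h2 (rinv h1) * rinv h2"
    using h by (simp add: twist_mult_def rinv_mult twist_exp twist_rinv)
  then have "tau N i (rinv (twist_mult N h1 h2)) = twist N h2 (tau N i (rinv h1)) * tau N i (rinv h2)"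
    using h by (simp add: tau_mult twist_over tau_twist exp_rinv)
  then show "twist N (twist_mult N h1 h2) (sB N i) = twist N h2 (twist N h1 (sB N i))"
    using h by (simp add: twist_sB twist_mult_exp twist_ad ad_mult twist_exp tau_exp exp_rinv)
qed (use h in \<open>simp_all add: twist_mult_exp\<close>)

lemma twist_mult_assoc:
  fixes h1 h2 h3 :: "'k::comm_ring_1 ab_series"
  assumes h: "h1 \<in> exp_t03 N" "h2 \<in> exp_t03 N" "h3 \<in> exp_t03 N"
  shows "twist_mult N (twist_mult N h1 h2) h3 = twist_mult N h1 (twist_mult N h2 h3)"
  using h twist_twist_mult[OF h(2,3) exp_over[OF h(1)]]
  by (simp add: twist_mult_def[of N _ h3] twist_mult_def[of N h1 h2] twist_mult_def[of N h1 "h3 * _"]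
      twist_mult_hom[OF h(3)] twist_over mult.assoc)

lemma twist_1: "f \<in> series \<Longrightarrow> twist N 1 f = f" for f :: "'k::comm_ring_1 ab_series"
  by (rule series_ext[OF endo_twist[OF exp_1] endo_id]) (simp_all add: twist_sB endo_1[OF endo_tau])

lemma twist_mult_1 [simp]:
  "h \<in> exp_t03 N \<Longrightarrow> twist_mult N h 1 = h" "h \<in> exp_t03 N \<Longrightarrow> twist_mult N 1 h = h" for h :: "'k::comm_ring_1 ab_series"
  by (simp_all add: twist_mult_def twist_1 endo_1[OF endo_twist])

section \<open>Contraction estimates and inverses\<close>

lemma rinv_diff_deg:
  fixes x y :: "'k::comm_ring_1 ab_series"
  assumes "x \<in> exp_t03 N" "y \<in> exp_t03 N" "x - y \<in> nc_deg d"
  shows "rinv x - rinv y \<in> nc_deg d"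
proof -
  have "rinv x - rinv y = rinv x * (y - x) * rinv y"
    using assms by (simp add: algebra_simps)
  then show ?thesis using ncs.fil_conj ncs.fil_diff_sym[OF assms(3)] by metis
qed

text \<open>Conjugating the degree 1 letter \<open>B(i)\<close> by two series that agree below
  degree \<open>d\<close> gives results that agree below degree \<open>d + 1\<close>. This gain
  makes the fixed point iteration converge.\<close>

lemma twist_diff_deg:
  fixes x y f :: "'k::comm_ring_1 ab_series"
  assumes x: "x \<in> exp_t03 N" and y: "y \<in> exp_t03 N" and xy: "x - y \<in> nc_deg d"
    and f: "f \<in> series" "nc_coeff f [] = 1"
  shows "twist N x f - twist N y f \<in> nc_deg (Suc d)"
proof -
  let ?\<phi> = "\<lambda>x. ab_assign sA (\<lambda>i. ad (tau N i (rinv x)) (sB N i))"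
  have 1: "ad (tau N i (rinv x)) (sB N i) - ad (tau N i (rinv y)) (sB N i) \<in> nc_deg (Suc d)" for i
  proof -
    let ?u = "tau N i (rinv x)" and ?v = "tau N i (rinv y)"
    have u: "?u - ?v \<in> nc_deg d"
      using ncs.chom_deg[OF endo_hom[OF endo_tau], of "rinv x - rinv y" d i] rinv_diff_deg[OF x y xy] x y
      by (simp add: endo_diff[OF endo_tau] nc_over_diff exp_rinv)
    then have v: "rinv ?u - rinv ?v \<in> nc_deg d"
      using x y by (intro rinv_diff_deg tau_exp exp_rinv)
    have "ad ?u (sB N i) - ad ?v (sB N i) = (?u - ?v) * (sB N i * rinv ?u) + ?v * (sB N i * (rinv ?u - rinv ?v))"
      by (simp add: ad_def algebra_simps)
    moreover have "(?u - ?v) * (sB N i * rinv ?u) \<in> nc_deg (d + Suc 0)"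
      by (intro nc_deg_mult u ncs.fil_mult_right) simp
    moreover have "?v * (sB N i * (rinv ?u - rinv ?v)) \<in> nc_deg (Suc 0 + d)"
      by (intro ncs.fil_mult_left nc_deg_mult v) simp
    ultimately show ?thesis by (simp add: ncs.fil_add)
  qed
  have e: "twist N z g = ncs.ev (?\<phi> z) g" if "z \<in> exp_t03 N" "g \<in> series" for z g :: "'k ab_series"
    unfolding twist_eq hsub_eq_nc_subst
    by (rule nc_subst_eq_ev[OF finite_ab_letters that(2)])
       (use twist_image[OF that(1)] in \<open>auto simp: ab_assign_def split: ab.splits\<close>)
  \<comment> \<open>The constant term is removed first: \<open>ev_diff_fil\<close> counts from the
    lowest degree of the series, and starting from degree 0 would lose the gain.\<close>
  have f1: "f - 1 \<in> series" "f - 1 \<in> nc_deg (Suc 0)"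
    using f by (simp_all add: nc_over_diff nc_deg_Suc_0_iff nc_coeff_one)
  have "twist N x (f - 1) - twist N y (f - 1) \<in> nc_deg (Suc 0 + d)"
    unfolding e[OF x f1(1)] e[OF y f1(1)]
    by (rule ncs.ev_diff_fil[OF finite_ab_letters f1(1)])
       (use 1 f1 twist_image[OF x] twist_image[OF y] in \<open>auto simp: ab_assign_def split: ab.splits\<close>)
  then show ?thesis
    using f by (simp add: endo_diff[OF endo_twist] endo_1[OF endo_twist] x y)
qed

text \<open>Each coefficient condition, including those on the coproduct, involves words of bounded
  length only, so it passes to limits.\<close>

lemma exp_closed:
  fixes x :: "'k::comm_ring_1 ab_series"
  assumes "\<And>m. \<exists>y\<in>exp_t03 N. x - y \<in> nc_deg m"
  shows "x \<in> exp_t03 N"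
proof -
  have "\<exists>y\<in>exp_t03 N. \<forall>w. length w < m \<longrightarrow> nc_coeff x w = nc_coeff y w" for m
    using assms[of m] by (auto simp: nc_deg_def)
  then obtain y where y: "\<And>m. y m \<in> exp_t03 N" "\<And>m w. length w < m \<Longrightarrow> nc_coeff x w = nc_coeff (y m) w"
    by metis
  have "x \<in> series"
    unfolding nc_over_def mem_Collect_eq
    using y(2)[OF lessI] nc_overD[OF exp_over[OF y(1)]] by metis
  moreover have "grouplike x"
    unfolding grouplike_def
  proof (intro conjI allI)
    show "nc_coeff x [] = 1" using y(2)[of "[]" 1] exp_Nil[OF y(1)] by simp
    fix u v :: "ab list"
    let ?y = "y (Suc (length u + length v))"
    have "nc_coprod x u v = nc_coprod ?y u v"
      unfolding nc_coprod_def by (rule sum.cong) (auto simp: unshuffles_length y(2)[of _ "Suc (length u + length v)"])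
    also have "\<dots> = nc_coeff ?y u * nc_coeff ?y v"
      using y(1)[of "Suc (length u + length v)"] unfolding exp_t03_iff grouplike_def by blast
    finally show "nc_coprod x u v = nc_coeff x u * nc_coeff x v"
      using y(2)[of u "Suc (length u + length v)"] y(2)[of v "Suc (length u + length v)"] by simp
  qed
  ultimately show ?thesis by (simp add: exp_t03_iff)
qed

text \<open>A right inverse \<open>x\<close> of \<open>h\<close> is a fixed point of the contraction \<open>x \<mapsto> twist N x (h\<^sup>-\<^sup>1)\<close>.\<close>
lemma twist_mult_right_inverse:
  fixes h :: "'k::comm_ring_1 ab_series"
  assumes h: "h \<in> exp_t03 N"
  shows "\<exists>x\<in>exp_t03 N. twist_mult N h x = 1"
proof -
  define x where "x n = ((\<lambda>x. twist N x (rinv h)) ^^ n) 1" for n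
  have x_Suc: "x (Suc n) = twist N (x n) (rinv h)" for n by (simp add: x_def)
  have x: "x n \<in> exp_t03 N" for n
    by (induction n) (simp_all add: x_Suc twist_exp exp_rinv h, simp add: x_def)
  have r: "rinv h \<in> series" "nc_coeff (rinv h) [] = 1"
    using exp_rinv[OF h] by simp_all
  have d: "x (Suc n) - x n \<in> nc_deg n" for n
  proof (induction n)
    case (Suc n)
    show ?case unfolding x_Suc[of "Suc n"] by (subst (2) x_Suc) (rule twist_diff_deg[OF x x Suc r])
  qed simp
  obtain s where s: "\<And>m. s - (\<Sum>n<m. x (Suc n) - x n) \<in> nc_deg m"
    using ncs.fil_complete[of "\<lambda>n. x (Suc n) - x n", OF d] by blast
  \<comment> \<open>The sum of differences telescopes, so \<open>z\<close> is the limit of the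
    iterates.\<close>
  define z where "z = s + x 0"
  have z: "z - x m \<in> nc_deg m" for m
    using s[of m] by (simp add: sum_lessThan_telescope z_def algebra_simps)
  then have zx: "z \<in> exp_t03 N" using exp_closed x by blast
  have "twist N z (rinv h) = z"
  proof (rule ncs.eqI_fil)
    fix m
    have "twist N z (rinv h) - x (Suc m) \<in> nc_deg (Suc m)"
      unfolding x_Suc by (rule twist_diff_deg[OF zx x z r])
    from ncs.fil_Suc[OF ncs.fil_diff_trans[OF this ncs.fil_diff_sym[OF z]]]
    show "twist N z (rinv h) - z \<in> nc_deg m" .
  qed
  moreover have "z * twist N z h = 1"
    using calculation zx h by (metis exp_unit rinv_right twist_rinv rinv_rinv twist_exp)
  ultimately show ?thesis using zx by (auto simp: twist_mult_def)
qed

text \<open>A right inverse \<open>x\<close> of \<open>h\<close> has a right inverse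
  \<open>y\<close> of its own, and associativity forces \<open>y = h\<close>.\<close>

lemma twist_mult_left_inverse:
  fixes h :: "'k::comm_ring_1 ab_series"
  assumes h: "h \<in> exp_t03 N"
  shows "\<exists>x\<in>exp_t03 N. twist_mult N x h = 1 \<and> twist_mult N h x = 1"
proof -
  obtain x where x: "x \<in> exp_t03 N" "twist_mult N h x = 1" using twist_mult_right_inverse[OF h] by blast
  obtain y where y: "y \<in> exp_t03 N" "twist_mult N x y = 1" using twist_mult_right_inverse[OF x(1)] by blast
  have "h = y" using twist_mult_assoc[OF h x(1) y(1)] x y h by simp
  then show ?thesis using x y by auto
qed

text \<open>The twist by a right inverse undoes the twist by \<open>h\<close>. Injectivity is what
  turns the compatibility of each condition with products into an equivalence.\<close>

lemma twist_inj:
  fixes f g h :: "'k::comm_ring_1 ab_series"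
  assumes "h \<in> exp_t03 N" "f \<in> series" "g \<in> series" "twist N h f = twist N h g"
  shows "f = g"
proof -
  obtain x where x: "x \<in> exp_t03 N" "twist_mult N h x = 1" using twist_mult_right_inverse[OF assms(1)] by blast
  have "twist N x (twist N h e) = e" if "e \<in> series" for e
    using twist_twist_mult[OF assms(1) x(1) that] x(2) twist_1[OF that] by simp
  then show ?thesis using assms by metis
qed

end

section \<open>Octagon, special action and hexagon\<close>

lemma add3_eq_0_iff: "a + b + c = 0 \<longleftrightarrow> - a - b = (c :: 'a::ab_group_add)"
  using add_eq_0_iff[of "a + b" c] by (auto simp: minus_add_distrib)

lemma unit_mult_right_cancel: "unit u \<Longrightarrow> x * u = y * u \<longleftrightarrow> x = y"
  by (metis mult_rinv_eq_iff)

context level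
begin

definition flip_ratio :: "'k::comm_ring_1 ab_series \<Rightarrow> 'k ab_series"
  where "flip_ratio h = rinv h * flip N h"

lemma flip_ratio_exp: "h \<in> exp_t03 N \<Longrightarrow> flip_ratio h \<in> exp_t03 N" for h :: "'k::comm_ring_1 ab_series"
  by (simp add: flip_ratio_def exp_mult exp_rinv flip_exp)

text \<open>The substitution \<open>B(i) \<mapsto> B(1 - i)\<close> is the flip followed by the
  shift by one, so the octagon word regroups as \<tau>_1(k) k^-1 with k =
  \<open>flip_ratio h\<close>.\<close>

lemma octagon_iff:
  fixes h :: "'k::field_char_0 ab_series"
  assumes h: "h \<in> exp_t03 N"
  shows "octagon N h \<longleftrightarrow> tau N 1 (flip_ratio h) = flip_ratio h"
proof -
  have 1: "hsub h sA (\<lambda>i. sB N i) = h"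
    by (rule series_ext[OF endo_hsub endo_id]) (simp_all add: h hsub_sA hsub_sB[OF N])
  have 2: "hsub h (sC N) (\<lambda>i. sB N (1 - i)) = tau N 1 (flip N h)"
    by (rule series_ext[OF endo_hsub endo_comp[OF endo_tau endo_flip]])
      (simp_all add: h hsub_sA hsub_sB[OF N] periodic_rev tau_sC)
  have 3: "hsub h sA (\<lambda>i. sB N (i + 1)) = tau N 1 h" "hsub h (sC N) (\<lambda>i. sB N (- i)) = flip N h"
    by (simp_all add: tau_def flip_def)
  let ?k = "flip_ratio h"
  have u: "unit (flip N h)" "unit h" "unit ?k" "unit (tau N 1 ?k)"
    using h by (simp_all add: flip_exp flip_ratio_exp tau_exp)
  have "octagon N h \<longleftrightarrow> rinv (tau N 1 h) * tau N 1 (flip N h) * rinv (flip N h) * h = 1"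
    by (simp only: octagon_def 1 2 3 nc_inv_eq_rinv)
  also have "rinv (tau N 1 h) * tau N 1 (flip N h) * rinv (flip N h) * h = tau N 1 ?k * rinv ?k"
    using h by (simp add: flip_ratio_def tau_mult tau_rinv rinv_mult u exp_rinv flip_exp flip_over mult.assoc)
  also have "\<dots> = 1 \<longleftrightarrow> tau N 1 ?k = ?k"
    using u by (simp add: mult_rinv_eq_iff)
  finally show ?thesis .
qed

text \<open>Since C = -A - \<Sum>B(a), its twist is minus the first two summands of the
  condition.\<close>

lemma special_action_iff:
  fixes h :: "'k::field_char_0 ab_series"
  assumes h: "h \<in> exp_t03 N"
  shows "special_action N h \<longleftrightarrow> twist N h (sC N) = ad (flip_ratio h) (sC N)"
proof -
  have "special_action N h \<longleftrightarrow>
      sA + (\<Sum>a\<in>{0..<int N}. twist N h (sB N a)) + ad (flip_ratio h) (sC N) = 0"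
    using h by (simp add: special_action_def nc_Ad_eq_ad nc_inv_eq_rinv twist_sB flip_ratio_def flip_def)
  also have "\<dots> \<longleftrightarrow> twist N h (sC N) = ad (flip_ratio h) (sC N)"
    by (simp add: endo_sC[OF endo_twist] h add3_eq_0_iff)
  finally show ?thesis .
qed

context
  fixes h :: "'k::field_char_0 ab_series"
  assumes h: "h \<in> exp_t03 N" and oct: "octagon N h" and special: "special_action N h"
begin

lemma tau_flip_ratio: "tau N a (flip_ratio h) = flip_ratio h"
proof -
  have "tau N (int n) (flip_ratio h) = flip_ratio h" for n
  proof (induction n)
    case (Suc n)
    have "tau N (int (Suc n)) (flip_ratio h) = tau N 1 (tau N (int n) (flip_ratio h))"
      using h by (simp add: tau_tau flip_ratio_exp)
    then show ?case using Suc oct octagon_iff[OF h] by simp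
  qed (simp add: tau_0 flip_ratio_exp h)
  \<comment> \<open>Shifts depend on \<open>a\<close> modulo N only, so nonnegative iterates of
    \<tau>_1 reach the negative ones too.\<close>
  from this[of "nat (a mod int N)"] show ?thesis
    using N by (simp add: tau_mod)
qed

lemma twist_sC: "twist N h (sC N) = ad (flip_ratio h) (sC N)"
  using special special_action_iff[OF h] by simp

text \<open>On \<open>A\<close> the identity is the special action condition, on the
  \<open>B(i)\<close> it is the octagon.\<close>

lemma flip_twist:
  assumes "f \<in> series"
  shows "flip N (twist N h f) = ad (rinv (flip_ratio h)) (twist N h (flip N f))"
proof (rule series_ext[OF endo_comp[OF endo_flip endo_twist[OF h]] _ assms])
  let ?k = "flip_ratio h"
  note k = flip_ratio_exp[OF h]
  show "endo (ab_letters N) (\<lambda>f. ad (rinv ?k) (twist N h (flip N f)))"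
    by (rule endo_ad[OF endo_comp[OF endo_twist[OF h] endo_flip] exp_rinv[OF k]])
  show "flip N (twist N h sA) = ad (rinv ?k) (twist N h (flip N sA))"
    using h k by (simp add: twist_sC)
  fix i
  \<comment> \<open>Invariance allows the ratio to be shifted by \<open>- i\<close>, so that its
    second factor cancels the series conjugating \<open>B(- i)\<close>.\<close>
  have "rinv ?k = rinv (tau N (- i) (flip N h)) * tau N (- i) h"
    using h tau_flip_ratio[of "- i"]
    by (simp add: flip_ratio_def tau_mult tau_rinv exp_rinv flip_over rinv_mult[symmetric] tau_exp flip_exp)
      (metis (no_types, lifting) exp_rinv exp_unit flip_exp rinv_mult rinv_rinv tau_exp)
  then have "ad (rinv ?k) (ad (rinv (tau N (- i) h)) (sB N (- i))) = ad (rinv (tau N (- i) (flip N h))) (sB N (- i))"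
    using h by (simp add: ad_mult tau_exp flip_exp exp_rinv)
  then show "flip N (twist N h (sB N i)) = ad (rinv ?k) (twist N h (flip N (sB N i)))"
    using h by (simp add: twist_sB flip_ad tau_exp exp_rinv flip_tau flip_rinv tau_rinv flip_exp)
qed

lemma flip_ratio_twist_mult:
  assumes f: "f \<in> exp_t03 N"
  shows "flip_ratio (twist_mult N f h) = twist N h (flip_ratio f) * flip_ratio h"
proof -
  let ?k = "flip_ratio h"
  have k: "flip N h = h * ?k" using h by (simp add: flip_ratio_def)
  have "flip_ratio (twist_mult N f h) = rinv (twist N h f) * rinv h * (flip N h * (rinv ?k * twist N h (flip N f) * ?k))"
    using f h flip_ratio_exp[OF h]
    unfolding flip_ratio_def[of "twist_mult N f h"]
    by (simp add: twist_mult_def rinv_mult twist_exp flip_mult twist_over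
        flip_twist ad_def exp_rinv)
  also have "\<dots> = rinv (twist N h f) * twist N h (flip N f) * ?k"
    using f h flip_ratio_exp[OF h] by (simp add: k mult.assoc)
  also have "\<dots> = twist N h (flip_ratio f) * ?k"
    using f h by (simp add: flip_ratio_def[of f] twist_mult_hom exp_rinv flip_over twist_rinv)
  finally show ?thesis .
qed

text \<open>Cancelling the ratio of \<open>h\<close>, and then the injective twist by
  \<open>h\<close>, leaves the condition for \<open>f\<close>.\<close>

lemma special_twist_mult_iff:
  assumes f: "f \<in> exp_t03 N"
  shows "octagon N (twist_mult N f h) \<longleftrightarrow> octagon N f"
    and "special_action N (twist_mult N f h) \<longleftrightarrow> special_action N f"
proof -
  let ?k = "flip_ratio h" and ?l = "flip_ratio f"
  note kl [simp] = flip_ratio_exp[OF h] flip_ratio_exp[OF f] f h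
  have "octagon N (twist_mult N f h) \<longleftrightarrow> tau N 1 (twist N h ?l * ?k) = twist N h ?l * ?k"
    by (simp add: octagon_iff twist_mult_exp flip_ratio_twist_mult)
  also have "tau N 1 (twist N h ?l * ?k) = twist N h (tau N 1 ?l) * ?k"
    by (simp add: tau_mult twist_over tau_twist tau_flip_ratio)
  also have "\<dots> = twist N h ?l * ?k \<longleftrightarrow> twist N h (tau N 1 ?l) = twist N h ?l"
    by (simp add: unit_mult_right_cancel)
  also have "\<dots> \<longleftrightarrow> tau N 1 ?l = ?l"
    using twist_inj[OF h, of "tau N 1 ?l" ?l] by (auto simp: tau_over)
  finally show "octagon N (twist_mult N f h) \<longleftrightarrow> octagon N f"
    by (simp add: octagon_iff)
  have "special_action N (twist_mult N f h) \<longleftrightarrow>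
      twist N h (twist N f (sC N)) = ad (twist N h ?l * ?k) (sC N)"
    by (simp add: special_action_iff twist_mult_exp flip_ratio_twist_mult twist_twist_mult)
  also have "ad (twist N h ?l * ?k) (sC N) = twist N h (ad ?l (sC N))"
    by (simp add: ad_mult twist_exp twist_ad twist_sC)
  also have "twist N h (twist N f (sC N)) = twist N h (ad ?l (sC N)) \<longleftrightarrow> twist N f (sC N) = ad ?l (sC N)"
    using twist_inj[OF h, of "twist N f (sC N)" "ad ?l (sC N)"] by (auto simp: twist_over ad_over)
  finally show "special_action N (twist_mult N f h) \<longleftrightarrow> special_action N f"
    by (simp add: special_action_iff)
qed

end

lemma octagon_1: "octagon N (1 :: 'k::field_char_0 ab_series)"
  by (simp add: octagon_iff flip_ratio_def endo_1[OF endo_tau] endo_1[OF endo_flip])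

lemma special_action_1: "special_action N (1 :: 'k::field_char_0 ab_series)"
  by (simp add: special_action_iff twist_1 flip_ratio_def endo_1[OF endo_flip])

end

section \<open>Level one: two-cycle and hexagon relations\<close>

interpretation one: level 1
  by unfold_locales simp

definition swap_AB :: "'k::comm_ring_1 ab_series \<Rightarrow> 'k ab_series"
  where "swap_AB g = hsub g (sB 1 0) (\<lambda>_. sA)"

definition B_to_C :: "'k::comm_ring_1 ab_series \<Rightarrow> 'k ab_series"
  where "B_to_C g = hsub g sA (\<lambda>_. sC 1)"

lemma int_upto_one: "{0..<1 :: int} = {0}"
  by auto

lemma sB_one: "sB 1 i = sB 1 0"
  by (simp add: sB_def)

lemma endo_swap_AB: "endo (ab_letters 1) (swap_AB :: 'k::comm_ring_1 ab_series \<Rightarrow> _)"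
  and endo_B_to_C: "endo (ab_letters 1) (B_to_C :: 'k::comm_ring_1 ab_series \<Rightarrow> _)"
  unfolding swap_AB_def B_to_C_def by (rule endo_hsub; simp del: One_nat_def)+

lemma swap_AB_letters [simp]: "swap_AB sA = (sB 1 0 :: 'k::comm_ring_1 ab_series)" "swap_AB (sB 1 0) = (sA :: 'k ab_series)"
  and B_to_C_letters [simp]: "B_to_C sA = (sA :: 'k ab_series)" "B_to_C (sB 1 0) = (sC 1 :: 'k ab_series)"
  by (simp_all add: swap_AB_def B_to_C_def hsub_sA hsub_sB[OF order_refl] del: One_nat_def)

lemma one_ext:
  fixes E F :: "'k::comm_ring_1 ab_series \<Rightarrow> 'k ab_series"
  assumes "endo (ab_letters 1) E" "endo (ab_letters 1) F" "f \<in> nc_over (ab_letters 1)"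
    and "E sA = F sA" "E (sB 1 0) = F (sB 1 0)"
  shows "E f = F f"
  using one.series_ext[OF assms(1-4)] assms(5) sB_one by metis

lemma tau_one: "f \<in> nc_over (ab_letters 1) \<Longrightarrow> tau 1 a f = f" for f :: "'k::comm_ring_1 ab_series"
  by (rule one_ext[OF one.endo_tau one.endo_id])
     (simp_all add: one.tau_sA one.tau_sB sB_one[of a] del: One_nat_def)

lemma twist_one_sB: "h \<in> exp_t03 1 \<Longrightarrow> twist 1 h (sB 1 0) = ad (rinv h) (sB 1 0)" for h :: "'k::comm_ring_1 ab_series"
  by (simp add: one.twist_sB tau_one one.exp_rinv del: One_nat_def)

lemma octagon_one: "h \<in> exp_t03 1 \<Longrightarrow> octagon 1 h"
  by (simp add: one.octagon_iff tau_one one.flip_ratio_exp del: One_nat_def)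

definition two_cycle :: "'k::comm_ring_1 ab_series \<Rightarrow> bool"
  where "two_cycle g \<longleftrightarrow> swap_AB g = rinv g"

text \<open>Under the two-cycle relation this is g(C,A) g(B,C) g(A,B) = 1, solved for g(A,B)^-1
  g(C,B). In this form it identifies the ratio that enters the special action condition.\<close>

definition hexagon :: "'k::comm_ring_1 ab_series \<Rightarrow> bool"
  where "hexagon g \<longleftrightarrow> one.flip_ratio g = rinv (B_to_C g)"

lemma swap_AB_exp: "h \<in> exp_t03 1 \<Longrightarrow> swap_AB h \<in> exp_t03 1"
  and B_to_C_exp: "h \<in> exp_t03 1 \<Longrightarrow> B_to_C h \<in> exp_t03 1" for h :: "'k::comm_ring_1 ab_series"
  unfolding swap_AB_def B_to_C_def by (rule one.hsub_exp; simp del: One_nat_def)+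

lemma two_cycle_twist_mult_iff:
  fixes f g :: "'k::comm_ring_1 ab_series"
  assumes f: "f \<in> exp_t03 1" and g: "g \<in> exp_t03 1" and tc: "two_cycle g"
  shows "two_cycle (twist_mult 1 f g) \<longleftrightarrow> two_cycle f"
proof -
  \<comment> \<open>Exchanging \<open>A\<close> and \<open>B\<close> intertwines the twist up to
    conjugation by \<open>g\<close>. The two-cycle relation enters on the letter \<open>B\<close>,
    whose image is conjugated by g(B,A)^-1 = g(A,B) after the exchange.\<close>
  have eq: "swap_AB (twist 1 g e) = ad g (twist 1 g (swap_AB e))" if "e \<in> nc_over (ab_letters 1)" for e
  proof (rule one_ext[OF one.endo_comp[OF endo_swap_AB one.endo_twist[OF g]]
        one.endo_ad[OF one.endo_comp[OF one.endo_twist[OF g] endo_swap_AB] g] that])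
    show "swap_AB (twist 1 g sA) = ad g (twist 1 g (swap_AB sA))"
      using g by (simp add: one.twist_sA twist_one_sB del: One_nat_def)
    show "swap_AB (twist 1 g (sB 1 0)) = ad g (twist 1 g (swap_AB (sB 1 0)))"
      using g tc by (simp add: one.twist_sA twist_one_sB one.endo_apply_ad[OF endo_swap_AB] one.exp_rinv
          one.endo_rinv[OF endo_swap_AB] two_cycle_def del: One_nat_def)
  qed
  have u: "unit g" "unit (twist 1 g f)" using f g by (simp_all add: one.twist_exp del: One_nat_def)
  have "swap_AB (twist_mult 1 f g) = rinv g * (g * twist 1 g (swap_AB f) * rinv g)"
    using f g tc
    by (simp add: twist_mult_def one.endo_mult[OF endo_swap_AB] one.twist_over eq ad_def two_cycle_def del: One_nat_def)
  also have "\<dots> = twist 1 g (swap_AB f) * rinv g"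
    using u by (simp add: mult.assoc)
  finally have "two_cycle (twist_mult 1 f g) \<longleftrightarrow> twist 1 g (swap_AB f) * rinv g = twist 1 g (rinv f) * rinv g"
    using f g u by (simp add: two_cycle_def twist_mult_def rinv_mult one.twist_rinv del: One_nat_def)
  also have "\<dots> \<longleftrightarrow> twist 1 g (swap_AB f) = twist 1 g (rinv f)"
    using u by (simp add: unit_mult_right_cancel)
  also have "\<dots> \<longleftrightarrow> two_cycle f"
    using one.twist_inj[OF g, of "swap_AB f" "rinv f"] f
    by (auto simp: two_cycle_def swap_AB_exp one.exp_rinv simp del: One_nat_def)
  finally show ?thesis .
qed

lemma hexagon_twist_mult_iff:
  fixes f g :: "'k::field_char_0 ab_series"
  assumes f: "f \<in> exp_t03 1" and g: "g \<in> exp_t03 1" and hex: "hexagon g" and special: "special_action 1 g"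
  shows "hexagon (twist_mult 1 f g) \<longleftrightarrow> hexagon f"
proof -
  note oct = octagon_one[OF g]
  \<comment> \<open>On \<open>B\<close> the left side is Ad(g(A,C)^-1)(C). The hexagon makes the
    conjugating series the ratio of \<open>g\<close>, and by the special action condition the result
    is the twist of C.\<close>
  have eq: "B_to_C (twist 1 g e) = twist 1 g (B_to_C e)" if "e \<in> nc_over (ab_letters 1)" for e
  proof (rule one_ext[OF one.endo_comp[OF endo_B_to_C one.endo_twist[OF g]]
        one.endo_comp[OF one.endo_twist[OF g] endo_B_to_C] that])
    show "B_to_C (twist 1 g sA) = twist 1 g (B_to_C sA)"
      using g by (simp add: one.twist_sA del: One_nat_def)
    show "B_to_C (twist 1 g (sB 1 0)) = twist 1 g (B_to_C (sB 1 0))"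
      using g hex one.twist_sC[OF g oct special]
      by (simp add: twist_one_sB one.endo_apply_ad[OF endo_B_to_C] one.exp_rinv
          one.endo_rinv[OF endo_B_to_C] hexagon_def del: One_nat_def)
  qed
  have u: "unit (rinv (B_to_C g))" "unit (B_to_C g)" "unit (twist 1 g (B_to_C f))"
    using f g by (simp_all add: B_to_C_exp one.twist_exp del: One_nat_def)
  have "rinv (B_to_C (twist_mult 1 f g)) = twist 1 g (rinv (B_to_C f)) * rinv (B_to_C g)"
    using f g u by (simp add: twist_mult_def one.endo_mult[OF endo_B_to_C] one.twist_over eq rinv_mult
        one.twist_rinv B_to_C_exp del: One_nat_def)
  then have "hexagon (twist_mult 1 f g) \<longleftrightarrow>
      twist 1 g (one.flip_ratio f) * rinv (B_to_C g) = twist 1 g (rinv (B_to_C f)) * rinv (B_to_C g)"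
    using one.flip_ratio_twist_mult[OF g oct special f] hex by (simp add: hexagon_def del: One_nat_def)
  also have "\<dots> \<longleftrightarrow> twist 1 g (one.flip_ratio f) = twist 1 g (rinv (B_to_C f))"
    using u by (simp add: unit_mult_right_cancel)
  also have "\<dots> \<longleftrightarrow> hexagon f"
    using one.twist_inj[OF g, of "one.flip_ratio f" "rinv (B_to_C f)"] f
    by (auto simp: hexagon_def B_to_C_exp one.exp_rinv one.flip_ratio_exp simp del: One_nat_def)
  finally show ?thesis .
qed

lemma gsub_AB: "g \<in> nc_over (ab_letters 1) \<Longrightarrow> gsub g sA (sB 1 0) = g" for g :: "'k::comm_ring_1 ab_series"
  unfolding gsub_def
  by (rule one_ext[OF endo_hsub one.endo_id]) (simp_all add: hsub_sA hsub_sB[OF order_refl] del: One_nat_def)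

text \<open>The conditions defining \<open>GRT\<^sub>1\<close> other than the pentagon. The pentagon of \<open>GRT\<^sub>1\<close> is treated as a
  mixed pentagon for \<open>N = 1\<close>.\<close>
lemma GRT1_iff:
  fixes g :: "'k::field_char_0 ab_series"
  shows "g \<in> GRT1 \<longleftrightarrow> g \<in> exp_t03 1 \<and> two_cycle g \<and> hexagon g \<and> special_action 1 g \<and>
    U_eq 4 1
        (gsub g (t1 2) (tt 1 0 2 3 + tt 1 0 2 4) * gsub g (t1 3 + tt 1 0 2 3) (tt 1 0 3 4))
        (gsub g (tt 1 0 2 3) (tt 1 0 3 4) * gsub g (t1 2 + t1 3) (tt 1 0 2 4 + tt 1 0 3 4) * gsub g (t1 2) (tt 1 0 2 3))"
proof -
  let ?A = "sA :: 'k ab_series" and ?B = "sB 1 0 :: 'k ab_series" and ?C = "sC 1 :: 'k ab_series"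
  have "(gsub g ?A ?B * gsub g ?B ?A = 1 \<and> gsub g ?C ?A * gsub g ?B ?C * gsub g ?A ?B = 1 \<and>
      ?A + nc_inv (gsub g ?A ?B) * ?B * gsub g ?A ?B + nc_inv (gsub g ?A ?C) * ?C * gsub g ?A ?C = 0)
    \<longleftrightarrow> two_cycle g \<and> hexagon g \<and> special_action 1 g" if g: "g \<in> exp_t03 1"
  proof -
    have u: "unit g" "unit (B_to_C g)" "unit (flip 1 g)" "unit (one.flip_ratio g)"
      using g by (simp_all add: B_to_C_exp one.flip_exp one.flip_ratio_exp del: One_nat_def)
    have 1: "gsub g ?A ?B = g" "gsub g ?B ?A = swap_AB g" "gsub g ?A ?C = B_to_C g"
      using g by (simp_all add: gsub_AB del: One_nat_def) (simp_all add: gsub_def swap_AB_def B_to_C_def)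
    have 2: "gsub g ?C ?A = B_to_C (swap_AB g)"
      unfolding gsub_def
      by (rule one_ext[OF endo_hsub one.endo_comp[OF endo_B_to_C endo_swap_AB]])
         (simp_all add: g hsub_sA hsub_sB[OF order_refl] del: One_nat_def)
    have 3: "gsub g ?B ?C = flip 1 (swap_AB g)"
      unfolding gsub_def
      by (rule one_ext[OF endo_hsub one.endo_comp[OF one.endo_flip endo_swap_AB]])
         (simp_all add: g hsub_sA hsub_sB[OF order_refl] one.flip_sA one.flip_sB[of 0, simplified] del: One_nat_def)
    have tc: "g * swap_AB g = 1 \<longleftrightarrow> two_cycle g"
      using u by (simp add: mult_eq_iff_eq_rinv_mult two_cycle_def)
    have hex: "B_to_C (swap_AB g) * flip 1 (swap_AB g) * g = 1 \<longleftrightarrow> hexagon g" if "two_cycle g"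
    proof -
      have "B_to_C (swap_AB g) * flip 1 (swap_AB g) * g = rinv (B_to_C g) * rinv (one.flip_ratio g)"
        using that g u by (simp add: two_cycle_def one.endo_rinv[OF endo_B_to_C] one.flip_rinv one.flip_ratio_def
            rinv_mult mult.assoc del: One_nat_def)
      also have "\<dots> = 1 \<longleftrightarrow> hexagon g"
        using u by (auto simp: mult_rinv_eq_iff hexagon_def)
      finally show ?thesis .
    qed
    \<comment> \<open>The last summand here is conjugated by g(A,C)^-1, the one in
      \<open>special_action\<close> by the ratio of \<open>g\<close>; the hexagon says that these
      agree.\<close>
    have sp: "?A + rinv g * ?B * g + rinv (B_to_C g) * ?C * B_to_C g = 0 \<longleftrightarrow> special_action 1 g" if "hexagon g"
    proof -
      have k: "one.flip_ratio g = rinv (B_to_C g)" using that by (simp add: hexagon_def)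
      have "rinv g * ?B * g = twist 1 g ?B" "rinv (B_to_C g) * ?C * B_to_C g = ad (one.flip_ratio g) ?C"
        unfolding twist_one_sB[OF g] k by (simp_all add: ad_def u)
      moreover have "twist 1 g ?C = - ?A - twist 1 g ?B"
        using one.endo_sC[OF one.endo_twist[OF g]] one.twist_sA[OF g] by (simp add: int_upto_one del: One_nat_def)
      ultimately show ?thesis
        using one.special_action_iff[OF g] by (simp add: add3_eq_0_iff)
    qed
    show ?thesis unfolding 1 2 3 nc_inv_eq_rinv tc using hex sp by blast
  qed
  then show ?thesis unfolding GRT1_def Let_def by auto
qed

section \<open>Systems satisfying the relations of \<open>t\<^sub>4\<^sub>,\<^sub>N\<close>\<close>

definition commutes :: "'r::ring_1 \<Rightarrow> 'r \<Rightarrow> bool"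
  where "commutes u v \<longleftrightarrow> u * v = v * u"

lemma commutes_sym: "commutes u v \<longleftrightarrow> commutes v u"
  by (auto simp: commutes_def)

lemma commutes_refl [simp]: "commutes u u"
  by (simp add: commutes_def)

lemma commutes_add: "commutes z u \<Longrightarrow> commutes z v \<Longrightarrow> commutes z (u + v)"
  and commutes_diff: "commutes z u \<Longrightarrow> commutes z v \<Longrightarrow> commutes z (u - v)"
  and commutes_uminus: "commutes z u \<Longrightarrow> commutes z (- u)"
  by (simp_all add: commutes_def algebra_simps)

lemma commutes_mult: "commutes z u \<Longrightarrow> commutes z v \<Longrightarrow> commutes z (u * v)"
  unfolding commutes_def by (metis mult.assoc)

lemma commutes_sum: "(\<And>a. a \<in> A \<Longrightarrow> commutes z (f a)) \<Longrightarrow> commutes z (sum f A)"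
  by (simp add: commutes_def sum_distrib_left sum_distrib_right)

lemma commutes_rinv: "unit u \<Longrightarrow> commutes z u \<Longrightarrow> commutes z (rinv u)"
  unfolding commutes_def by (metis rinv_commute)

lemma commutes_ad: "unit u \<Longrightarrow> commutes z u \<Longrightarrow> commutes z v \<Longrightarrow> commutes z (ad u v)"
  unfolding ad_def by (intro commutes_mult commutes_rinv)

lemma ad_eq_self: "unit u \<Longrightarrow> commutes u v \<Longrightarrow> ad u v = v"
  by (simp add: commutes_def ad_commute)

lemma ad_rinv_eq_self: "unit u \<Longrightarrow> commutes u v \<Longrightarrow> ad (rinv u) v = v"
  by (metis ad_eq_self ad_rinv_ad)

lemma commutes_ad_iff: "unit u \<Longrightarrow> commutes (ad u v) (ad u v') \<longleftrightarrow> commutes v v'"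
  unfolding commutes_def by (simp flip: ad_mult_distrib add: ad_eq_iff)

text \<open>The coefficient of l \<otimes> l^n in the coproduct is a positive multiple of the
  coefficient of l^(n+1), and group-likeness makes it a multiple of the coefficient of l, which is
  0. Characteristic 0 allows the division.\<close>

lemma coeff_replicate_eq_0:
  fixes f :: "('x, 'k::field_char_0) ncs"
  assumes "grouplike f" "nc_coeff f [l] = 0"
  shows "nc_coeff f (replicate (Suc n) l) = 0"
proof -
  let ?w = "replicate (Suc n) l" and ?p = "([l], replicate n l)"
  have "([], replicate n l) \<in> set (unshuffles (replicate n l))" for n
    by (induction n) force+
  then have mem: "?p \<in> set (unshuffles ?w)" by force
  have "{w. ?p \<in> set (unshuffles w)} = {?w}"
  proof (intro equalityI subsetI)
    fix w assume "w \<in> {w. ?p \<in> set (unshuffles w)}"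
    then have "length w = Suc n" "set w \<subseteq> {l}"
      using unshuffles_length[of "[l]" "replicate n l" w] unshuffles_set[of "[l]" "replicate n l" w]
      by (auto split: if_splits)
    then show "w \<in> {?w}"
      using replicate_length_same[of w l] by (metis singletonI singletonD subsetD)
  qed (use mem in auto)
  then have "nc_coprod f [l] (replicate n l) = nc_coeff f ?w * of_nat (count_list (unshuffles ?w) ?p)"
    by (simp only: nc_coprod_def) simp
  moreover have "nc_coprod f [l] (replicate n l) = 0"
    using assms by (simp add: grouplike_def)
  moreover have "count_list (unshuffles ?w) ?p \<noteq> 0"
    using mem by (simp only: count_list_0_iff) simp
  ultimately show ?thesis by (metis mult_eq_0_iff of_nat_eq_0_iff)
qed

text \<open>The new assignment is the sum of \<open>\<phi>\<close> and the assignment sending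
  \<open>l\<close> to \<open>z\<close> and the other letters to 0. The two commute, and the second
  evaluates \<open>f\<close> to 1, since only powers of \<open>l\<close> survive and their
  coefficients vanish.\<close>

lemma ev_fun_upd_add:
  fixes fil :: "nat \<Rightarrow> 'r::ring_1 set" and sc :: "'k::field_char_0 \<Rightarrow> 'r"
  assumes "complete_filtered_algebra fil sc"
    and X: "finite X" "f \<in> nc_over X" and \<phi>: "\<And>x. x \<in> X \<Longrightarrow> \<phi> x \<in> fil (Suc 0)"
    and z: "z \<in> fil (Suc 0)" "\<And>x. x \<in> X \<Longrightarrow> commutes z (\<phi> x)"
    and f: "grouplike f" "nc_coeff f [l] = 0"
  shows "complete_filtered_algebra.ev fil sc (\<phi>(l := \<phi> l + z)) f = complete_filtered_algebra.ev fil sc \<phi> f"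
proof -
  interpret complete_filtered_algebra fil sc by fact
  define \<psi> where "\<psi> x = (if x = l then z else 0)" for x
  have \<psi>: "\<psi> x \<in> fil (Suc 0)" for x by (simp add: \<psi>_def z)
  have "ev \<psi> f = 1"
  proof (rule ev_eqI[OF X])
    fix m
    show "1 - ev_trunc X \<psi> f m \<in> fil m"
    proof (cases m)
      case (Suc n)
      have "sc (nc_coeff f w) * word_ev \<psi> w = 0" if w: "w \<noteq> []" for w
      proof (cases "set w \<subseteq> {l}")
        case True
        then have "w = replicate (length w) l" using replicate_length_same by (metis singletonD subsetD)
        then have "w = replicate (Suc (length w - 1)) l" using w by simp
        then show ?thesis using coeff_replicate_eq_0[OF f] by (metis mult_zero_left sc_0)
      next
        case False
        then obtain y where "y \<in> set w" "y \<noteq> l" by auto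
        then obtain u v where "w = u @ y # v" "y \<noteq> l" by (meson split_list)
        then show ?thesis by (simp add: word_ev_def \<psi>_def)
      qed
      then have "ev_trunc X \<psi> f m = (\<Sum>w\<in>words X m. if w = [] then 1 else 0)"
        unfolding ev_trunc_def using grouplike_Nil[OF f(1)]
        by (intro sum.cong) (auto simp: word_ev_def)
      also have "\<dots> = 1"
      proof -
        have "[] \<in> words X m" by (simp add: words_def Suc)
        then show ?thesis using X(1) by simp
      qed
      finally show ?thesis by simp
    qed simp
  qed
  moreover have "ev (\<lambda>x. \<phi> x + \<psi> x) f = ev \<phi> f * ev \<psi> f"
    by (rule ev_add_letters[OF X]) (use \<phi> \<psi> z f in \<open>auto simp: \<psi>_def commutes_def\<close>)
  moreover have "(\<lambda>x. \<phi> x + \<psi> x) = \<phi>(l := \<phi> l + z)"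
    by (auto simp: \<psi>_def)
  ultimately show ?thesis by simp
qed

section \<open>Evaluations at level N in an arbitrary algebra\<close>

locale algebra_level = complete_filtered_algebra fil sc + level N
  for fil :: "nat \<Rightarrow> 'r::ring_1 set" and sc :: "'k::field_char_0 \<Rightarrow> 'r" and N :: nat
begin

lemma hev_mult: 
  assumes "X \<in> fil (Suc 0)" "\<And>i. Y i \<in> fil (Suc 0)" "f \<in> series" "g \<in> series"
  shows "hev (f * g) X Y = hev f X Y * hev g X Y"
  by (rule chom_mult[OF continuous_hom_hev[OF assms(1,2)] assms(3,4)])

lemma unit_hev_exp:
  "X \<in> fil (Suc 0) \<Longrightarrow> (\<And>i. Y i \<in> fil (Suc 0)) \<Longrightarrow> h \<in> exp_t03 N \<Longrightarrow> unit (hev h X Y)"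
  by (rule unit_hev)

lemma commutes_hev:
  assumes "f \<in> series" "X \<in> fil (Suc 0)" "\<And>i. Y i \<in> fil (Suc 0)" "commutes z X" "\<And>i. commutes z (Y i)"
  shows "commutes z (hev f X Y)"
  using hev_commute[OF assms(2,3,1), of z] assms(4,5) by (auto simp: commutes_def)

text \<open>An endomorphism followed by an evaluation is the evaluation at the images of the
  letters; shifts, flips and twists are all evaluated through this.\<close>

lemma hev_endo:
  assumes E: "endo (ab_letters N) E" and X: "X \<in> fil (Suc 0)" "\<And>i. Y i \<in> fil (Suc 0)" and f: "f \<in> series"
    and X': "hev (E sA) X Y = X'" "\<And>i. hev (E (sB N i)) X Y = Y' i"
  shows "hev (E f) X Y = hev f X' Y'"
proof -
  note H = continuous_hom_hev[OF X, of N]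
  have d: "X' \<in> fil (Suc 0)" "Y' i \<in> fil (Suc 0)" for i
    unfolding X'[symmetric] using ncs.chom_deg[OF endo_hom[OF E]] endo_over[OF E]
    by (auto intro!: chom_deg[OF H])
  have "periodic N Y'"
    unfolding periodic_def X'(2)[symmetric] by (simp add: sB_mod)
  then show ?thesis
    using d X' by (intro chom_ext_ab[OF continuous_hom_comp[OF E H] continuous_hom_hev[OF d] f])
      (simp_all add: hev_sA hev_sB)
qed

lemma hev_tau:
  assumes "X \<in> fil (Suc 0)" "\<And>i. Y i \<in> fil (Suc 0)" "periodic N Y" "f \<in> series"
  shows "hev (tau N a f) X Y = hev f X (\<lambda>i. Y (i + a))"
  by (rule hev_endo[OF endo_tau assms(1,2,4)]) (simp_all add: assms hev_sA hev_sB)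

lemma hev_sC:
  assumes "X \<in> fil (Suc 0)" "\<And>i. Y i \<in> fil (Suc 0)" "periodic N Y"
  shows "hev (sC N) X Y = - X - (\<Sum>c\<in>{0..<int N}. Y c)"
proof -
  note H = continuous_hom_hev[OF assms(1,2), of N]
  show ?thesis
    by (simp add: sC_def chom_diff[OF H] chom_uminus[OF H] chom_sum[OF H] nc_over_uminus nc_over_sum
        assms hev_sA hev_sB)
qed

lemma hev_flip:
  assumes "X \<in> fil (Suc 0)" "\<And>i. Y i \<in> fil (Suc 0)" "periodic N Y" "f \<in> series"
  shows "hev (flip N f) X Y = hev f (- X - (\<Sum>c\<in>{0..<int N}. Y c)) (\<lambda>i. Y (- i))"
  by (rule hev_endo[OF endo_flip assms(1,2,4)]) (simp_all add: assms hev_sC hev_sB)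

lemma hev_rinv:
  assumes "X \<in> fil (Suc 0)" "\<And>i. Y i \<in> fil (Suc 0)" "f \<in> exp_t03 N"
  shows "hev (rinv f) X Y = rinv (hev f X Y)"
  using hev_nc_inv[OF assms] by (simp add: nc_inv_eq_rinv)

lemma hev_ad_apply:
  assumes "X \<in> fil (Suc 0)" "\<And>i. Y i \<in> fil (Suc 0)" "u \<in> exp_t03 N" "f \<in> series"
  shows "hev (ad u f) X Y = ad (hev u X Y) (hev f X Y)"
  using chom_ad[OF continuous_hom_hev[OF assms(1,2)], of u N f] assms by simp

lemma hev_twist:
  assumes X: "X \<in> fil (Suc 0)" "\<And>i. Y i \<in> fil (Suc 0)" "periodic N Y" and h: "h \<in> exp_t03 N" and f: "f \<in> series"
  shows "hev (twist N h f) X Y = hev f X (\<lambda>i. ad (rinv (hev h X (\<lambda>j. Y (j + i)))) (Y i))"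
  by (rule hev_endo[OF endo_twist[OF h] X(1,2) f])
     (simp_all add: assms hev_sA twist_sB hev_ad_apply tau_exp exp_rinv hev_sB hev_tau hev_rinv)

lemma hev_twist_mult:
  assumes "X \<in> fil (Suc 0)" "\<And>i. Y i \<in> fil (Suc 0)" "periodic N Y" "h \<in> exp_t03 N" "h' \<in> exp_t03 N"
  shows "hev (twist_mult N h' h) X Y = hev h X Y * hev h' X (\<lambda>i. ad (rinv (hev h X (\<lambda>j. Y (j + i)))) (Y i))"
  using assms by (simp add: twist_mult_def hev_mult twist_over hev_twist)

lemma hev_add_commuting:
  assumes X: "X \<in> fil (Suc 0)" "\<And>i. Y i \<in> fil (Suc 0)" and h: "h \<in> exp_t03 N" "nc_coeff h [LA] = 0"
    and z: "z \<in> fil (Suc 0)" "commutes z X" "\<And>i. commutes z (Y i)"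
  shows "hev h (X + z) Y = hev h X Y"
proof -
  have "ab_assign (X + z) Y = (ab_assign X Y)(LA := ab_assign X Y LA + z)"
    by (auto simp: ab_assign_def fun_eq_iff split: ab.splits)
  moreover have "ev ((ab_assign X Y)(LA := ab_assign X Y LA + z)) h = ev (ab_assign X Y) h"
  proof (rule ev_fun_upd_add[OF complete_filtered_algebra_axioms finite_ab_letters])
    show "commutes z (ab_assign X Y l)" for l using z by (cases l) auto
  qed (use h z in \<open>auto simp: exp_t03_iff ab_assign_fil X\<close>)
  ultimately show ?thesis by (simp add: hev_def)
qed

text \<open>The factor \<open>h\<^sup>-\<^sup>1 \<sqdot> h(C|B(-i))\<close> evaluated through any shift of the \<open>B(i)\<close>.\<close>
lemma hev_flip_ratio:
  assumes X: "X \<in> fil (Suc 0)" "\<And>i. Y i \<in> fil (Suc 0)" "periodic N Y"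
    and h: "h \<in> exp_t03 N" "nc_coeff h [LA] = 0" "octagon N h" "special_action N h"
    and W: "W \<in> fil (Suc 0)" "commutes (X + W + (\<Sum>c\<in>{0..<int N}. Y c)) X"
      "\<And>i. commutes (X + W + (\<Sum>c\<in>{0..<int N}. Y c)) (Y i)"
  shows "hev (flip_ratio h) X Y = rinv (hev h X (\<lambda>i. Y (i + a))) * hev h W (\<lambda>i. Y (a - i))"
proof -
  let ?S = "\<Sum>c\<in>{0..<int N}. Y c" and ?C = "- X - (\<Sum>c\<in>{0..<int N}. Y c)"
  have S: "?S \<in> fil (Suc 0)" using X by (intro fil_sum)
  have C: "?C \<in> fil (Suc 0)" using X S by (intro fil_diff fil_uminus)
  have Cz: "commutes (X + W + ?S) ?C"
    using W by (intro commutes_diff commutes_uminus commutes_sum)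
  \<comment> \<open>\<open>W\<close> is the value of C plus an element commuting with all arguments,
    so it may replace that value.\<close>
  have "hev h W (\<lambda>i. Y (a - i)) = hev h (?C + (X + W + ?S)) (\<lambda>i. Y (a - i))"
    by (simp add: algebra_simps)
  also have "\<dots> = hev h ?C (\<lambda>i. Y (a - i))"
    using W X S C Cz h by (intro hev_add_commuting) (auto intro: fil_add)
  also have "\<dots> = hev (tau N a (flip N h)) X Y"
  proof -
    have s: "(\<Sum>c\<in>{0..<int N}. Y (c + a)) = ?S" by (rule sum_periodic_shift[OF X(3) N])
    show ?thesis
      using X h by (simp add: hev_tau flip_over hev_flip periodic_shift s)
  qed
  finally have 1: "hev h W (\<lambda>i. Y (a - i)) = hev (tau N a (flip N h)) X Y" .
  have "hev (flip_ratio h) X Y = hev (tau N a (rinv h * flip N h)) X Y"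
    using tau_flip_ratio[OF h(1,3,4), of a] by (simp add: flip_ratio_def)
  also have "\<dots> = rinv (hev (tau N a h) X Y) * hev (tau N a (flip N h)) X Y"
    using X h by (simp add: tau_mult exp_rinv flip_over tau_rinv hev_mult tau_over tau_exp hev_rinv)
  also have "hev (tau N a h) X Y = hev h X (\<lambda>i. Y (i + a))"
    using X h by (simp add: hev_tau)
  finally show ?thesis by (simp add: 1)
qed

end

abbreviation isum :: "nat \<Rightarrow> (int \<Rightarrow> 'r::comm_monoid_add) \<Rightarrow> 'r"
  where "isum N Y \<equiv> \<Sum>c\<in>{0..<int N}. Y c"

text \<open>A system of elements satisfying the relations of \<open>t\<^sub>4\<^sub>,\<^sub>N\<close>: \<open>x, y, w\<close> stand for
  \<open>t\<^sup>1\<^sup>2, t\<^sup>1\<^sup>3, t\<^sup>1\<^sup>4\<close> and \<open>b, c, d\<close> for \<open>t(a)\<^sup>2\<^sup>3, t(a)\<^sup>2\<^sup>4, t(a)\<^sup>3\<^sup>4\<close>. The relations in which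
  \<open>t\<^sup>1\<^sup>4\<close> occurs amount to the centrality of the sum of all generators.\<close>
locale t4_system = algebra_level fil sc N
  for fil :: "nat \<Rightarrow> 'r::ring_1 set" and sc :: "'k::field_char_0 \<Rightarrow> 'r" and N :: nat +
  fixes x y w :: 'r and b c d :: "int \<Rightarrow> 'r"
  assumes fil1 [simp]: "x \<in> fil (Suc 0)" "y \<in> fil (Suc 0)" "w \<in> fil (Suc 0)"
      "b i \<in> fil (Suc 0)" "c i \<in> fil (Suc 0)" "d i \<in> fil (Suc 0)"
    and periodic [simp]: "periodic N b" "periodic N c" "periodic N d"
    and bcd: "q = p + r \<Longrightarrow> commutes (b p) (c q + d r)" "q = p + r \<Longrightarrow> commutes (c q) (b p + d r)"
      "q = p + r \<Longrightarrow> commutes (d r) (b p + c q)"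
    and xyb: "commutes (x + y + isum N b) (b i)"
    and x_yb: "commutes x (y + isum N b)"
    and x_d: "commutes x (d i)" and y_c: "commutes y (c i)"
    and central: "commutes (x + y + w + isum N b + isum N c + isum N d) x"
      "commutes (x + y + w + isum N b + isum N c + isum N d) y"
      "commutes (x + y + w + isum N b + isum N c + isum N d) (b i)"
      "commutes (x + y + w + isum N b + isum N c + isum N d) (c i)"
      "commutes (x + y + w + isum N b + isum N c + isum N d) (d i)"
begin

abbreviation "total3 \<equiv> x + y + isum N b"
abbreviation "total4 \<equiv> x + y + w + isum N b + isum N c + isum N d"

lemma fil1_isum [simp]: "isum N b \<in> fil (Suc 0)" "isum N c \<in> fil (Suc 0)" "isum N d \<in> fil (Suc 0)"
  by (simp_all add: fil_sum)

lemmas isum_shift = periodic[THEN sum_periodic_shift, OF N]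
  and isum_neg = periodic[THEN sum_periodic_neg, OF N]

lemma total3: "commutes total3 x" "commutes total3 y" "commutes total3 (b i)"
proof -
  show 1: "commutes total3 x"
    using x_yb by (simp add: commutes_def algebra_simps)
  show 2: "commutes total3 (b i)" for i by (rule xyb)
  have "commutes total3 (total3 - x - isum N b)"
    by (intro commutes_diff commutes_refl 1 2 commutes_sum)
  then show "commutes total3 y" by simp
qed

lemma y_xb: "commutes y (x + isum N b)"
  using total3(2) by (simp add: commutes_def algebra_simps)

text \<open>With the residue of one generator fixed, the residue of a second determines that of the
  third; summing over it removes the labels, and periodicity absorbs the shifts.\<close>

lemma isum_relations: "commutes (b i) (isum N c + isum N d)" "commutes (c i) (isum N b + isum N d)"
    "commutes (d i) (isum N b + isum N c)"
proof -
  have "commutes (b i) (\<Sum>r\<in>{0..<int N}. c (r + i) + d r)"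
    by (intro commutes_sum bcd) simp
  then show "commutes (b i) (isum N c + isum N d)"
    by (simp add: sum.distrib isum_shift)
  have "commutes (c i) (\<Sum>r\<in>{0..<int N}. b (- r + i) + d r)"
    by (intro commutes_sum bcd) simp
  moreover have "(\<Sum>r\<in>{0..<int N}. b (- r + i)) = isum N b"
    using sum_periodic_neg[of N "\<lambda>r. b (r + i)"] N by (simp add: periodic_shift isum_shift)
  ultimately show "commutes (c i) (isum N b + isum N d)"
    by (simp add: sum.distrib)
  have "commutes (d i) (\<Sum>r\<in>{0..<int N}. b r + c (r + i))"
    by (intro commutes_sum bcd) simp
  then show "commutes (d i) (isum N b + isum N c)"
    by (simp add: sum.distrib isum_shift)
qed

text \<open>Here and below, relations containing \<open>w\<close> are recovered by writing the
  relevant sum as \<open>total4\<close> minus blocks that are already known to commute with the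
  given generator.\<close>

lemma w_b: "commutes w (b i)"
proof -
  have "commutes (b i) (total4 - total3 - (isum N c + isum N d))"
    using central total3 isum_relations(1) by (intro commutes_diff) (simp_all add: commutes_sym)
  then show ?thesis by (simp add: commutes_sym algebra_simps)
qed

lemma x_wc: "commutes x (w + isum N c)"
proof -
  have "commutes x (total4 - total3 - isum N d)"
    using central total3 x_d by (intro commutes_diff commutes_sum) (simp_all add: commutes_sym)
  then show ?thesis by (simp add: algebra_simps)
qed

lemma xwc: "commutes (x + w + isum N c) (c i)"
proof -
  have "commutes (c i) (total4 - y - (isum N b + isum N d))"
    using central y_c isum_relations(2) by (intro commutes_diff) (simp_all add: commutes_sym)
  then show ?thesis by (simp add: commutes_sym algebra_simps)
qed

lemma y_wd: "commutes y (w + isum N d)"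
proof -
  have "commutes y (total4 - total3 - isum N c)"
    using central total3 y_c by (intro commutes_diff commutes_sum) (simp_all add: commutes_sym)
  then show ?thesis by (simp add: algebra_simps)
qed

lemma ywd: "commutes (y + w + isum N d) (d i)"
proof -
  have "commutes (d i) (total4 - x - (isum N b + isum N c))"
    using central x_d isum_relations(3) by (intro commutes_diff) (simp_all add: commutes_sym)
  then show ?thesis by (simp add: commutes_sym algebra_simps)
qed

lemma central_w: "commutes total4 w"
proof -
  have "commutes total4 (total4 - x - y - isum N b - isum N c - isum N d)"
    using central by (intro commutes_diff commutes_sum) simp_all
  then show ?thesis by simp
qed

text \<open>Exchange of the indices 3 and 4, the sign coming from t(a)^{43} = t(-a)^{34}. It turns
  t^{13} into t^{14}, which is why a system records t^{14} although the mixed pentagon does not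
  contain it.\<close>

lemma swap34: "t4_system fil sc N x w y c b (\<lambda>i. d (- i))"
proof unfold_locales
  have s: "(\<Sum>i\<in>{0..<int N}. d (- i)) = isum N d" by (simp add: isum_neg)
  have t: "x + w + y + isum N c + isum N b + (\<Sum>i\<in>{0..<int N}. d (- i)) = total4"
    unfolding s by (simp add: algebra_simps)
  show "commutes (x + w + y + isum N c + isum N b + (\<Sum>i\<in>{0..<int N}. d (- i))) (d (- i))"
    "commutes (x + w + y + isum N c + isum N b + (\<Sum>i\<in>{0..<int N}. d (- i))) x"
    "commutes (x + w + y + isum N c + isum N b + (\<Sum>i\<in>{0..<int N}. d (- i))) w"
    "commutes (x + w + y + isum N c + isum N b + (\<Sum>i\<in>{0..<int N}. d (- i))) (b i)"
    "commutes (x + w + y + isum N c + isum N b + (\<Sum>i\<in>{0..<int N}. d (- i))) (c i)" for i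
    unfolding t by (simp_all add: central central_w)
  fix p q r :: int assume "q = p + r"
  then show "commutes (c p) (b q + d (- r))" "commutes (b q) (c p + d (- r))" "commutes (d (- r)) (c p + b q)"
    using bcd[of p q "- r"] by (simp_all add: add.commute)
qed (simp_all add: xwc x_wc x_d w_b periodic_neg)

lemma swap23: "t4_system fil sc N y x w (\<lambda>i. b (- i)) d c"
proof unfold_locales
  have s: "(\<Sum>i\<in>{0..<int N}. b (- i)) = isum N b" by (simp add: isum_neg)
  have t: "y + x + w + (\<Sum>i\<in>{0..<int N}. b (- i)) + isum N d + isum N c = total4"
    unfolding s by (simp add: algebra_simps)
  show "commutes (y + x + w + (\<Sum>i\<in>{0..<int N}. b (- i)) + isum N d + isum N c) (b (- i))"
    "commutes (y + x + w + (\<Sum>i\<in>{0..<int N}. b (- i)) + isum N d + isum N c) x"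
    "commutes (y + x + w + (\<Sum>i\<in>{0..<int N}. b (- i)) + isum N d + isum N c) y"
    "commutes (y + x + w + (\<Sum>i\<in>{0..<int N}. b (- i)) + isum N d + isum N c) (c i)"
    "commutes (y + x + w + (\<Sum>i\<in>{0..<int N}. b (- i)) + isum N d + isum N c) (d i)" for i
    unfolding t by (simp_all add: central)
  show "commutes (y + x + (\<Sum>i\<in>{0..<int N}. b (- i))) (b (- i))" for i
    unfolding s using xyb[of "- i"] by (simp add: add.commute)
  show "commutes y (x + (\<Sum>i\<in>{0..<int N}. b (- i)))"
    unfolding s by (rule y_xb)
  fix p q r :: int assume "q = p + r"
  then show "commutes (b (- p)) (d q + c r)" "commutes (d q) (b (- p) + c r)" "commutes (c r) (b (- p) + d q)"
    using bcd[of r "- p" q] by (simp_all add: add.commute)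
qed (simp_all add: x_d y_c periodic_neg)

text \<open>The relations tie the residues together only through q = p + r, and shifts compatible
  with this preserve them. Each pentagon thus becomes available at all residues.\<close>

lemma shift:
  assumes "q = p + r"
  shows "t4_system fil sc N x y w (\<lambda>i. b (i + p)) (\<lambda>i. c (i + q)) (\<lambda>i. d (i + r))"
  unfolding assms
  by unfold_locales (simp_all add: isum_shift central xyb x_yb x_d y_c periodic_shift bcd)

end

section \<open>Evaluation of the pentagons\<close>

lemma finite_tgens [simp]: "finite (tgens n N)"
proof -
  have "tgens n N \<subseteq> T1 ` {2..n} \<union> (\<lambda>(a, i, j). T a i j) ` ({0..<int N} \<times> {2..n} \<times> {2..n})"
  proof
    fix t assume t: "t \<in> tgens n N"
    show "t \<in> T1 ` {2..n} \<union> (\<lambda>(a, i, j). T a i j) ` ({0..<int N} \<times> {2..n} \<times> {2..n})"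
    proof (cases t)
      case (T a i j)
      then have "(a, i, j) \<in> {0..<int N} \<times> {2..n} \<times> {2..n}" using t by (auto simp: tgens_def)
      then show ?thesis using T by (auto intro: image_eqI[where x = "(a, i, j)"])
    qed (use t in \<open>auto simp: tgens_def\<close>)
  qed
  then show ?thesis by (rule finite_subset) simp
qed

lemma t1_over: "i \<in> {2..n} \<Longrightarrow> t1 i \<in> nc_over (tgens n N)"
  by (simp add: t1_def nc_over_var tgens_def)

lemma tt_over: "N \<ge> 1 \<Longrightarrow> i \<in> {2..n} \<Longrightarrow> j \<in> {2..n} \<Longrightarrow> i \<noteq> j \<Longrightarrow> tt N a i j \<in> nc_over (tgens n N)"
  by (simp add: tt_def nc_over_var tgens_def)

lemma ttsum_over: "N \<ge> 1 \<Longrightarrow> i \<in> {2..n} \<Longrightarrow> j \<in> {2..n} \<Longrightarrow> i \<noteq> j \<Longrightarrow> ttsum N i j \<in> nc_over (tgens n N)"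
  unfolding ttsum_def by (intro nc_over_sum tt_over)

lemma t_deg [simp]: "t1 i \<in> nc_deg (Suc 0)" "tt N a i j \<in> nc_deg (Suc 0)" "ttsum N i j \<in> nc_deg (Suc 0)"
  by (simp_all add: t1_def tt_def ttsum_def nc_deg_Suc_0_iff nc_coeff_sum nc_coeff_var)

lemma nc_deg_add [simp]: "f \<in> nc_deg n \<Longrightarrow> g \<in> nc_deg n \<Longrightarrow> f + g \<in> nc_deg n"
  by (simp add: nc_deg_def)

lemma tt_mod: "tt N (a mod int N) i j = tt N a i j"
  by (simp add: tt_def)

lemma nc_lie_over: "f \<in> nc_over X \<Longrightarrow> g \<in> nc_over X \<Longrightarrow> nc_lie f g \<in> nc_over X"
  by (simp add: nc_lie_def nc_over_diff nc_over_mult)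

lemma trels_over: "N \<ge> 1 \<Longrightarrow> r \<in> trels n N \<Longrightarrow> r \<in> nc_over (tgens n N)"
  unfolding trels_def
  by (auto intro!: nc_over_diff nc_lie_over nc_over_add tt_over t1_over ttsum_over)

lemma nc_ideal_over: "f \<in> nc_ideal X R \<Longrightarrow> R \<subseteq> nc_over X \<Longrightarrow> f \<in> nc_over X"
  by (induction rule: nc_ideal.induct) (auto intro: nc_over_add nc_over_mult)

lemma hsub_over:
  assumes "f \<in> nc_over (ab_letters N)" "X \<in> nc_over Z" "\<And>i. Y i \<in> nc_over Z"
  shows "hsub f X Y \<in> nc_over Z"
  unfolding hsub_eq_nc_subst
  by (rule nc_subst_over[OF assms(1)]) (use assms in \<open>auto simp: ab_assign_def split: ab.splits\<close>)

definition pentagon_left :: "nat \<Rightarrow> 'k::comm_ring_1 ab_series \<Rightarrow> (tgen, 'k) ncs"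
  where "pentagon_left N h = hsub h (t1 2) (\<lambda>a. tt N a 2 3 + tt N a 2 4) *
       hsub h (t1 3 + ttsum N 2 3) (\<lambda>a. tt N a 3 4)"

definition pentagon_right :: "nat \<Rightarrow> 'k::comm_ring_1 ab_series \<Rightarrow> 'k ab_series \<Rightarrow> (tgen, 'k) ncs"
  where "pentagon_right N g h = gsub g (tt N 0 2 3) (tt N 0 3 4) *
       hsub h (t1 2 + t1 3 + ttsum N 2 3) (\<lambda>a. tt N a 2 4 + tt N a 3 4) *
       hsub h (t1 2) (\<lambda>a. tt N a 2 3)"

lemma mixed_pentagon_iff: "mixed_pentagon N g h \<longleftrightarrow> U_eq 4 N (pentagon_left N h) (pentagon_right N g h)"
  by (simp add: mixed_pentagon_def pentagon_left_def pentagon_right_def)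

context level
begin

lemmas t_over = t1_over tt_over[OF N] ttsum_over[OF N]

lemma pentagon_over:
  assumes "h \<in> exp_t03 N" "g \<in> exp_t03 1"
  shows "pentagon_left N h \<in> nc_over (tgens 4 N)" "pentagon_right N g h \<in> nc_over (tgens 4 N)"
  unfolding pentagon_left_def pentagon_right_def gsub_def
  using assms by (auto intro!: nc_over_mult hsub_over[of _ N] hsub_over[of g 1] nc_over_add t_over simp: exp_t03_iff)

end

context algebra_level
begin

definition left_at :: "'k ab_series \<Rightarrow> 'r \<Rightarrow> 'r \<Rightarrow> (int \<Rightarrow> 'r) \<Rightarrow> (int \<Rightarrow> 'r) \<Rightarrow> (int \<Rightarrow> 'r) \<Rightarrow> 'r"
  where "left_at h x y b c d = hev h x (\<lambda>i. b i + c i) * hev h (y + isum N b) d"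

definition right_at :: "'k ab_series \<Rightarrow> 'k ab_series \<Rightarrow> 'r \<Rightarrow> 'r \<Rightarrow> (int \<Rightarrow> 'r) \<Rightarrow> (int \<Rightarrow> 'r) \<Rightarrow> (int \<Rightarrow> 'r) \<Rightarrow> 'r"
  where "right_at g h x y b c d =
    hev g (b 0) (\<lambda>_. d 0) * hev h (x + y + isum N b) (\<lambda>i. c i + d i) * hev h x b"

lemma chom_pentagon:
  assumes H: "continuous_hom (tgens 4 N) H" and h: "h \<in> exp_t03 N" and g: "g \<in> exp_t03 1"
  shows "H (pentagon_left N h)
      = left_at h (H (t1 2)) (H (t1 3)) (\<lambda>a. H (tt N a 2 3)) (\<lambda>a. H (tt N a 2 4)) (\<lambda>a. H (tt N a 3 4))"
    and "H (pentagon_right N g h)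
      = right_at g h (H (t1 2)) (H (t1 3)) (\<lambda>a. H (tt N a 2 3)) (\<lambda>a. H (tt N a 2 4)) (\<lambda>a. H (tt N a 3 4))"
proof -
  have s: "H (ttsum N 2 3) = isum N (\<lambda>a. H (tt N a 2 3))"
    unfolding ttsum_def by (rule chom_sum[OF H]) (simp add: t_over)
  have g1: "g \<in> nc_over (ab_letters 1)" using g by (simp add: exp_t03_iff)
  note o = hsub_over[OF exp_over[OF h]] hsub_over[OF g1] nc_over_add nc_over_mult t_over
  note e = chom_hsub[OF exp_over[OF h] H] chom_hsub[OF g1 H] chom_mult[OF H] chom_add[OF H] s
  show "H (pentagon_left N h)
      = left_at h (H (t1 2)) (H (t1 3)) (\<lambda>a. H (tt N a 2 3)) (\<lambda>a. H (tt N a 2 4)) (\<lambda>a. H (tt N a 3 4))"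
    unfolding pentagon_left_def left_at_def by (simp add: e o)
  show "H (pentagon_right N g h)
      = right_at g h (H (t1 2)) (H (t1 3)) (\<lambda>a. H (tt N a 2 3)) (\<lambda>a. H (tt N a 2 4)) (\<lambda>a. H (tt N a 3 4))"
    unfolding pentagon_right_def right_at_def gsub_def by (simp add: e o)
qed

end

context t4_system
begin

text \<open>Reversed pairs carry the negated residue, as the first family of relations demands. The
  fallback values lie in \<open>fil 1\<close> too, so that \<open>gen_value_fil\<close> holds for
  every letter.\<close>

definition gen_value :: "tgen \<Rightarrow> 'r"
  where "gen_value t = (case t of
      T1 i \<Rightarrow> if i = 2 then x else if i = 3 then y else w
    | T a i j \<Rightarrow>
        if i = 2 \<and> j = 3 then b a else if i = 3 \<and> j = 2 then b (- a) else
        if i = 2 \<and> j = 4 then c a else if i = 4 \<and> j = 2 then c (- a) else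
        if i = 3 \<and> j = 4 then d a else if i = 4 \<and> j = 3 then d (- a) else 0)"

lemma gen_value_fil: "gen_value t \<in> fil (Suc 0)"
  by (auto simp: gen_value_def split: tgen.splits)

lemma continuous_hom_gen_value: "continuous_hom (tgens 4 N) (ev gen_value)"
  by (rule continuous_hom_ev) (simp_all add: gen_value_fil)

lemma ev_t1: "ev gen_value (t1 i) = gen_value (T1 i)"
  by (simp add: t1_def ev_var gen_value_fil)

lemma ev_tt: "ev gen_value (tt N a i j) = gen_value (T a i j)"
proof -
  have "ev gen_value (tt N a i j) = gen_value (T (a mod int N) i j)"
    by (simp add: tt_def ev_var gen_value_fil)
  also have "\<dots> = gen_value (T a i j)"
    using periodic_neg[OF periodic(1)] periodic_neg[OF periodic(2)] periodic_neg[OF periodic(3)] periodic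
    by (simp add: gen_value_def periodic_def)
  finally show ?thesis .
qed

lemma ev_ttsum:
  assumes "i \<in> {2..4}" "j \<in> {2..4}" "i \<noteq> j"
  shows "ev gen_value (ttsum N i j) = isum N (\<lambda>a. gen_value (T a i j))"
  unfolding ttsum_def using assms
  by (simp add: chom_sum[OF continuous_hom_gen_value] t_over ev_tt)

lemma gen_value_simps:
  "gen_value (T1 2) = x" "gen_value (T1 3) = y" "gen_value (T1 4) = w"
  "gen_value (T a 2 3) = b a" "gen_value (T a 3 2) = b (- a)" "gen_value (T a 2 4) = c a"
  "gen_value (T a 4 2) = c (- a)" "gen_value (T a 3 4) = d a" "gen_value (T a 4 3) = d (- a)"
  by (simp_all add: gen_value_def)

lemma gen_value_relations:
  assumes "i \<in> {2..4}" "j \<in> {2..4}" "i \<noteq> j"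
  shows "gen_value (T a i j) = gen_value (T (- a) j i)"
    and "commutes (gen_value (T1 i) + gen_value (T1 j) + isum N (\<lambda>a. gen_value (T a i j))) (gen_value (T a i j))"
    and "commutes (gen_value (T1 i)) (gen_value (T1 j) + isum N (\<lambda>a. gen_value (T a i j)))"
    and "k \<in> {2..4} \<Longrightarrow> k \<noteq> i \<Longrightarrow> k \<noteq> j \<Longrightarrow>
      commutes (gen_value (T a i j)) (gen_value (T (a + e) i k) + gen_value (T e j k))"
    and "k \<in> {2..4} \<Longrightarrow> k \<noteq> i \<Longrightarrow> k \<noteq> j \<Longrightarrow> commutes (gen_value (T1 i)) (gen_value (T a j k))"
proof -
  \<comment> \<open>The systems with exchanged indices supply the relations for ordered pairs that
    the axioms of a system do not list.\<close>
  interpret s34: t4_system fil sc N x w y c b "\<lambda>i. d (- i)" by (rule swap34)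
  interpret s23: t4_system fil sc N y x w "\<lambda>i. b (- i)" d c by (rule swap23)
  interpret s: t4_system fil sc N y w x d "\<lambda>i. b (- i)" "\<lambda>i. c (- i)" by (rule s23.swap34)
  have three: "m = 2 \<or> m = 3 \<or> m = 4" if "m \<in> {2..4}" for m :: nat
    using that unfolding atLeastAtMost_iff by presburger
  consider "i = 2" "j = 3" | "i = 3" "j = 2" | "i = 2" "j = 4" | "i = 4" "j = 2" | "i = 3" "j = 4" | "i = 4" "j = 3"
    using three[OF assms(1)] three[OF assms(2)] assms(3) by metis
  note ij = this
  from ij show "gen_value (T a i j) = gen_value (T (- a) j i)"
    by cases (simp_all add: gen_value_simps)
  have w: "commutes w (x + isum N c)" "commutes w (y + isum N d)"
    by (rule s34.y_xb, rule s.y_xb)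
  have v: "commutes (y + x + isum N b) (b i)" "commutes (w + x + isum N c) (c i)" "commutes (w + y + isum N d) (d i)" for i
    using xyb xwc ywd by (simp_all add: add.commute)
  from ij show "commutes (gen_value (T1 i) + gen_value (T1 j) + isum N (\<lambda>a. gen_value (T a i j))) (gen_value (T a i j))"
    by cases (simp_all only: gen_value_simps isum_neg xyb xwc ywd v)
  from ij show "commutes (gen_value (T1 i)) (gen_value (T1 j) + isum N (\<lambda>a. gen_value (T a i j)))"
    by cases (simp_all only: gen_value_simps isum_neg x_yb y_xb x_wc y_wd w)
  show "commutes (gen_value (T a i j)) (gen_value (T (a + e) i k) + gen_value (T e j k))"
    if "k \<in> {2..4}" "k \<noteq> i" "k \<noteq> j"
  proof -
    have 1: "commutes (b a) (c (a + e) + d e)" "commutes (c a) (b (a + e) + d (- e))"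
      "commutes (b (- a)) (c e + d (a + e))" "commutes (d a) (b (- (a + e)) + c (- e))"
      "commutes (c (- a)) (b e + d (- (a + e)))" "commutes (d (- a)) (b (- e) + c (- (a + e)))"
      by (rule bcd; simp)+
    have 2: "commutes (b (- a)) (d (a + e) + c e)" "commutes (c (- a)) (d (- (a + e)) + b e)"
      "commutes (d (- a)) (c (- (a + e)) + b (- e))"
      using 1(3,5,6) by (simp_all only: add.commute)
    show ?thesis
      using three[OF that(1)] that(2,3) by (rule_tac ij; elim disjE; simp only: gen_value_simps 1 2; simp)
  qed
  show "commutes (gen_value (T1 i)) (gen_value (T a j k))" if "k \<in> {2..4}" "k \<noteq> i" "k \<noteq> j"
    using three[OF that(1)] that(2,3)
    by (rule_tac ij; elim disjE; simp only: gen_value_simps x_d y_c w_b; simp)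
qed

lemma ev_nc_lie:
  assumes "f \<in> nc_over (tgens 4 N)" "f' \<in> nc_over (tgens 4 N)" "commutes (ev gen_value f) (ev gen_value f')"
  shows "ev gen_value (nc_lie f f') = 0"
  using assms
  by (simp add: nc_lie_def chom_diff[OF continuous_hom_gen_value] chom_mult[OF continuous_hom_gen_value]
      nc_over_mult commutes_def)

lemma ev_trels:
  assumes "r \<in> trels 4 N" shows "ev gen_value r = 0"
  using assms unfolding trels_def
proof (elim UnE CollectE exE conjE)
  note H = continuous_hom_gen_value
  fix a i j assume r: "r = tt N a i j - tt N (- a) j i" and ij: "distinct [i, j]" "{i, j} \<subseteq> {2..4}"
  then show ?thesis
    using gen_value_relations(1)[of i j a] by (simp add: chom_diff[OF H] t_over ev_tt)
next
  note H = continuous_hom_gen_value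
  fix a e i j k
  assume "r = nc_lie (tt N a i j) (tt N (a + e) i k + tt N e j k)" "distinct [i, j, k]" "{i, j, k} \<subseteq> {2..4}"
  then show ?thesis
    using gen_value_relations(4)[of i j k a e]
    by (auto simp: chom_add[OF H] t_over ev_tt nc_over_add intro!: ev_nc_lie)
next
  note H = continuous_hom_gen_value
  fix a i j
  assume "r = nc_lie (t1 i + t1 j + ttsum N i j) (tt N a i j)" "distinct [i, j]" "{i, j} \<subseteq> {2..4}"
  then show ?thesis
    using gen_value_relations(2)[of i j a]
    by (auto simp: chom_add[OF H] t_over ev_tt ev_t1 ev_ttsum nc_over_add intro!: ev_nc_lie)
next
  note H = continuous_hom_gen_value
  fix i j
  assume "r = nc_lie (t1 i) (t1 j + ttsum N i j)" "distinct [i, j]" "{i, j} \<subseteq> {2..4}"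
  then show ?thesis
    using gen_value_relations(3)[of i j]
    by (auto simp: chom_add[OF H] t_over ev_tt ev_t1 ev_ttsum nc_over_add intro!: ev_nc_lie)
next
  fix a i j k
  assume "r = nc_lie (t1 i) (tt N a j k)" "distinct [i, j, k]" "{i, j, k} \<subseteq> {2..4}"
  then show ?thesis
    using gen_value_relations(5)[of i j k a] by (auto simp: t_over ev_tt ev_t1 intro!: ev_nc_lie)
next
  fix a e i j k l :: nat
  assume "distinct [i, j, k, l]" "{i, j, k, l} \<subseteq> {2..4}"
  \<comment> \<open>Four distinct indices do not fit into {2, 3, 4}, so the last family of relations
    is empty for n = 4.\<close>
  then have "card {i, j, k, l} = 4" "card {i, j, k, l} \<le> card {2..4::nat}"
    by (auto intro!: card_mono)
  then show ?thesis by simp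
qed

text \<open>Relations evaluate to 0, hence so does the ideal, and the closure follows because
  evaluation is continuous and the target Hausdorff.\<close>

lemma ev_U_eq:
  assumes "U_eq 4 N f f'" "f \<in> nc_over (tgens 4 N)" "f' \<in> nc_over (tgens 4 N)"
  shows "ev gen_value f = ev gen_value f'"
proof -
  note H = continuous_hom_gen_value
  have R: "trels 4 N \<subseteq> nc_over (tgens 4 N)" using trels_over[OF N] by blast
  have ideal: "ev gen_value e = 0" if "e \<in> nc_ideal (tgens 4 N) (trels 4 N)" for e
    using that
  proof (induction rule: nc_ideal.induct)
    case (gen r p q)
    then show ?case using R by (auto simp: chom_mult[OF H] nc_over_mult ev_trels)
  next
    case (add e e')
    then show ?case by (simp add: chom_add[OF H nc_ideal_over[OF add.hyps(1) R] nc_ideal_over[OF add.hyps(2) R]])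
  qed simp
  have "ev gen_value (f - f') = 0"
  proof (rule fil_hausdorff)
    fix n
    from assms(1) obtain e where e: "e \<in> nc_ideal (tgens 4 N) (trels 4 N)"
      "\<forall>v. length v \<le> n \<longrightarrow> nc_coeff (f - f') v = nc_coeff e v"
      unfolding U_eq_def nc_closure_def by blast
    have "f - f' - e \<in> nc_deg n" using e(2) by (simp add: nc_deg_def)
    moreover have "e \<in> nc_over (tgens 4 N)" by (rule nc_ideal_over[OF e(1) R])
    moreover have o: "f - f' \<in> nc_over (tgens 4 N)" using assms by (simp add: nc_over_diff)
    ultimately have "ev gen_value (f - f' - e) \<in> fil n" by (intro chom_deg[OF H] nc_over_diff[of "f - f'"])
    then show "ev gen_value (f - f') \<in> fil n"
      by (simp add: chom_diff[OF H o nc_ideal_over[OF e(1) R]] ideal[OF e(1)])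
  qed
  then show ?thesis using assms by (simp add: chom_diff[OF H])
qed

lemma ev_pentagon:
  assumes "h \<in> exp_t03 N" "g \<in> exp_t03 1"
  shows "ev gen_value (pentagon_left N h) = left_at h x y b c d"
    and "ev gen_value (pentagon_right N g h) = right_at g h x y b c d"
  unfolding chom_pentagon[OF continuous_hom_gen_value assms] ev_t1 ev_tt by (simp_all add: gen_value_def)

lemma pentagon_at:
  assumes "h \<in> exp_t03 N" "g \<in> exp_t03 1" "mixed_pentagon N g h"
  shows "left_at h x y b c d = right_at g h x y b c d"
  using ev_U_eq[of "pentagon_left N h" "pentagon_right N g h"] assms
  by (simp add: ev_pentagon pentagon_over mixed_pentagon_iff)

end

section \<open>The action on systems\<close>

declare One_nat_def [simp del]

lemma commutes_symI: "commutes u v \<Longrightarrow> commutes v u"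
  by (simp add: commutes_sym)

lemma mult_unit_mult: "unit u \<Longrightarrow> z * (u * v) = u * (ad (rinv u) z * v)"
  by (simp add: ad_def mult.assoc)

lemma commutes_complement: "commutes t u \<Longrightarrow> commutes u (t - u)"
  by (simp add: commutes_sym commutes_diff)

definition GRT_conditions :: "'k::field_char_0 ab_series \<Rightarrow> bool"
  where "GRT_conditions g \<longleftrightarrow> g \<in> exp_t03 1 \<and> two_cycle g \<and> hexagon g \<and> special_action 1 g \<and>
    nc_coeff g [LA] = 0 \<and> nc_coeff g [LB 0] = 0"

lemma swap_AB_sB: "swap_AB (sB 1 i) = (sA :: 'k::comm_ring_1 ab_series)"
  and B_to_C_sB: "B_to_C (sB 1 i) = (sC 1 :: 'k ab_series)"
  by (subst sB_one, rule swap_AB_letters(2), subst sB_one, rule B_to_C_letters(2))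

text \<open>Three elements satisfying the relations of \<open>t\<^sub>3\<close>: their sum commutes with each of them.\<close>
locale t3_triple = complete_filtered_algebra fil sc
  for fil :: "nat \<Rightarrow> 'r::ring_1 set" and sc :: "'k::field_char_0 \<Rightarrow> 'r" +
  fixes b c d :: 'r and g :: "'k ab_series"
  assumes fil1 [simp]: "b \<in> fil (Suc 0)" "c \<in> fil (Suc 0)" "d \<in> fil (Suc 0)"
    and sum_commutes: "commutes (b + c + d) b" "commutes (b + c + d) c" "commutes (b + c + d) d"
    and g: "GRT_conditions g"
begin

sublocale base: algebra_level fil sc 1
  by unfold_locales simp

abbreviation gev :: "'r \<Rightarrow> 'r \<Rightarrow> 'r"
  where "gev X Y \<equiv> hev g X (\<lambda>_. Y)"

lemma g_exp: "g \<in> exp_t03 1"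
  using g by (simp add: GRT_conditions_def)

lemma unit_gev [simp]: "X \<in> fil (Suc 0) \<Longrightarrow> Y \<in> fil (Suc 0) \<Longrightarrow> unit (gev X Y)"
  by (rule unit_hev[OF _ _ g_exp])

lemma gev_swap:
  assumes "X \<in> fil (Suc 0)" "Y \<in> fil (Suc 0)"
  shows "gev Y X = rinv (gev X Y)"
proof -
  have "hev (swap_AB g) X (\<lambda>_. Y) = hev g Y (\<lambda>_. X)"
    by (rule base.hev_endo[OF endo_swap_AB assms one.exp_over[OF g_exp]])
      (simp_all only: swap_AB_sB swap_AB_letters, simp_all add: assms hev_sA hev_sB del: One_nat_def)
  moreover have "hev (swap_AB g) X (\<lambda>_. Y) = rinv (gev X Y)"
    using g assms base.hev_rinv[OF assms g_exp] by (simp add: GRT_conditions_def two_cycle_def del: One_nat_def)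
  ultimately show ?thesis by simp
qed

lemma gev_add_left:
  assumes X: "X \<in> fil (Suc 0)" "Y \<in> fil (Suc 0)" and z: "z \<in> fil (Suc 0)" "commutes z X" "commutes z Y"
  shows "gev (X + z) Y = gev X Y"
  by (rule base.hev_add_commuting) (use g X z in \<open>simp_all add: GRT_conditions_def\<close>)

text \<open>The two-cycle relation moves the added element to the first argument.\<close>

lemma gev_add_right:
  assumes X: "X \<in> fil (Suc 0)" "Y \<in> fil (Suc 0)" and z: "z \<in> fil (Suc 0)" "commutes z X" "commutes z Y"
  shows "gev X (Y + z) = gev X Y"
  using gev_add_left[OF X(2,1) z(1,3,2)] gev_swap[OF fil_add[OF X(2) z(1)] X(1)] gev_swap[OF X(2,1)] by simp

abbreviation "t3_sum \<equiv> b + c + d"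

lemma total_fil [simp]: "- t3_sum \<in> fil (Suc 0)"
  by (intro fil_uminus fil_add fil1)

lemma total_commutes_gev:
  assumes "X \<in> {b, c, d}" "Y \<in> {b, c, d}" shows "commutes t3_sum (gev X Y)"
  by (rule base.commutes_hev[OF one.exp_over[OF g_exp]]) (use assms sum_commutes in auto)

text \<open>At the pair (c, d) the series C takes the value -c - d = b - \<open>t3_sum\<close>, and
  the summand commuting with everything may be dropped.\<close>

lemma hexagon_identity: "gev b c * gev d b * gev c d = 1"
proof -
  note cd = fil1(2) fil1(3)
  have e: "isum 1 (\<lambda>_. d) = d" by (simp add: int_upto_one)
  have z: "- c - isum 1 (\<lambda>_. d) = b + (- t3_sum)" unfolding e by simp
  have z': "commutes (- t3_sum) b" "commutes (- t3_sum) c" "commutes (- t3_sum) d"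
    using sum_commutes by (simp_all only: commutes_sym[of "- t3_sum"] commutes_uminus commutes_sym[of _ t3_sum])
  have "hev (flip 1 g) c (\<lambda>_. d) = gev (b + (- t3_sum)) d"
    unfolding z[symmetric] by (rule base.hev_flip[OF cd periodic_const one.exp_over[OF g_exp]])
  also have "\<dots> = gev b d"
    by (rule gev_add_left) (simp_all only: fil1 total_fil z')
  finally have f: "hev (flip 1 g) c (\<lambda>_. d) = gev b d" .
  have "hev (B_to_C g) c (\<lambda>_. d) = gev c (b + (- t3_sum))"
    unfolding z[symmetric]
    by (rule base.hev_endo[OF endo_B_to_C cd one.exp_over[OF g_exp]])
      (simp_all only: B_to_C_sB B_to_C_letters hev_sA[OF cd] base.hev_sC[OF cd periodic_const])
  also have "\<dots> = gev c b"
    by (rule gev_add_right) (simp_all only: fil1 total_fil z')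
  finally have B: "hev (B_to_C g) c (\<lambda>_. d) = gev c b" .
  have "rinv g * flip 1 g = rinv (B_to_C g)"
    using g by (simp add: GRT_conditions_def hexagon_def one.flip_ratio_def)
  then have "hev (rinv g * flip 1 g) c (\<lambda>_. d) = hev (rinv (B_to_C g)) c (\<lambda>_. d)"
    by simp
  then have "rinv (gev c d) * gev b d = rinv (gev c b)"
    using g_exp f B base.hev_mult[OF cd one.exp_over[OF one.exp_rinv[OF g_exp]] one.flip_over[OF one.exp_over[OF g_exp]]]
      base.hev_rinv[OF cd g_exp] base.hev_rinv[OF cd B_to_C_exp[OF g_exp]] by simp
  then have "gev b d = gev c d * gev b c"
    unfolding gev_swap[OF fil1(2,1), symmetric] by (metis unit_gev rinv_right_assoc fil1(2,3))
  then show ?thesis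
    unfolding gev_swap[OF fil1(1,3)] by (simp add: rinv_mult mult.assoc)
qed

text \<open>The special action condition at the pair (d, b), where C becomes c -
  \<open>t3_sum\<close>. It says that \<open>d\<close> and the two conjugates still add up to the
  unconjugated sum.\<close>

lemma special_identity: "ad (gev c d) c = t3_sum - d - ad (gev b d) b"
proof -
  note db = fil1(3) fil1(1)
  have e: "isum 1 (\<lambda>_. Y) = Y" for Y :: 'r by (simp add: int_upto_one)
  have z': "commutes (- t3_sum) b" "commutes (- t3_sum) c" "commutes (- t3_sum) d"
    using sum_commutes by (simp_all only: commutes_sym[of "- t3_sum"] commutes_uminus commutes_sym[of _ t3_sum])
  have z: "- d - b = c + (- t3_sum)" by simp
  have "hev (B_to_C g) d (\<lambda>_. b) = gev d (c + (- t3_sum))"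
    unfolding z[symmetric]
    by (rule base.hev_endo[OF endo_B_to_C db one.exp_over[OF g_exp]])
      (simp_all only: B_to_C_sB B_to_C_letters hev_sA[OF db] base.hev_sC[OF db periodic_const] e)
  also have "\<dots> = gev d c"
    by (rule gev_add_right) (simp_all only: fil1 total_fil z')
  finally have B: "hev (B_to_C g) d (\<lambda>_. b) = gev d c" .
  have sp: "special_action 1 g" and hex: "one.flip_ratio g = rinv (B_to_C g)"
    using g by (simp_all only: GRT_conditions_def hexagon_def)
  have "hev (twist 1 g (sC 1)) d (\<lambda>_. b) = hev (sC 1) d (\<lambda>_. ad (rinv (gev d b)) b)"
    by (rule base.hev_twist[OF db periodic_const g_exp sC_over]) simp
  also have "\<dots> = - d - ad (rinv (gev d b)) b"
    using base.hev_sC[of d "\<lambda>_. ad (rinv (gev d b)) b"] by (simp add: e ad_fil del: One_nat_def)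
  also have "rinv (gev d b) = gev b d"
    by (rule gev_swap[OF db, symmetric])
  finally have 1: "hev (twist 1 g (sC 1)) d (\<lambda>_. b) = - d - ad (gev b d) b" .
  have "hev (twist 1 g (sC 1)) d (\<lambda>_. b) = hev (ad (rinv (B_to_C g)) (sC 1)) d (\<lambda>_. b)"
    using one.special_action_iff[OF g_exp] sp hex by simp
  also have "\<dots> = ad (hev (rinv (B_to_C g)) d (\<lambda>_. b)) (hev (sC 1) d (\<lambda>_. b))"
    by (rule base.hev_ad_apply[OF db one.exp_rinv[OF B_to_C_exp[OF g_exp]] sC_over]) simp
  also have "hev (rinv (B_to_C g)) d (\<lambda>_. b) = gev c d"
    unfolding base.hev_rinv[OF db B_to_C_exp[OF g_exp]] B by (rule gev_swap[OF fil1(3,2), symmetric])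
  also have "hev (sC 1) d (\<lambda>_. b) = c - t3_sum"
    unfolding base.hev_sC[OF db periodic_const] e by simp
  also have "ad (gev c d) (c - t3_sum) = ad (gev c d) c - t3_sum"
  proof -
    have "ad (gev c d) t3_sum = t3_sum"
      by (rule ad_eq_self) (use total_commutes_gev[of c d] in \<open>simp_all add: commutes_sym\<close>)
    then show ?thesis by (simp only: ad_diff)
  qed
  finally show ?thesis using 1 by (simp add: algebra_simps)
qed

end

text \<open>The system obtained by letting a solution \<open>(g, h)\<close> act: every generator is conjugated by the
  associators along a path of parenthesisations from \<open>((12)3)4\<close> to one in which its two indices are adjacent.\<close>
locale twisted_system = t4_system fil sc N x y w b c d
  for fil :: "nat \<Rightarrow> 'r::ring_1 set" and sc :: "'k::field_char_0 \<Rightarrow> 'r" and N x y w b c d +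
  fixes g h :: "'k ab_series"
  assumes g: "GRT_conditions g" and h: "h \<in> exp_t03 N" "nc_coeff h [LA] = 0" "octagon N h" "special_action N h"
    and mixed: "mixed_pentagon N g h"
begin

lemma g_exp: "g \<in> exp_t03 1"
  using g by (simp add: GRT_conditions_def)

abbreviation "X \<equiv> y + isum N b"
text \<open>The \<open>P\<close> are the factors of the pentagon for the indices in the order 1234,
  with residues shifted by p, q, r; the \<open>Q\<close> belong to the order 1243 and the
  \<open>R\<close> to 1324. The pentagons are glued along common factors: \<open>P1\<close> occurs
  in the first two and \<open>P4\<close> in the first and third, while \<open>K\<close> compares
  \<open>P2\<close> with \<open>Q2\<close> and \<open>L\<close> compares \<open>P5\<close> with
  \<open>R5\<close>.\<close>

abbreviation "P1 p q \<equiv> hev h x (\<lambda>i. b (i + p) + c (i + q))"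
abbreviation "P2 r \<equiv> hev h X (\<lambda>i. d (i + r))"
abbreviation "P3 p r \<equiv> hev g (b p) (\<lambda>_. d r)"
abbreviation "P4 q r \<equiv> hev h total3 (\<lambda>i. c (i + q) + d (i + r))"
abbreviation "P5 p \<equiv> hev h x (\<lambda>i. b (i + p))"
abbreviation "Q2 r \<equiv> hev h (w + isum N c) (\<lambda>i. d (r - i))"
abbreviation "Q3 q r \<equiv> hev g (c q) (\<lambda>_. d r)"
abbreviation "Q4 p r \<equiv> hev h (x + w + isum N c) (\<lambda>i. b (i + p) + d (r - i))"
abbreviation "Q5 q \<equiv> hev h x (\<lambda>i. c (i + q))"
abbreviation "R1 p r \<equiv> hev h y (\<lambda>i. b (p - i) + d (i + r))"
abbreviation "R2 q \<equiv> hev h (x + isum N b) (\<lambda>i. c (i + q))"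
abbreviation "R3 p q \<equiv> hev g (b p) (\<lambda>_. c q)"
abbreviation "R5 p \<equiv> hev h y (\<lambda>i. b (p - i))"
definition "K = hev (flip_ratio h) X d"
definition "L = hev (flip_ratio h) x b"

lemma fil1_add [simp]: "u \<in> fil n \<Longrightarrow> v \<in> fil n \<Longrightarrow> u + v \<in> fil n"
  by (rule fil_add)

lemma unit_h [simp]: "A \<in> fil (Suc 0) \<Longrightarrow> (\<And>i. Y i \<in> fil (Suc 0)) \<Longrightarrow> unit (hev h A Y)"
  by (rule unit_hev[OF _ _ h(1)])

lemma unit_g [simp]: "A \<in> fil (Suc 0) \<Longrightarrow> (\<And>i. Y i \<in> fil (Suc 0)) \<Longrightarrow> unit (hev g A Y)"
  by (rule unit_hev[OF _ _ g_exp])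

lemma unit_KL [simp]: "unit K" "unit L"
  unfolding K_def L_def by (rule unit_hev_exp; simp add: flip_ratio_exp h)+

lemmas commutes_h = commutes_hev[OF exp_over[OF h(1)]]

lemma triple: "q = p + r \<Longrightarrow> t3_triple fil sc (b p) (c q) (d r) g"
  using bcd[of q p r] g
  by unfold_locales (simp_all add: commutes_def distrib_left distrib_right)

lemma pentagon234: "q = p + r \<Longrightarrow> P1 p q * P2 r = P3 p r * P4 q r * P5 p"
proof -
  assume "q = p + r"
  then interpret s: t4_system fil sc N x y w "\<lambda>i. b (i + p)" "\<lambda>i. c (i + q)" "\<lambda>i. d (i + r)" by (rule shift)
  show ?thesis
    using s.pentagon_at[OF h(1) g_exp mixed] unfolding left_at_def right_at_def by (simp add: isum_shift)
qed

lemma pentagon243: "q = p + r \<Longrightarrow> P1 p q * Q2 r = Q3 q r * Q4 p r * Q5 q"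
proof -
  assume q: "q = p + r"
  interpret s34: t4_system fil sc N x w y c b "\<lambda>i. d (- i)" by (rule swap34)
  interpret s: t4_system fil sc N x w y "\<lambda>i. c (i + q)" "\<lambda>i. b (i + p)" "\<lambda>i. d (- (i + - r))"
    by (rule s34.shift) (simp add: q)
  show ?thesis
    using s.pentagon_at[OF h(1) g_exp mixed] unfolding left_at_def right_at_def
    by (simp add: isum_shift add.commute[of "c _" "b _"])
qed

lemma pentagon324: "q = p + r \<Longrightarrow> R1 p r * R2 q = R3 p q * P4 q r * R5 p"
proof -
  assume q: "q = p + r"
  interpret s23: t4_system fil sc N y x w "\<lambda>i. b (- i)" d c by (rule swap23)
  interpret s: t4_system fil sc N y x w "\<lambda>i. b (- (i + - p))" "\<lambda>i. d (i + r)" "\<lambda>i. c (i + q)"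
    by (rule s23.shift) (simp add: q)
  have "(\<Sum>i\<in>{0..<int N}. b (- (i + - p))) = isum N b"
    unfolding s23.isum_shift(1) isum_neg ..
  then show ?thesis
    using s.pentagon_at[OF h(1) g_exp mixed] unfolding left_at_def right_at_def
    by (simp add: add.commute[of "d _" "c _"] add.commute[of y x])
qed

text \<open>By the octagon the ratio is the same for every residue \<open>r\<close>, so a single
  \<open>K\<close> serves in the definition of all \<open>c' q\<close>.\<close>

lemma K_eq: "K = rinv (P2 r) * Q2 r"
  unfolding K_def
proof (rule hev_flip_ratio[OF _ _ _ h])
  have "X + (w + isum N c) + isum N d = total4 - x"
    by (simp add: algebra_simps)
  moreover have "commutes X (total4 - x)"
    by (intro commutes_diff commutes_symI[OF x_yb] commutes_symI[of total4] commutes_add commutes_sum central)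
  moreover have "commutes (d i) (total4 - x)" for i
    by (intro commutes_diff commutes_symI[OF x_d] commutes_symI[OF central(5)])
  ultimately show "commutes (X + (w + isum N c) + isum N d) X" "commutes (X + (w + isum N c) + isum N d) (d i)" for i
    by (simp_all only: commutes_symI)
qed simp_all

lemma L_eq: "L = rinv (P5 p) * R5 p"
  unfolding L_def by (rule hev_flip_ratio[OF _ _ _ h]) (simp_all add: total3)

lemma b_total3: "commutes total3 (P5 p)" "commutes total3 L"
proof -
  show "commutes total3 (P5 p)" by (rule commutes_h) (simp_all add: total3)
  show "commutes total3 L"
    unfolding L_def by (rule commutes_hev) (simp_all add: total3 flip_ratio_exp h)
qed

definition "b' p = ad (rinv (P5 p)) (b p)"
definition "c' q = ad (K * rinv (Q5 q)) (c q)"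
definition "d' r = ad (rinv (P2 r)) (d r)"
text \<open>Defined so that \<open>total3\<close>, and with \<open>w'\<close> also
  \<open>total4\<close>, keep their values; the centrality relations then carry over. That
  \<open>y'\<close> is a conjugate of \<open>y\<close> becomes a theorem,
  \<open>y'_eq\<close>.\<close>

definition "y' = total3 - x - isum N b'"
definition "w' = total4 - x - y' - isum N b' - isum N c' - isum N d'"

lemma c_Q4: "q = p + r \<Longrightarrow> commutes (c q) (Q4 p r)"
  by (rule commutes_h) (simp_all add: commutes_sym[of "c _" "x + w + _"] xwc bcd)

lemma b_P4: "q = p + r \<Longrightarrow> commutes (b p) (P4 q r)"
  by (rule commutes_h) (simp_all add: commutes_sym[of "b _" total3] xyb bcd)

lemma d_P1: "q = p + r \<Longrightarrow> commutes (d r) (P1 p q)"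
  by (rule commutes_h) (simp_all add: commutes_sym[of "d _" x] x_d bcd)

text \<open>Conjugation by \<open>P1 p q * P2 r\<close> transports the three generators to a place
  where only \<open>g\<close> conjugates them: the pentagons reduce the paths of \<open>b'\<close>
  and \<open>c'\<close> to factors of \<open>g\<close>, and \<open>special_identity\<close>
  expresses the second conjugate by the first.\<close>

lemma conj_path:
  assumes q: "q = p + r"
  shows "ad (P1 p q * P2 r) (b' p) = ad (P3 p r) (b p)"
    and "ad (P1 p q * P2 r) (c' q) = b p + c q - ad (P3 p r) (b p)"
    and "ad (P1 p q * P2 r) (d' r) = d r"
proof -
  have "P1 p q * P2 r * rinv (P5 p) = P3 p r * P4 q r"
    by (simp add: pentagon234[OF q] mult.assoc)
  then have "ad (P1 p q * P2 r) (b' p) = ad (P3 p r * P4 q r) (b p)"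
    by (simp add: b'_def ad_mult[symmetric])
  also have "\<dots> = ad (P3 p r) (b p)"
    using b_P4[OF q] by (simp add: ad_mult ad_eq_self commutes_sym)
  finally show "ad (P1 p q * P2 r) (b' p) = ad (P3 p r) (b p)" .
  interpret t: t3_triple fil sc "b p" "c q" "d r" g by (rule triple[OF q])
  have "P1 p q * P2 r * (K * rinv (Q5 q)) = P1 p q * Q2 r * rinv (Q5 q)"
    unfolding K_eq[of r] by (simp add: mult.assoc)
  also have "\<dots> = Q3 q r * Q4 p r"
    unfolding pentagon243[OF q] by (simp add: mult.assoc)
  finally have "ad (P1 p q * P2 r) (c' q) = ad (Q3 q r * Q4 p r) (c q)"
    by (simp add: c'_def flip: ad_mult)
  also have "\<dots> = ad (Q3 q r) (c q)"
    using c_Q4[OF q] by (simp add: ad_mult ad_eq_self commutes_sym)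
  also have "\<dots> = b p + c q - ad (P3 p r) (b p)"
    using t.special_identity by simp
  finally show "ad (P1 p q * P2 r) (c' q) = b p + c q - ad (P3 p r) (b p)" .
  have "ad (P1 p q * P2 r) (d' r) = ad (P1 p q) (d r)"
    by (simp add: d'_def ad_mult)
  also have "\<dots> = d r"
    using d_P1[OF q] by (simp add: ad_eq_self commutes_sym)
  finally show "ad (P1 p q * P2 r) (d' r) = d r" .
qed

lemma bcd':
  assumes q: "q = p + r"
  shows "commutes (b' p) (c' q + d' r)" "commutes (c' q) (b' p + d' r)" "commutes (d' r) (b' p + c' q)"
proof -
  interpret t: t3_triple fil sc "b p" "c q" "d r" g by (rule triple[OF q])
  \<comment> \<open>After the transport the three generators still add up to \<open>?T\<close>,
    which commutes with each of them; every relation then says that one of them commutes with the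
    rest of the sum.\<close>
  let ?a = "P1 p q * P2 r" and ?B = "ad (P3 p r) (b p)" and ?T = "b p + c q + d r"
  have u: "unit ?a" by simp
  have T: "commutes ?T (b p)" "commutes ?T (c q)" "commutes ?T (d r)" by (rule t.sum_commutes)+
  have TB: "commutes ?T ?B"
    by (rule commutes_ad) (simp_all add: t.total_commutes_gev T)
  have "commutes ?B (?T - ?B)" "commutes (?T - d r - ?B) (?T - (?T - d r - ?B))" "commutes (d r) (?T - d r)"
    by (rule commutes_complement; intro commutes_diff commutes_refl T TB)+
  moreover have "ad ?a (c' q + d' r) = ?T - ?B" "ad ?a (b' p + d' r) = ?T - (?T - d r - ?B)"
    "ad ?a (b' p + c' q) = ?T - d r" "ad ?a (c' q) = ?T - d r - ?B"
    by (simp_all add: ad_add conj_path[OF q])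
  ultimately have "commutes (ad ?a (b' p)) (ad ?a (c' q + d' r))" "commutes (ad ?a (c' q)) (ad ?a (b' p + d' r))"
    "commutes (ad ?a (d' r)) (ad ?a (b' p + c' q))"
    by (simp_all only: conj_path(1,3)[OF q])
  then show "commutes (b' p) (c' q + d' r)" "commutes (c' q) (b' p + d' r)" "commutes (d' r) (b' p + c' q)"
    by (simp_all only: commutes_ad_iff[OF u])
qed

lemma periodic': "periodic N b'" "periodic N c'" "periodic N d'"
proof -
  have "b (i + p mod int N) = b (i + p)" "c (i + p mod int N) = c (i + p)" "d (i + p mod int N) = d (i + p)" for i p
    by (rule periodic_cong[OF periodic(1)] periodic_cong[OF periodic(2)] periodic_cong[OF periodic(3)]; simp add: mod_simps)+
  then show "periodic N b'" "periodic N c'" "periodic N d'"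
    by (simp_all add: periodic_def b'_def c'_def d'_def periodic[THEN periodicD])
qed

lemma fil1': "b' i \<in> fil (Suc 0)" "c' i \<in> fil (Suc 0)" "d' i \<in> fil (Suc 0)"
  by (simp_all add: b'_def c'_def d'_def ad_fil)

lemma fun_b': "(\<lambda>i. ad (rinv (P5 i)) (b i)) = b'"
  and fun_d': "(\<lambda>i. ad (rinv (P2 i)) (d i)) = d'"
  by (simp_all add: fun_eq_iff b'_def d'_def)

text \<open>This is the special action condition for \<open>h\<close> at (x, b): there C = -x -
  \<Sum>b is \<open>y\<close> minus \<open>total3\<close>, and \<open>total3\<close> is fixed by
  \<open>L\<close>.\<close>

lemma y'_eq: "y' = ad L y"
proof -
  have "hev (twist N h (sC N)) x b = hev (sC N) x b'"
    using hev_twist[of x b h "sC N"] h by (simp add: fun_b')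
  also have "\<dots> = - x - isum N b'"
    by (rule hev_sC) (simp_all add: fil1' periodic')
  finally have 1: "hev (twist N h (sC N)) x b = - x - isum N b'" .
  have "hev (twist N h (sC N)) x b = hev (ad (flip_ratio h) (sC N)) x b"
    using special_action_iff[OF h(1)] h(4) by simp
  also have "\<dots> = ad L (- x - isum N b)"
    by (simp add: hev_ad_apply flip_ratio_exp h hev_sC L_def)
  finally have "- x - isum N b' = ad L (- x - isum N b)"
    using 1 by simp
  then have "y' = total3 + ad L (y - total3)"
    by (simp add: y'_def algebra_simps)
  also have "ad L total3 = total3"
    by (rule ad_eq_self) (use b_total3 in \<open>simp_all add: commutes_sym\<close>)
  then have "total3 + ad L (y - total3) = ad L y"
    unfolding ad_diff[of L y] by simp
  finally show ?thesis .
qed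

text \<open>Both \<open>t\<^sup>1\<^sup>3\<close> and \<open>t(a)\<^sup>2\<^sup>4\<close> are brought to \<open>(13)(24)\<close>, where they commute; that the two paths to
  \<open>t(a)\<^sup>2\<^sup>4\<close> agree uses the three pentagons and the hexagon of \<open>g\<close>.\<close>
lemma y'_c': "commutes y' (c' q)"
proof -
  \<comment> \<open>Any splitting q = p + r would do, since the claim involves \<open>q\<close>
    alone.\<close>
  define p r where "p = (0 :: int)" and "r = q"
  then have q: "q = p + r" by simp
  interpret t: t3_triple fil sc "b p" "c q" "d r" g by (rule triple[OF q])
  let ?s = "L * rinv (R2 q)"
  have us: "unit ?s" by simp
  have y: "commutes (R2 q) y"
    by (rule commutes_symI, rule commutes_h) (simp_all add: y_xb y_c)
  then have "y' = ad ?s y"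
    by (simp add: y'_eq ad_mult ad_rinv_eq_self)
  moreover have "c' q = ad ?s (c q)"
  proof -
    have LK: "rinv ?s * (K * rinv (Q5 q)) = R2 q * rinv (R5 p) * (P5 p * rinv (P2 r)) * (Q2 r * rinv (Q5 q))"
      unfolding L_eq[of p] K_eq[of r] by (simp add: rinv_mult mult.assoc)
    have 1: "P5 p * rinv (P2 r) = rinv (P3 p r * P4 q r) * P1 p q"
      using pentagon234[OF q] by (simp add: mult_rinv_eq_iff mult.assoc rinv_mult)
    have 2: "Q2 r * rinv (Q5 q) = rinv (P1 p q) * (Q3 q r * Q4 p r)"
    proof -
      have "Q2 r = rinv (P1 p q) * (P1 p q * Q2 r)" by simp
      then show ?thesis unfolding pentagon243[OF q] by (simp add: mult_rinv_eq_iff mult.assoc)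
    qed
    have 3: "R2 q * rinv (R5 p) = rinv (R1 p r) * (R3 p q * P4 q r)"
    proof -
      have "R2 q = rinv (R1 p r) * (R1 p r * R2 q)" by simp
      then show ?thesis unfolding pentagon324[OF q] by (simp add: mult_rinv_eq_iff mult.assoc)
    qed
    \<comment> \<open>The factors of \<open>g\<close> left over by the three pentagons are those of
      the hexagon of the triple; their cancellation makes the two paths agree.\<close>
    have hex: "R3 p q * (rinv (P3 p r) * (Q3 q r * z)) = z" for z
    proof -
      have "R3 p q * (rinv (P3 p r) * (Q3 q r * z)) = R3 p q * rinv (P3 p r) * Q3 q r * z"
        by (simp only: mult.assoc)
      then show ?thesis using t.hexagon_identity unfolding t.gev_swap[OF t.fil1(1,3)] by simp
    qed
    have "rinv ?s * (K * rinv (Q5 q)) = rinv (R1 p r) * Q4 p r"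
      unfolding LK 1 2 3 by (simp add: rinv_mult mult.assoc hex)
    moreover have "commutes (c q) (R1 p r)"
    proof (rule commutes_h)
      show "commutes (c q) (b (p - i) + d (i + r))" for i
        by (rule bcd(2)) (simp add: q)
    qed (simp_all add: commutes_symI y_c)
    ultimately have "ad (rinv ?s) (c' q) = c q"
      using c_Q4[OF q] by (simp add: c'_def ad_mult[symmetric]) (simp add: ad_mult ad_eq_self ad_rinv_eq_self commutes_symI)
    then have "ad ?s (ad (rinv ?s) (c' q)) = ad ?s (c q)" by simp
    then show ?thesis using us by (simp only: ad_ad_rinv)
  qed
  ultimately show ?thesis
    using y_c us by (simp only: commutes_ad_iff)
qed

lemma fil1_yw': "y' \<in> fil (Suc 0)" "w' \<in> fil (Suc 0)"
proof -
  show y: "y' \<in> fil (Suc 0)" by (simp add: y'_eq ad_fil)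
  show "w' \<in> fil (Suc 0)"
    unfolding w'_def using fil1' y by (intro fil_diff fil_sum) simp_all
qed

lemma total4_hev:
  assumes "A \<in> fil (Suc 0)" "\<And>i. Y i \<in> fil (Suc 0)" "commutes total4 A" "\<And>i. commutes total4 (Y i)"
  shows "commutes total4 (hev h A Y)" "commutes total4 (hev (flip_ratio h) A Y)"
  by (rule commutes_hev; simp add: assms h flip_ratio_exp)+

theorem twisted: "t4_system fil sc N x y' w' b' c' d'"
proof unfold_locales
  have t3: "x + y' + isum N b' = total3" by (simp add: y'_def)
  have t4: "x + y' + w' + isum N b' + isum N c' + isum N d' = total4" by (simp add: w'_def)
  show "commutes (x + y' + isum N b') (b' i)" for i
    unfolding t3 b'_def[of i] by (rule commutes_ad) (simp_all add: commutes_rinv b_total3 xyb)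
  have "y' + isum N b' = total3 - x" by (simp add: y'_def)
  then show "commutes x (y' + isum N b')"
    using commutes_complement[OF total3(1)] by simp
  show "commutes x (d' i)" for i
    unfolding d'_def by (rule commutes_ad) (simp_all add: commutes_rinv commutes_h x_yb x_d)
  show "commutes y' (c' i)" for i by (rule y'_c')
  have sums: "commutes total4 X" "commutes total4 (w + isum N c)"
    by (intro commutes_add commutes_sum central central_w)+
  then have KL: "commutes total4 K" "commutes total4 L"
    unfolding K_def L_def by (simp_all add: total4_hev central)
  show "commutes (x + y' + w' + isum N b' + isum N c' + isum N d') (b' i)" for i
    unfolding t4 b'_def[of i] by (rule commutes_ad) (simp_all add: commutes_rinv total4_hev central)
  show "commutes (x + y' + w' + isum N b' + isum N c' + isum N d') (c' i)" for i
    unfolding t4 c'_def[of i]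
    by (rule commutes_ad) (simp_all add: commutes_rinv commutes_mult KL total4_hev central)
  show "commutes (x + y' + w' + isum N b' + isum N c' + isum N d') (d' i)" for i
    unfolding t4 d'_def[of i] by (rule commutes_ad) (simp_all add: commutes_rinv total4_hev central sums)
  show "commutes (x + y' + w' + isum N b' + isum N c' + isum N d') x"
    unfolding t4 by (rule central)
  show "commutes (x + y' + w' + isum N b' + isum N c' + isum N d') y'"
    unfolding t4 by (subst y'_eq, rule commutes_ad) (simp_all add: KL central)
qed (simp_all add: fil1' fil1_yw' periodic' bcd')

text \<open>Each factor splits off a factor of the pentagon of \<open>h\<close>. Moving
  \<open>P2 0\<close> to the front conjugates the arguments of the first evaluation of
  \<open>h'\<close>, and \<open>conj_path\<close> recognises the result.\<close>

lemma left_at_twist_mult: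
  assumes h': "h' \<in> exp_t03 N"
  shows "left_at (twist_mult N h' h) x y b c d = P1 0 0 * P2 0 * left_at h' x y' b' c' d'"
proof -
  have 1: "hev (twist_mult N h' h) x (\<lambda>i. b i + c i) = P1 0 0 * hev h' x (\<lambda>i. ad (rinv (P1 i i)) (b i + c i))"
    using hev_twist_mult[of x "\<lambda>i. b i + c i" h h'] h h' by (simp add: periodic_add)
  have 2: "hev (twist_mult N h' h) X d = P2 0 * hev h' X d'"
    using hev_twist_mult[of X d h h'] h h' by (simp add: fun_d')
  \<comment> \<open>The path with r = 0 applies for every \<open>i\<close>, because its second
    factor \<open>P2 0\<close> does not involve \<open>i\<close>.\<close>
  have 3: "ad (rinv (P2 0)) (ad (rinv (P1 i i)) (b i + c i)) = b' i + c' i" for i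
  proof -
    have 1: "ad (P1 i i * P2 0) (b' i + c' i) = b i + c i"
      using conj_path[of i i 0] by (simp add: ad_add)
    have "unit (P1 i i * P2 0)" by simp
    from ad_rinv_ad[OF this, of "b' i + c' i"] have "ad (rinv (P1 i i * P2 0)) (b i + c i) = b' i + c' i"
      unfolding 1 .
    then show ?thesis by (simp add: rinv_mult ad_mult)
  qed
  have x: "ad (rinv (P2 0)) x = x"
    by (rule ad_rinv_eq_self) (simp_all add: commutes_symI commutes_h x_yb x_d)
  have "ad (rinv (P2 0)) (hev h' x (\<lambda>i. ad (rinv (P1 i i)) (b i + c i))) = hev h' x (\<lambda>i. b' i + c' i)"
    using hev_ad[of x "\<lambda>i. ad (rinv (P1 i i)) (b i + c i)" h' N "rinv (P2 0)"] h'
    by (simp only: x 3) (simp add: ad_fil)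
  then have "hev h' x (\<lambda>i. ad (rinv (P1 i i)) (b i + c i)) * (P2 0 * z) = P2 0 * (hev h' x (\<lambda>i. b' i + c' i) * z)" for z
    using mult_unit_mult[of "P2 0"] by simp
  moreover have "X = y' + isum N b'" by (simp add: y'_def)
  ultimately show ?thesis
    unfolding left_at_def 1 2 by (simp add: mult.assoc)
qed

text \<open>The factors of the pentagon of \<open>(g, h)\<close> are moved to the front one after
  the other, conjugating the arguments of what they pass; each conjugated argument turns out to be a
  transformed generator.\<close>

lemma right_at_twist_mult:
  assumes h': "h' \<in> exp_t03 N" and g': "g' \<in> exp_t03 1"
  shows "right_at (twist_mult 1 g' g) (twist_mult N h' h) x y b c d
    = P3 0 0 * P4 0 0 * P5 0 * right_at g' h' x y' b' c' d'"
proof -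
  interpret t: t3_triple fil sc "b 0" "c 0" "d 0" g by (rule triple) simp
  have 1: "hev (twist_mult 1 g' g) (b 0) (\<lambda>_. d 0) = P3 0 0 * hev g' (b 0) (\<lambda>_. ad (rinv (P3 0 0)) (d 0))"
    using t.base.hev_twist_mult[of "b 0" "\<lambda>_. d 0" g g'] g_exp g' by simp
  have 2: "hev (twist_mult N h' h) total3 (\<lambda>i. c i + d i) = P4 0 0 * hev h' total3 (\<lambda>i. ad (rinv (P4 i i)) (c i + d i))"
    using hev_twist_mult[of total3 "\<lambda>i. c i + d i" h h'] h h' by (simp add: periodic_add)
  have 3: "hev (twist_mult N h' h) x b = P5 0 * hev h' x b'"
    using hev_twist_mult[of x b h h'] h h' by (simp add: fun_b')
  let ?u = "P4 0 0 * P5 0"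
  have b0: "ad (rinv ?u) (b 0) = b' 0"
    using b_P4[of 0 0 0] by (simp add: rinv_mult ad_mult ad_rinv_eq_self commutes_symI b'_def)
  have d0: "ad (rinv ?u) (ad (rinv (P3 0 0)) (d 0)) = d' 0"
  proof -
    have "ad (rinv (P3 0 0 * ?u)) (d 0) = ad (rinv (P1 0 0 * P2 0)) (ad (P1 0 0 * P2 0) (d' 0))"
      using pentagon234[of 0 0 0] conj_path(3)[of 0 0 0] by (simp add: mult.assoc)
    then show ?thesis by (simp add: rinv_mult ad_mult)
  qed
  have G: "hev g' (b 0) (\<lambda>_. ad (rinv (P3 0 0)) (d 0)) * (?u * z) = ?u * (hev g' (b' 0) (\<lambda>_. d' 0) * z)" for z
  proof -
    have "hev g' (ad (rinv ?u) (b 0)) (\<lambda>_. ad (rinv ?u) (ad (rinv (P3 0 0)) (d 0)))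
        = ad (rinv ?u) (hev g' (b 0) (\<lambda>_. ad (rinv (P3 0 0)) (d 0)))"
      by (rule hev_ad[OF _ _ one.exp_over[OF g']]) (simp_all add: ad_fil)
    then have "ad (rinv ?u) (hev g' (b 0) (\<lambda>_. ad (rinv (P3 0 0)) (d 0))) = hev g' (b' 0) (\<lambda>_. d' 0)"
      unfolding b0 d0 by (rule sym)
    then show ?thesis
      using mult_unit_mult[of ?u "hev g' (b 0) (\<lambda>_. ad (rinv (P3 0 0)) (d 0))" z] by simp
  qed
  \<comment> \<open>Here p = 0 and q = r = i, so that \<open>P5 0\<close> is common to all
    \<open>i\<close>. The sum \<open>c' i + d' i\<close> is found as the complement of the conjugate
    of \<open>b 0\<close> in the sum of the triple, which \<open>P3 0 i\<close> fixes.\<close>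
  have cd: "ad (rinv (P5 0)) (ad (rinv (P4 i i)) (c i + d i)) = c' i + d' i" for i
  proof -
    interpret ti: t3_triple fil sc "b 0" "c i" "d i" g by (rule triple) simp
    have u: "unit (P3 0 i * P4 i i * P5 0)" "unit (P4 i i * P5 0)" by simp_all
    have "ad (P3 0 i * P4 i i * P5 0) (c' i + d' i) = ti.t3_sum - ad (P3 0 i) (b 0)"
      using conj_path(2,3)[of i 0 i] pentagon234[of i 0 i] by (simp add: ad_add)
    also have "\<dots> = ad (P3 0 i) (ti.t3_sum - b 0)"
    proof -
      have "ad (P3 0 i) ti.t3_sum = ti.t3_sum"
        by (rule ad_eq_self) (simp_all add: commutes_symI ti.total_commutes_gev)
      then show ?thesis by (simp only: ad_diff)
    qed
    finally have "ad (P3 0 i) (ad (P4 i i * P5 0) (c' i + d' i)) = ad (P3 0 i) (c i + d i)"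
      by (simp add: ad_mult mult.assoc)
    then have 1: "ad (P4 i i * P5 0) (c' i + d' i) = c i + d i"
      by (simp add: ad_eq_iff)
    from ad_rinv_ad[OF u(2), of "c' i + d' i"] have "ad (rinv (P4 i i * P5 0)) (c i + d i) = c' i + d' i"
      unfolding 1 .
    then show ?thesis by (simp add: rinv_mult ad_mult)
  qed
  have H: "hev h' total3 (\<lambda>i. ad (rinv (P4 i i)) (c i + d i)) * (P5 0 * z) = P5 0 * (hev h' total3 (\<lambda>i. c' i + d' i) * z)" for z
  proof -
    have t: "ad (rinv (P5 0)) total3 = total3"
      by (rule ad_rinv_eq_self[OF _ commutes_symI[OF b_total3(1)]]) simp
    have "hev h' (ad (rinv (P5 0)) total3) (\<lambda>i. ad (rinv (P5 0)) (ad (rinv (P4 i i)) (c i + d i)))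
        = ad (rinv (P5 0)) (hev h' total3 (\<lambda>i. ad (rinv (P4 i i)) (c i + d i)))"
      by (rule hev_ad[OF _ _ exp_over[OF h']]) (simp_all add: ad_fil)
    then have "ad (rinv (P5 0)) (hev h' total3 (\<lambda>i. ad (rinv (P4 i i)) (c i + d i))) = hev h' total3 (\<lambda>i. c' i + d' i)"
      unfolding cd t by (rule sym)
    then show ?thesis
      using mult_unit_mult[of "P5 0" "hev h' total3 (\<lambda>i. ad (rinv (P4 i i)) (c i + d i))" z] by simp
  qed
  have t3: "x + y' + isum N b' = total3" by (simp add: y'_def)
  have "right_at (twist_mult 1 g' g) (twist_mult N h' h) x y b c d
      = P3 0 0 * (hev g' (b 0) (\<lambda>_. ad (rinv (P3 0 0)) (d 0)) *
          (P4 0 0 * (hev h' total3 (\<lambda>i. ad (rinv (P4 i i)) (c i + d i)) * (P5 0 * hev h' x b'))))"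
    unfolding right_at_def 1 2 3 by (simp only: mult.assoc)
  also have "\<dots> = P3 0 0 * (hev g' (b 0) (\<lambda>_. ad (rinv (P3 0 0)) (d 0)) *
      (?u * (hev h' total3 (\<lambda>i. c' i + d' i) * hev h' x b')))"
    unfolding H by (simp only: mult.assoc)
  also have "\<dots> = P3 0 0 * (?u * (hev g' (b' 0) (\<lambda>_. d' 0) * (hev h' total3 (\<lambda>i. c' i + d' i) * hev h' x b')))"
    unfolding G ..
  finally show ?thesis
    unfolding right_at_def t3 by (simp only: mult.assoc)
qed

text \<open>The prefactors split off on the two sides are the two sides of the pentagon of
  \<open>(g, h)\<close>, so they cancel.\<close>

theorem pentagon_twist_mult_iff:
  assumes "h' \<in> exp_t03 N" "g' \<in> exp_t03 1"
  shows "left_at (twist_mult N h' h) x y b c d = right_at (twist_mult 1 g' g) (twist_mult N h' h) x y b c d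
    \<longleftrightarrow> left_at h' x y' b' c' d' = right_at g' h' x y' b' c' d'"
proof -
  have "P1 0 0 * P2 0 = P3 0 0 * P4 0 0 * P5 0" by (rule pentagon234) simp
  then show ?thesis
    unfolding left_at_twist_mult[OF assms(1)] right_at_twist_mult[OF assms]
    using unit_mult_left_cancel[of "P1 0 0 * P2 0"] by simp
qed

section \<open>Agreement of the two systems to leading order\<close>

definition near_one :: "'r \<Rightarrow> bool"
  where "near_one u \<longleftrightarrow> unit u \<and> u - 1 \<in> fil (Suc 0)"

lemma near_one_rinv: "near_one u \<Longrightarrow> near_one (rinv u)"
proof -
  assume u: "near_one u"
  then have "rinv u - 1 = - (rinv u * (u - 1))" by (simp add: near_one_def algebra_simps)
  then show ?thesis using u by (simp add: near_one_def fil_uminus fil_mult_left)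
qed

lemma near_one_mult: "near_one u \<Longrightarrow> near_one v \<Longrightarrow> near_one (u * v)"
  using fil_diff_mult[of u 1 "Suc 0" v 1] by (simp add: near_one_def)

lemma near_one_hev:
  assumes "A \<in> fil (Suc 0)" "\<And>i. Y i \<in> fil (Suc 0)" "f \<in> exp_t03 N"
  shows "near_one (hev f A Y)"
proof -
  note H = continuous_hom_hev[OF assms(1,2), of N]
  have "f - 1 \<in> nc_deg (Suc 0)"
    using assms(3) by (simp add: nc_deg_Suc_0_iff nc_coeff_one)
  then have "hev (f - 1) A Y \<in> fil (Suc 0)"
    using assms(3) by (intro chom_deg[OF H] nc_over_diff) simp_all
  then show ?thesis
    using assms by (simp add: near_one_def chom_diff[OF H] chom_1[OF H] unit_hev_exp)
qed

text \<open>Up to a unit the difference is the commutator of \<open>z\<close> with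
  \<open>u - 1\<close>, both of positive degree.\<close>

lemma ad_near_one:
  assumes u: "near_one u" and z: "z \<in> fil (Suc 0)"
  shows "ad u z - z \<in> fil (Suc (Suc 0))"
proof -
  have "ad u z - z = ((u - 1) * z - z * (u - 1)) * rinv u"
    using u by (simp add: ad_def near_one_def algebra_simps)
  moreover have "u - 1 \<in> fil (Suc 0)" using u by (simp add: near_one_def)
  then have "(u - 1) * z - z * (u - 1) \<in> fil (Suc 0 + Suc 0)"
    by (intro fil_diff[OF fil_mult fil_mult] z)
  ultimately show ?thesis using fil_mult_right by simp
qed

interpretation tw: t4_system fil sc N x y' w' b' c' d'
  by (rule twisted)

lemma letters_near:
  "y' - y \<in> fil (Suc (Suc 0))" "b' i - b i \<in> fil (Suc (Suc 0))"
  "c' i - c i \<in> fil (Suc (Suc 0))" "d' i - d i \<in> fil (Suc (Suc 0))" "w' - w \<in> fil (Suc (Suc 0))"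
proof -
  show y: "y' - y \<in> fil (Suc (Suc 0))"
    unfolding y'_eq L_def by (rule ad_near_one[OF near_one_hev]) (simp_all add: h flip_ratio_exp)
  show b: "b' i - b i \<in> fil (Suc (Suc 0))" for i
    unfolding b'_def by (rule ad_near_one[OF near_one_rinv[OF near_one_hev]]) (simp_all add: h)
  show c: "c' i - c i \<in> fil (Suc (Suc 0))" for i
    unfolding c'_def K_def
    by (rule ad_near_one[OF near_one_mult[OF near_one_hev near_one_rinv[OF near_one_hev]]])
      (simp_all add: h flip_ratio_exp)
  show d: "d' i - d i \<in> fil (Suc (Suc 0))" for i
    unfolding d'_def by (rule ad_near_one[OF near_one_rinv[OF near_one_hev]]) (simp_all add: h)
  have "w' - w = - (y' - y) - (\<Sum>i\<in>{0..<int N}. b' i - b i) - (\<Sum>i\<in>{0..<int N}. c' i - c i)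
      - (\<Sum>i\<in>{0..<int N}. d' i - d i)"
    by (simp add: w'_def sum_subtractf algebra_simps)
  then show "w' - w \<in> fil (Suc (Suc 0))"
    using fil_diff[OF fil_diff[OF fil_diff[OF fil_uminus[OF y] fil_sum[OF b]] fil_sum[OF c]] fil_sum[OF d]] by simp
qed

lemma ev_twisted_near:
  assumes "f \<in> nc_over (tgens 4 N)" "f \<in> nc_deg n"
  shows "ev tw.gen_value f - ev gen_value f \<in> fil (Suc n)"
proof -
  have "tw.gen_value t - gen_value t \<in> fil (Suc (Suc 0))" for t
    by (auto simp: tw.gen_value_def gen_value_def letters_near split: tgen.splits)
  from ev_diff_fil[OF finite_tgens assms(1) tw.gen_value_fil gen_value_fil this assms(2)]
  show ?thesis by simp
qed

end

section \<open>The universal system\<close>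

lemma nc_closure_iff: "f \<in> nc_closure I \<longleftrightarrow> (\<forall>d. \<exists>g\<in>I. f - g \<in> nc_deg d)"
proof
  assume "f \<in> nc_closure I"
  then have *: "\<exists>g\<in>I. \<forall>w. length w \<le> d \<longrightarrow> nc_coeff f w = nc_coeff g w" for d
    by (simp add: nc_closure_def)
  show "\<forall>d. \<exists>g\<in>I. f - g \<in> nc_deg d"
  proof
    fix d
    obtain g where "g \<in> I" "\<forall>w. length w \<le> d \<longrightarrow> nc_coeff f w = nc_coeff g w" using *[of d] by blast
    then show "\<exists>g\<in>I. f - g \<in> nc_deg d" by (intro bexI[of _ g]) (simp_all add: nc_deg_def)
  qed
next
  assume *: "\<forall>d. \<exists>g\<in>I. f - g \<in> nc_deg d"
  have "\<exists>g\<in>I. \<forall>w. length w \<le> d \<longrightarrow> nc_coeff f w = nc_coeff g w" for d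
    using *[rule_format, of "Suc d"] by (auto simp: nc_deg_def less_Suc_eq_le)
  then show "f \<in> nc_closure I" by (simp add: nc_closure_def)
qed

lemma nc_ideal_mult:
  assumes "f \<in> nc_ideal X R" "e \<in> nc_over X" shows "e * f \<in> nc_ideal X R" "f * e \<in> nc_ideal X R"
  using assms(1)
proof (induction rule: nc_ideal.induct)
  case (gen r p q)
  { case 1
    have "(e * p) * r * q \<in> nc_ideal X R" by (rule nc_ideal.gen) (simp_all add: gen nc_over_mult assms)
    then show ?case by (simp add: mult.assoc) }
  { case 2
    have "p * r * (q * e) \<in> nc_ideal X R" by (rule nc_ideal.gen) (simp_all add: gen nc_over_mult assms)
    then show ?case by (simp add: mult.assoc) }
qed (simp_all add: distrib_left distrib_right nc_ideal.zero nc_ideal.add)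

text \<open>Multipliers are unrestricted here; \<open>t4_ideal_iff_U_eq\<close> compares with \<^const>\<open>U_eq\<close>.\<close>
definition t4_ideal :: "nat \<Rightarrow> (tgen, 'k::field_char_0) ncs set"
  where "t4_ideal N = nc_closure (nc_ideal UNIV (trels 4 N))"

lemma t4_ideal_0: "0 \<in> t4_ideal N"
  unfolding t4_ideal_def nc_closure_iff by (auto intro!: bexI[of _ 0] nc_ideal.zero simp: nc_deg_def)

lemma t4_ideal_add:
  assumes "f \<in> t4_ideal N" "g \<in> t4_ideal N" shows "f + g \<in> t4_ideal N"
  unfolding t4_ideal_def nc_closure_iff
proof
  fix d
  obtain f' g' where fg: "f' \<in> nc_ideal UNIV (trels 4 N)" "f - f' \<in> nc_deg d" "g' \<in> nc_ideal UNIV (trels 4 N)" "g - g' \<in> nc_deg d"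
    using assms unfolding t4_ideal_def nc_closure_iff by meson
  then have "f + g - (f' + g') \<in> nc_deg d"
    unfolding add_diff_add by (intro ncs.fil_add)
  then show "\<exists>e\<in>nc_ideal UNIV (trels 4 N). f + g - e \<in> nc_deg d"
    using nc_ideal.add[OF fg(1,3)] by blast
qed

lemma t4_ideal_mult:
  assumes "f \<in> t4_ideal N" shows "e * f \<in> t4_ideal N" "f * e \<in> t4_ideal N"
proof -
  have "(\<exists>f'\<in>nc_ideal UNIV (trels 4 N). e * f - f' \<in> nc_deg d) \<and> (\<exists>f'\<in>nc_ideal UNIV (trels 4 N). f * e - f' \<in> nc_deg d)" for d
  proof -
    obtain f' where f: "f' \<in> nc_ideal UNIV (trels 4 N)" "f - f' \<in> nc_deg d"
      using assms unfolding t4_ideal_def nc_closure_iff by meson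
    have "e * f - e * f' \<in> nc_deg d" "f * e - f' * e \<in> nc_deg d"
      unfolding right_diff_distrib[symmetric] left_diff_distrib[symmetric]
      by (rule ncs.fil_mult_left[OF f(2)], rule ncs.fil_mult_right[OF f(2)])
    then show ?thesis
      using nc_ideal_mult[OF f(1) nc_over_UNIV[of e]] by blast
  qed
  then show "e * f \<in> t4_ideal N" "f * e \<in> t4_ideal N"
    unfolding t4_ideal_def nc_closure_iff by blast+
qed

lemma t4_ideal_uminus: "f \<in> t4_ideal N \<Longrightarrow> - f \<in> t4_ideal N"
  using t4_ideal_mult(1)[of f N "- 1"] by simp

lemma t4_ideal_diff: "f \<in> t4_ideal N \<Longrightarrow> g \<in> t4_ideal N \<Longrightarrow> f - g \<in> t4_ideal N"
  using t4_ideal_add[of f N "- g"] by (simp add: t4_ideal_uminus)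

lemma t4_ideal_cong_diff:
  assumes "f - f' \<in> t4_ideal N" "g - g' \<in> t4_ideal N" shows "f - g - (f' - g') \<in> t4_ideal N"
proof -
  have "f - g - (f' - g') = (f - f') - (g - g')" by simp
  then show ?thesis using t4_ideal_diff[OF assms] by (simp only:)
qed

lemma t4_ideal_cong_mult:
  assumes "f - f' \<in> t4_ideal N" "g - g' \<in> t4_ideal N" shows "f * g - f' * g' \<in> t4_ideal N"
proof -
  have "f * g - f' * g' = (f - f') * g + f' * (g - g')" by (simp add: algebra_simps)
  then show ?thesis using t4_ideal_add[OF t4_ideal_mult(2)[OF assms(1)] t4_ideal_mult(1)[OF assms(2)]] by (simp only:)
qed

lemma t4_ideal_closed:
  assumes "\<And>d. \<exists>g\<in>t4_ideal N. f - g \<in> nc_deg d" shows "f \<in> t4_ideal N"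
  unfolding t4_ideal_def nc_closure_iff
proof
  fix d
  obtain g where g: "g \<in> t4_ideal N" "f - g \<in> nc_deg d" using assms by meson
  then obtain e where e: "e \<in> nc_ideal UNIV (trels 4 N)" "g - e \<in> nc_deg d"
    unfolding t4_ideal_def nc_closure_iff by meson
  then show "\<exists>e\<in>nc_ideal UNIV (trels 4 N). f - e \<in> nc_deg d"
    using ncs.fil_diff_trans[OF g(2) e(2)] by blast
qed

lemma trels_t4_ideal: "r \<in> trels 4 N \<Longrightarrow> r \<in> t4_ideal N"
  unfolding t4_ideal_def nc_closure_iff
  using nc_ideal.gen[of r "trels 4 N" 1 UNIV 1] by (auto intro!: bexI[of _ r] simp: nc_deg_def)

text \<open>No relation has a constant term, and linear terms occur only in the relations t(a)^{ij}
  = t(-a)^{ji}. So these coefficients descend to the quotient: the first keeps it from collapsing,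
  the second detects the coefficient of \<open>A\<close> in \<open>h\<close>.\<close>

lemma t4_ideal_coeff:
  assumes "f \<in> t4_ideal N" shows "nc_coeff f [] = 0" "nc_coeff f [T1 i] = 0"
proof -
  have r: "nc_coeff r [] = 0 \<and> nc_coeff r [T1 i] = 0" if "r \<in> trels 4 N" for r :: "(tgen, 'a) ncs"
    using that unfolding trels_def
    by (elim UnE CollectE exE conjE)
      (simp_all add: nc_lie_def nc_coeff_mult_Nil nc_coeff_mult_single t1_def tt_def ttsum_def nc_coeff_sum nc_coeff_var)
  have I: "nc_coeff e [] = 0 \<and> nc_coeff e [T1 i] = 0" if "e \<in> nc_ideal UNIV (trels 4 N)" for e :: "(tgen, 'a) ncs"
    using that by (induction rule: nc_ideal.induct) (auto simp: r nc_coeff_mult_Nil nc_coeff_mult_single)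
  obtain e where "e \<in> nc_ideal UNIV (trels 4 N)" "f - e \<in> nc_deg 2"
    using assms unfolding t4_ideal_def nc_closure_iff by meson
  then show "nc_coeff f [] = 0" "nc_coeff f [T1 i] = 0"
    using I nc_degD[of "f - e" 2 "[]"] nc_degD[of "f - e" 2 "[T1 i]"] by auto
qed

lemma nc_restrict_deg: "f \<in> nc_deg d \<Longrightarrow> nc_restrict X f \<in> nc_deg d"
  by (simp add: nc_deg_def nc_coeff_restrict)

text \<open>Restriction to the letters in \<open>tgens 4 N\<close> fixes the relations and maps all
  multipliers into the alphabet, so larger multipliers yield no new identities between series in
  these letters.\<close>

lemma t4_ideal_iff_U_eq:
  assumes N: "N \<ge> 1" and "f \<in> nc_over (tgens 4 N)" "g \<in> nc_over (tgens 4 N)"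
  shows "f - g \<in> t4_ideal N \<longleftrightarrow> U_eq 4 N f g"
proof
  have "nc_ideal (tgens 4 N) (trels 4 N) \<subseteq> nc_ideal UNIV (trels 4 N)"
  proof
    fix e assume "e \<in> nc_ideal (tgens 4 N) (trels 4 N)"
    then show "e \<in> nc_ideal UNIV (trels 4 N)"
      by (induction rule: nc_ideal.induct) (auto intro: nc_ideal.intros)
  qed
  then show "U_eq 4 N f g \<Longrightarrow> f - g \<in> t4_ideal N"
    unfolding U_eq_def t4_ideal_def nc_closure_iff by blast
  have R: "nc_restrict (tgens 4 N) e \<in> nc_ideal (tgens 4 N) (trels 4 N)" if "e \<in> nc_ideal UNIV (trels 4 N)" for e
    using that
  proof (induction rule: nc_ideal.induct)
    case (gen r p q)
    then show ?case
      using trels_over[OF N gen(1)] by (simp add: nc_restrict_mult nc_restrict_id nc_ideal.gen)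
  next
    case zero
    then show ?case using nc_restrict_id[OF nc_over_zero] nc_ideal.zero by metis
  qed (simp add: nc_restrict_add nc_ideal.add)
  show "U_eq 4 N f g" if "f - g \<in> t4_ideal N"
    unfolding U_eq_def nc_closure_iff
  proof
    fix d
    obtain e where e: "e \<in> nc_ideal UNIV (trels 4 N)" "f - g - e \<in> nc_deg d"
      using \<open>f - g \<in> t4_ideal N\<close> unfolding t4_ideal_def nc_closure_iff by meson
    have "nc_restrict (tgens 4 N) (f - g) = nc_restrict (tgens 4 N) (f - g - e) + nc_restrict (tgens 4 N) e"
      by (simp flip: nc_restrict_add)
    then have "f - g = nc_restrict (tgens 4 N) (f - g - e) + nc_restrict (tgens 4 N) e"
      unfolding nc_restrict_id[OF nc_over_diff[OF assms(2,3)]] .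
    from arg_cong[OF this, of "\<lambda>z. z - nc_restrict (tgens 4 N) e"]
    have "f - g - nc_restrict (tgens 4 N) e = nc_restrict (tgens 4 N) (f - g - e)"
      unfolding add_diff_cancel_right' .
    then show "\<exists>e\<in>nc_ideal (tgens 4 N) (trels 4 N). f - g - e \<in> nc_deg d"
      using R[OF e(1)] nc_restrict_deg[OF e(2)] by metis
  qed
qed

text \<open>A type cannot depend on \<open>N\<close>, so the quotients for all \<open>N\<close> are collected in one product ring.\<close>
quotient_type (overloaded) 'k t4_ring = "nat \<Rightarrow> (tgen, 'k::field_char_0) ncs" / "\<lambda>F G. \<forall>N. F N - G N \<in> t4_ideal N"
proof (rule equivpI)
  show "reflp (\<lambda>F G :: nat \<Rightarrow> (tgen, 'k) ncs. \<forall>N. F N - G N \<in> t4_ideal N)"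
    by (simp add: reflp_def t4_ideal_0)
  show "symp (\<lambda>F G :: nat \<Rightarrow> (tgen, 'k) ncs. \<forall>N. F N - G N \<in> t4_ideal N)"
  proof (intro sympI allI)
    fix F G :: "nat \<Rightarrow> (tgen, 'k) ncs" and N assume "\<forall>N. F N - G N \<in> t4_ideal N"
    then show "G N - F N \<in> t4_ideal N" using t4_ideal_uminus[of "F N - G N" N] by simp
  qed
  show "transp (\<lambda>F G :: nat \<Rightarrow> (tgen, 'k) ncs. \<forall>N. F N - G N \<in> t4_ideal N)"
  proof (intro transpI allI)
    fix F G H :: "nat \<Rightarrow> (tgen, 'k) ncs" and N
    assume "\<forall>N. F N - G N \<in> t4_ideal N" "\<forall>N. G N - H N \<in> t4_ideal N"
    then show "F N - H N \<in> t4_ideal N" using t4_ideal_add[of "F N - G N" N "G N - H N"] by simp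
  qed
qed

instantiation t4_ring :: (field_char_0) ring_1
begin

lift_definition zero_t4_ring :: "'a t4_ring" is "\<lambda>_. 0" .
lift_definition one_t4_ring :: "'a t4_ring" is "\<lambda>_. 1" .
lift_definition plus_t4_ring :: "'a t4_ring \<Rightarrow> 'a t4_ring \<Rightarrow> 'a t4_ring" is "\<lambda>F G N. F N + G N"
  by (simp add: add_diff_add t4_ideal_add)
lift_definition uminus_t4_ring :: "'a t4_ring \<Rightarrow> 'a t4_ring" is "\<lambda>F N. - F N"
  using t4_ideal_uminus by force
lift_definition minus_t4_ring :: "'a t4_ring \<Rightarrow> 'a t4_ring \<Rightarrow> 'a t4_ring" is "\<lambda>F G N. F N - G N"
  by (rule t4_ideal_cong_diff)
lift_definition times_t4_ring :: "'a t4_ring \<Rightarrow> 'a t4_ring \<Rightarrow> 'a t4_ring" is "\<lambda>F G N. F N * G N"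
  by (rule t4_ideal_cong_mult)

instance
proof
  show "(0 :: 'a t4_ring) \<noteq> 1"
  proof (transfer, rule notI)
    assume "\<forall>N. (0 :: (tgen, 'a) ncs) - 1 \<in> t4_ideal N"
    then have "nc_coeff ((0 :: (tgen, 'a) ncs) - 1) [] = 0" using t4_ideal_coeff(1) by blast
    then show False by (simp add: nc_coeff_one)
  qed
qed (transfer; simp add: t4_ideal_0 algebra_simps)+

end

text \<open>The quotient filtration. It separates points because the ideals are closed, and Cauchy
  sums converge because their terms lift to series of the same degree.\<close>

definition t4_fil :: "nat \<Rightarrow> 'k::field_char_0 t4_ring set"
  where "t4_fil n = {z. \<exists>F. z = abs_t4_ring F \<and> (\<forall>N. F N \<in> nc_deg n)}"

lemma abs_t4_ring_eq_iff: "abs_t4_ring F = abs_t4_ring G \<longleftrightarrow> (\<forall>N. F N - G N \<in> t4_ideal N)"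
  by (rule t4_ring.abs_eq_iff)

lemma abs_t4_ring_surj: "\<exists>F. z = abs_t4_ring F"
  by (induct z rule: t4_ring.abs_induct) auto

lemma abs_t4_ring_sum: "(\<Sum>n<(m::nat). abs_t4_ring (F n)) = abs_t4_ring (\<lambda>N. \<Sum>n<m. F n N)"
  by (induction m) (simp_all add: zero_t4_ring.abs_eq plus_t4_ring.abs_eq)

interpretation t4: complete_filtered_algebra
  "t4_fil :: nat \<Rightarrow> 'k::field_char_0 t4_ring set" "\<lambda>c. abs_t4_ring (\<lambda>_. nc_const c)"
proof
  fix z :: "'k t4_ring" and n
  obtain F where F: "z = abs_t4_ring F" using abs_t4_ring_surj by blast
  show "z \<in> t4_fil 0"
    unfolding t4_fil_def mem_Collect_eq using F by (intro exI[of _ F]) simp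
  show "z \<in> t4_fil (Suc n) \<Longrightarrow> z \<in> t4_fil n"
    unfolding t4_fil_def mem_Collect_eq using ncs.fil_Suc by blast
  show "0 \<in> (t4_fil n :: 'k t4_ring set)"
    unfolding t4_fil_def mem_Collect_eq by (intro exI[of _ "\<lambda>_. 0"]) (simp add: zero_t4_ring.abs_eq)
  show "z = 0" if *: "\<And>n. z \<in> t4_fil n"
  proof -
    have "F N \<in> t4_ideal N" for N
    proof (rule t4_ideal_closed)
      fix d
      obtain G where G: "z = abs_t4_ring G" "\<And>N. G N \<in> nc_deg d"
        using *[of d] unfolding t4_fil_def mem_Collect_eq by blast
      then have "F N - G N \<in> t4_ideal N" using F abs_t4_ring_eq_iff by metis
      moreover have "F N - (F N - G N) \<in> nc_deg d" using G(2)[of N] by simp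
      ultimately show "\<exists>g\<in>t4_ideal N. F N - g \<in> nc_deg d" by (rule rev_bexI)
    qed
    then show ?thesis unfolding F zero_t4_ring.abs_eq abs_t4_ring_eq_iff by simp
  qed
next
  fix z z' :: "'k t4_ring" and n
  assume "z \<in> t4_fil n" "z' \<in> t4_fil n"
  then obtain F G where "z = abs_t4_ring F" "\<And>N. F N \<in> nc_deg n" "z' = abs_t4_ring G" "\<And>N. G N \<in> nc_deg n"
    unfolding t4_fil_def mem_Collect_eq by blast
  then show "z + z' \<in> t4_fil n"
    unfolding t4_fil_def mem_Collect_eq
    by (intro exI[of _ "\<lambda>N. F N + G N"]) (simp add: plus_t4_ring.abs_eq)
next
  fix z z' :: "'k t4_ring" and m n
  assume "z \<in> t4_fil m" "z' \<in> t4_fil n"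
  then obtain F G where "z = abs_t4_ring F" "\<And>N. F N \<in> nc_deg m" "z' = abs_t4_ring G" "\<And>N. G N \<in> nc_deg n"
    unfolding t4_fil_def mem_Collect_eq by blast
  then show "z * z' \<in> t4_fil (m + n)"
    unfolding t4_fil_def mem_Collect_eq
    by (intro exI[of _ "\<lambda>N. F N * G N"]) (simp add: times_t4_ring.abs_eq nc_deg_mult)
next
  fix u :: "nat \<Rightarrow> 'k t4_ring" assume "\<And>n. u n \<in> t4_fil n"
  then have "\<forall>n. \<exists>F. u n = abs_t4_ring F \<and> (\<forall>N. F N \<in> nc_deg n)"
    unfolding t4_fil_def by blast
  then obtain F where F: "\<And>n. u n = abs_t4_ring (F n)" "\<And>n N. F n N \<in> nc_deg n" by metis
  have "\<forall>N. \<exists>s. \<forall>m. s - (\<Sum>n<m. F n N) \<in> nc_deg m"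
    by (intro allI ncs.fil_complete F(2))
  then obtain s where s: "\<And>N m. s N - (\<Sum>n<m. F n N) \<in> nc_deg m" by metis
  have "abs_t4_ring s - (\<Sum>n<m. u n) \<in> t4_fil m" for m
    unfolding F(1) abs_t4_ring_sum minus_t4_ring.abs_eq t4_fil_def mem_Collect_eq using s by blast
  then show "\<exists>s. \<forall>m. s - (\<Sum>n<m. u n) \<in> t4_fil m" by blast
next
  fix a and z :: "'k t4_ring"
  obtain F where "z = abs_t4_ring F" using abs_t4_ring_surj by blast
  then show "abs_t4_ring (\<lambda>_. nc_const a) * z = z * abs_t4_ring (\<lambda>_. nc_const a)"
    by (simp add: times_t4_ring.abs_eq ncs.sc_central)
qed (simp_all add: zero_t4_ring.abs_eq one_t4_ring.abs_eq plus_t4_ring.abs_eq times_t4_ring.abs_eq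
    nc_const_add nc_const_mult)

text \<open>Embedding of the \<open>N\<close>-th factor, made unital by keeping the constant term in the others.\<close>
definition t4_class :: "nat \<Rightarrow> (tgen, 'k::field_char_0) ncs \<Rightarrow> 'k t4_ring"
  where "t4_class N f = abs_t4_ring (\<lambda>M. if M = N then f else nc_const (nc_coeff f []))"

lemma t4_class_eq_iff: "t4_class N f = t4_class N g \<longleftrightarrow> f - g \<in> t4_ideal N"
proof
  assume "t4_class N f = t4_class N g"
  then show "f - g \<in> t4_ideal N"
    unfolding t4_class_def abs_t4_ring_eq_iff by (auto dest: spec[of _ N])
next
  assume fg: "f - g \<in> t4_ideal N"
  then have "nc_coeff f [] = nc_coeff g []" using t4_ideal_coeff(1)[OF fg] by simp
  then show "t4_class N f = t4_class N g"
    unfolding t4_class_def abs_t4_ring_eq_iff using fg by (simp add: t4_ideal_0)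
qed

lemma continuous_hom_t4_class: "t4.continuous_hom X (t4_class N)"
  unfolding t4.continuous_hom_def
proof (intro conjI ballI allI impI)
  fix f g :: "(tgen, 'a) ncs"
  show "t4_class N (f + g) = t4_class N f + t4_class N g"
    unfolding t4_class_def plus_t4_ring.abs_eq by (intro arg_cong[of _ _ abs_t4_ring]) (auto simp: nc_const_add)
  show "t4_class N (f * g) = t4_class N f * t4_class N g"
    unfolding t4_class_def times_t4_ring.abs_eq
    by (intro arg_cong[of _ _ abs_t4_ring]) (auto simp: nc_const_mult nc_coeff_mult_Nil)
next
  fix c :: 'a
  show "t4_class N (nc_const c) = abs_t4_ring (\<lambda>_. nc_const c)"
    unfolding t4_class_def by (intro arg_cong[of _ _ abs_t4_ring]) (auto simp: nc_coeff_const)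
next
  fix m and f :: "(tgen, 'a) ncs" assume f: "f \<in> nc_deg m"
  have "(nc_const (nc_coeff f []) :: (tgen, 'a) ncs) \<in> nc_deg m"
    using nc_degD[OF f, of "[]"] by (cases m) (auto simp: nc_deg_def)
  then show "t4_class N f \<in> t4_fil m"
    unfolding t4_class_def t4_fil_def mem_Collect_eq using f
    by (intro exI[of _ "\<lambda>M. if M = N then f else nc_const (nc_coeff f [])"]) simp
qed

lemma t4_class_add: "t4_class N (f + g) = t4_class N f + t4_class N g"
  and t4_class_diff: "t4_class N (f - g) = t4_class N f - t4_class N g"
  and t4_class_mult: "t4_class N (f * g) = t4_class N f * t4_class N g"
  by (rule t4.chom_add[OF continuous_hom_t4_class[of UNIV]] t4.chom_diff[OF continuous_hom_t4_class[of UNIV]]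
      t4.chom_mult[OF continuous_hom_t4_class[of UNIV]]; simp)+

lemma t4_class_0: "t4_class N 0 = 0"
  by (rule t4.chom_0[OF continuous_hom_t4_class[of UNIV]])

lemma t4_class_ttsum: "t4_class N (ttsum N i j) = isum N (\<lambda>a. t4_class N (tt N a i j))"
  unfolding ttsum_def by (rule t4.chom_sum[OF continuous_hom_t4_class[of UNIV]]) simp

lemma commutes_sum_shift:
  assumes N: "N \<ge> 1" "periodic N A" and c: "\<And>r. commutes z (A (r + s) + B r)"
  shows "commutes z (isum N A + isum N B)"
proof -
  have "commutes z (\<Sum>r\<in>{0..<int N}. A (r + s) + B r)" by (intro commutes_sum c)
  then show ?thesis by (simp add: sum.distrib sum_periodic_shift[OF N(2,1)])
qed

context level
begin

lemma t4_class_rel: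
  "f \<in> trels 4 N \<Longrightarrow> t4_class N f = 0"
  using t4_class_eq_iff[of N f 0] trels_t4_ideal[of f N] by (simp add: t4_class_0)

lemma t4_class_commutes:
  assumes "nc_lie f g \<in> trels 4 N" shows "commutes (t4_class N f) (t4_class N g)"
  using t4_class_rel[OF assms] by (simp add: nc_lie_def commutes_def t4_class_diff t4_class_mult)

sublocale t4: algebra_level "t4_fil :: nat \<Rightarrow> 'k::field_char_0 t4_ring set" "\<lambda>c. abs_t4_ring (\<lambda>_. nc_const c)" N
  by unfold_locales

abbreviation "cx i \<equiv> t4_class N (t1 i)"
abbreviation "ct i j \<equiv> \<lambda>a. t4_class N (tt N a i j)"

lemma ct_swap: "i \<in> {2..4} \<Longrightarrow> j \<in> {2..4} \<Longrightarrow> i \<noteq> j \<Longrightarrow> ct i j a = ct j i (- a)"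
proof -
  assume ij: "i \<in> {2..4}" "j \<in> {2..4}" "i \<noteq> j"
  have "tt N a i j - tt N (- a) j i \<in> trels 4 N"
    unfolding trels_def
    by (intro UnI1 CollectI, rule exI[of _ a], rule exI[of _ i], rule exI[of _ j]) (use ij in simp)
  from t4_class_rel[OF this] show ?thesis by (simp add: t4_class_diff)
qed

lemma periodic_ct [simp]: "periodic N (ct i j)"
  by (simp add: periodic_def tt_mod)

lemma ct_relations:
  assumes ij: "i \<in> {2..4}" "j \<in> {2..4}" "i \<noteq> j"
  shows "commutes (cx i + cx j + isum N (ct i j)) (ct i j a)"
    and "commutes (cx i) (cx j + isum N (ct i j))"
    and "k \<in> {2..4} \<Longrightarrow> k \<noteq> i \<Longrightarrow> k \<noteq> j \<Longrightarrow> commutes (ct i j a) (ct i k (a + e) + ct j k e)"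
    and "k \<in> {2..4} \<Longrightarrow> k \<noteq> i \<Longrightarrow> k \<noteq> j \<Longrightarrow> commutes (cx i) (ct j k a)"
proof -
  have "nc_lie (t1 i + t1 j + ttsum N i j) (tt N a i j) \<in> trels 4 N" "nc_lie (t1 i) (t1 j + ttsum N i j) \<in> trels 4 N"
     apply (unfold trels_def)
     apply (rule UnI1, rule UnI1, rule UnI1, rule UnI2, rule CollectI, rule exI[of _ a], rule exI[of _ i], rule exI[of _ j])
    subgoal using ij by simp
    apply (rule UnI1, rule UnI1, rule UnI2, rule CollectI, rule exI[of _ i], rule exI[of _ j])
    subgoal using ij by simp
    done
  from this[THEN t4_class_commutes] show "commutes (cx i + cx j + isum N (ct i j)) (ct i j a)"
    "commutes (cx i) (cx j + isum N (ct i j))" by (simp_all only: t4_class_add t4_class_ttsum)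
  assume k: "k \<in> {2..4}" "k \<noteq> i" "k \<noteq> j"
  have "nc_lie (tt N a i j) (tt N (a + e) i k + tt N e j k) \<in> trels 4 N" "nc_lie (t1 i) (tt N a j k) \<in> trels 4 N"
     apply (unfold trels_def)
     apply (rule UnI1, rule UnI1, rule UnI1, rule UnI1, rule UnI2, rule CollectI,
        rule exI[of _ a], rule exI[of _ e], rule exI[of _ i], rule exI[of _ j], rule exI[of _ k])
    subgoal using ij k by simp
    apply (rule UnI1, rule UnI2, rule CollectI,
        rule exI[of _ a], rule exI[of _ i], rule exI[of _ j], rule exI[of _ k])
    subgoal using ij k by simp
    done
  from this[THEN t4_class_commutes] show "commutes (ct i j a) (ct i k (a + e) + ct j k e)"
    "commutes (cx i) (ct j k a)" by (simp_all only: t4_class_add)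
qed

lemma t4_system_class:
  "t4_system t4_fil (\<lambda>c. abs_t4_ring (\<lambda>_. nc_const c)) N (cx 2) (cx 3) (cx 4)
    (ct 2 3) (ct 2 4) (ct 3 4 :: int \<Rightarrow> 'k::field_char_0 t4_ring)"
proof -
  let ?x = "cx 2 :: 'k t4_ring" and ?y = "cx 3 :: 'k t4_ring" and ?w = "cx 4 :: 'k t4_ring"
  let ?b = "ct 2 3 :: int \<Rightarrow> 'k t4_ring" and ?c = "ct 2 4 :: int \<Rightarrow> 'k t4_ring" and ?d = "ct 3 4 :: int \<Rightarrow> 'k t4_ring"
  have r1: "i \<in> {2..4} \<Longrightarrow> j \<in> {2..4} \<Longrightarrow> i \<noteq> j \<Longrightarrow> commutes (cx i + cx j + isum N (ct i j)) (ct i j a :: 'k t4_ring)" for i j a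
    by (rule ct_relations(1))
  have r2: "i \<in> {2..4} \<Longrightarrow> j \<in> {2..4} \<Longrightarrow> i \<noteq> j \<Longrightarrow> commutes (cx i :: 'k t4_ring) (cx j + isum N (ct i j))" for i j
    by (rule ct_relations(2))
  have r3: "i \<in> {2..4} \<Longrightarrow> j \<in> {2..4} \<Longrightarrow> i \<noteq> j \<Longrightarrow> k \<in> {2..4} \<Longrightarrow> k \<noteq> i \<Longrightarrow> k \<noteq> j \<Longrightarrow>
      commutes (ct i j a :: 'k t4_ring) (ct i k (a + e) + ct j k e)" for i j k a e
    by (rule ct_relations(3))
  have r4: "i \<in> {2..4} \<Longrightarrow> j \<in> {2..4} \<Longrightarrow> i \<noteq> j \<Longrightarrow> k \<in> {2..4} \<Longrightarrow> k \<noteq> i \<Longrightarrow> k \<noteq> j \<Longrightarrow>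
      commutes (cx i :: 'k t4_ring) (ct j k a)" for i j k a
    by (rule ct_relations(4))
  have sw: "(ct 3 2 a :: 'k t4_ring) = ?b (- a)" "(ct 4 2 a :: 'k t4_ring) = ?c (- a)" "(ct 4 3 a :: 'k t4_ring) = ?d (- a)" for a
    by (rule ct_swap; simp)+
  have neg: "isum N (\<lambda>a. ?b (- a)) = isum N ?b"
    by (rule sum_periodic_neg[OF periodic_ct N])
  have bcd: "q = p + r \<Longrightarrow> commutes (?b p) (?c q + ?d r)" "q = p + r \<Longrightarrow> commutes (?c q) (?b p + ?d r)"
    "q = p + r \<Longrightarrow> commutes (?d r) (?b p + ?c q)" for p q r
    using r3[of 2 3 4 p r] r3[of 2 4 3 q "- r"] r3[of 3 4 2 r "- q"] by (simp_all add: sw add.commute[of r p])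
  have x_yb: "commutes ?x (?y + isum N ?b)" "commutes ?x (?w + isum N ?c)" "commutes ?y (?w + isum N ?d)"
    by (rule r2; simp)+
  have y_xb: "commutes ?y (?x + isum N ?b)"
    using r2[of 3 2] by (simp add: sw neg)
  have xyb: "commutes (?x + ?y + isum N ?b) (?b a)" "commutes (?x + ?w + isum N ?c) (?c a)"
    "commutes (?y + ?w + isum N ?d) (?d a)" for a
    by (rule r1; simp)+
  have far: "commutes ?x (?d a)" "commutes ?y (?c a)" "commutes ?w (?b a)" for a
    by (rule r4; simp)+
  have s1: "commutes (?b i) (isum N ?c + isum N ?d)" for i
    by (rule commutes_sum_shift[where s = i, OF N periodic_ct]) (rule bcd(1), simp)
  have s2: "commutes (?d i) (isum N ?c + isum N ?b)" for i
    by (rule commutes_sum_shift[where s = i, OF N periodic_ct]) (subst add.commute, rule bcd(3), simp)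
  have s3: "commutes (?c i) (isum N (\<lambda>a. ?b (- a)) + isum N ?d)" for i
    by (rule commutes_sum_shift[where s = "- i", OF N periodic_neg[OF periodic_ct]]) (rule bcd(2), simp)
  \<comment> \<open>Centrality of the total sum is not among the defining relations. For each
    generator the sum is regrouped into blocks that commute with it.\<close>
  let ?Z = "?x + ?y + ?w + isum N ?b + isum N ?c + isum N ?d"
  have "?Z = ?x + (?y + isum N ?b) + (?w + isum N ?c) + isum N ?d" by (simp add: algebra_simps)
  then have Zx: "commutes ?Z ?x"
    using commutes_symI[OF commutes_add[OF commutes_add[OF commutes_add[OF commutes_refl x_yb(1)] x_yb(2)] commutes_sum[OF far(1)]]]
    by (simp only:)
  have "?Z = ?y + (?x + isum N ?b) + (?w + isum N ?d) + isum N ?c" by (simp add: algebra_simps)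
  then have Zy: "commutes ?Z ?y"
    using commutes_symI[OF commutes_add[OF commutes_add[OF commutes_add[OF commutes_refl y_xb] x_yb(3)] commutes_sum[OF far(2)]]]
    by (simp only:)
  have "?Z = (?x + ?y + isum N ?b) + ?w + (isum N ?c + isum N ?d)" by (simp add: algebra_simps)
  then have Zb: "commutes ?Z (?b a)" for a
    using commutes_symI[OF commutes_add[OF commutes_add[OF commutes_symI[OF xyb(1)[of a]] commutes_symI[OF far(3)]] s1]]
    by (simp only:)
  have "?Z = (?x + ?w + isum N ?c) + ?y + (isum N (\<lambda>a. ?b (- a)) + isum N ?d)"
    unfolding neg by (simp add: algebra_simps)
  then have Zc: "commutes ?Z (?c a)" for a
    using commutes_symI[OF commutes_add[OF commutes_add[OF commutes_symI[OF xyb(2)[of a]] commutes_symI[OF far(2)]] s3]]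
    by (simp only:)
  have "?Z = (?y + ?w + isum N ?d) + ?x + (isum N ?c + isum N ?b)" by (simp add: algebra_simps)
  then have Zd: "commutes ?Z (?d a)" for a
    using commutes_symI[OF commutes_add[OF commutes_add[OF commutes_symI[OF xyb(3)[of a]] commutes_symI[OF far(1)]] s2]]
    by (simp only:)
  have f1: "(cx i :: 'k t4_ring) \<in> t4_fil (Suc 0)" "(ct i j a :: 'k t4_ring) \<in> t4_fil (Suc 0)" for i j a
    by (rule t4.chom_deg[OF continuous_hom_t4_class nc_over_UNIV]; simp)+
  show ?thesis
    by unfold_locales (rule f1 periodic_ct bcd xyb(1) x_yb(1) far Zx Zy Zb Zc Zd | assumption)+
qed

end

text \<open>A representative obtained from the filtration of the quotient may contain letters
  outside \<open>tgens 4 N\<close>; this allows it to be replaced by its restriction.\<close>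

lemma nc_restrict_t4_ideal:
  assumes N: "N \<ge> 1" and f: "f \<in> t4_ideal N" shows "nc_restrict (tgens 4 N) f \<in> t4_ideal N"
  unfolding t4_ideal_def nc_closure_iff
proof
  fix d
  have R: "nc_restrict (tgens 4 N) e \<in> nc_ideal UNIV (trels 4 N)" if "e \<in> nc_ideal UNIV (trels 4 N)" for e
    using that
  proof (induction rule: nc_ideal.induct)
    case (gen r p q)
    then show ?case
      using trels_over[OF N gen(1)] by (simp add: nc_restrict_mult nc_restrict_id nc_ideal.gen)
  next
    case zero
    show ?case unfolding nc_restrict_id[OF nc_over_zero] by (rule nc_ideal.zero)
  qed (simp add: nc_restrict_add nc_ideal.add)
  obtain e where e: "e \<in> nc_ideal UNIV (trels 4 N)" "f - e \<in> nc_deg d"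
    using f unfolding t4_ideal_def nc_closure_iff by meson
  have "nc_restrict (tgens 4 N) f - nc_restrict (tgens 4 N) e = nc_restrict (tgens 4 N) (f - e)"
    by (rule ncs_eqI) (simp add: nc_coeff_restrict)
  then show "\<exists>e\<in>nc_ideal UNIV (trels 4 N). nc_restrict (tgens 4 N) f - e \<in> nc_deg d"
    using nc_restrict_deg[OF e(2), of "tgens 4 N"] R[OF e(1)] by (intro bexI[of _ "nc_restrict (tgens 4 N) e"]) (simp_all only:)
qed

section \<open>The group structure\<close>

lemma nc_restrict_diff: "nc_restrict X (f - g) = nc_restrict X f - nc_restrict X g"
  by (rule ncs_eqI) (simp add: nc_coeff_restrict)

context level
begin

lemma t4_class_pentagon:
  fixes g h :: "'k::field_char_0 ab_series"
  assumes "h \<in> exp_t03 N" "g \<in> exp_t03 1"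
  shows "t4_class N (pentagon_left N h) = t4.left_at h (cx 2) (cx 3) (ct 2 3) (ct 2 4) (ct 3 4)"
    and "t4_class N (pentagon_right N g h) = t4.right_at g h (cx 2) (cx 3) (ct 2 3) (ct 2 4) (ct 3 4)"
  by (rule t4.chom_pentagon[OF continuous_hom_t4_class assms])+

lemma mixed_pentagon_iff_class:
  fixes g h :: "'k::field_char_0 ab_series"
  assumes "h \<in> exp_t03 N" "g \<in> exp_t03 1"
  shows "mixed_pentagon N g h \<longleftrightarrow> t4.left_at h (cx 2) (cx 3) (ct 2 3) (ct 2 4) (ct 3 4)
    = t4.right_at g h (cx 2) (cx 3) (ct 2 3) (ct 2 4) (ct 3 4)"
  unfolding mixed_pentagon_iff t4_class_pentagon[OF assms, symmetric] t4_class_eq_iff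
  by (rule t4_ideal_iff_U_eq[OF N pentagon_over[OF assms], symmetric])

theorem mixed_pentagon_twist_mult_iff:
  fixes g g' h h' :: "'k::field_char_0 ab_series"
  assumes g: "GRT_conditions g" and h: "h \<in> exp_t03 N" "nc_coeff h [LA] = 0" "octagon N h" "special_action N h"
    and mixed: "mixed_pentagon N g h" and h': "h' \<in> exp_t03 N" and g': "g' \<in> exp_t03 1"
  shows "mixed_pentagon N (twist_mult 1 g' g) (twist_mult N h' h) \<longleftrightarrow> mixed_pentagon N g' h'"
proof -
  have g1: "g \<in> exp_t03 1" using g by (simp add: GRT_conditions_def)
  interpret u: t4_system t4_fil "\<lambda>c :: 'k. abs_t4_ring (\<lambda>_. nc_const c)" N "cx 2" "cx 3" "cx 4" "ct 2 3" "ct 2 4" "ct 3 4"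
    by (rule t4_system_class)
  interpret tw: twisted_system t4_fil "\<lambda>c :: 'k. abs_t4_ring (\<lambda>_. nc_const c)" N "cx 2" "cx 3" "cx 4" "ct 2 3" "ct 2 4" "ct 3 4" g h
    by unfold_locales (rule g h mixed)+
  interpret s: t4_system t4_fil "\<lambda>c :: 'k. abs_t4_ring (\<lambda>_. nc_const c)" N "cx 2" tw.y' tw.w' tw.b' tw.c' tw.d'
    by (rule tw.twisted)
  let ?f = "pentagon_left N h' - pentagon_right N g' h'"
  note po = pentagon_over[OF h' g']
  have f: "?f \<in> nc_over (tgens 4 N)" by (rule nc_over_diff[OF po])
  \<comment> \<open>Evaluation at the universal system is the class map, so
    \<open>ev_twisted_near\<close> compares evaluation at the transformed system with the class
    itself.\<close>
  have ev_class: "t4.ev u.gen_value r = t4_class N r" if r: "r \<in> nc_over (tgens 4 N)" for r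
  proof (rule t4.chom_ext[OF u.continuous_hom_gen_value continuous_hom_t4_class finite_tgens r])
    fix t assume t: "t \<in> tgens 4 N"
    have three: "m = 2 \<or> m = 3 \<or> m = 4" if "m \<in> {2..4}" for m :: nat
      using that unfolding atLeastAtMost_iff by presburger
    show "t4.ev u.gen_value (nc_var t) = t4_class N (nc_var t)"
    proof (cases t)
      case (T1 i)
      then have "i \<in> {2..4}" using t by (simp add: tgens_def)
      from three[OF this] have "u.gen_value (T1 i) = cx i"
        by (elim disjE) (simp_all only: u.gen_value_simps)
      then show ?thesis using u.ev_t1[of i] by (simp only: T1 t1_def)
    next
      case (T a i j)
      then have ij: "i \<in> {2..4}" "j \<in> {2..4}" "i \<noteq> j" and a: "a mod int N = a"
        using t by (simp_all add: tgens_def)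
      have sw: "(ct 3 2 a :: 'k t4_ring) = ct 2 3 (- a)" "(ct 4 2 a :: 'k t4_ring) = ct 2 4 (- a)"
        "(ct 4 3 a :: 'k t4_ring) = ct 3 4 (- a)"
        by (rule ct_swap; simp)+
      consider "i = 2" "j = 3" | "i = 3" "j = 2" | "i = 2" "j = 4" | "i = 4" "j = 2" | "i = 3" "j = 4" | "i = 4" "j = 3"
        using three[OF ij(1)] three[OF ij(2)] ij(3) by metis
      then have "u.gen_value (T a i j) = ct i j a"
        by cases (simp_all only: u.gen_value_simps sw)
      then show ?thesis using u.ev_tt[of a i j] by (simp only: T tt_def a)
    qed
  qed
  \<comment> \<open>A representative \<open>r\<close> of degree \<open>d\<close> that evaluates to 0
    at the transformed system has a class of degree \<open>d + 1\<close>, since the two evaluations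
    differ only in higher degree. This yields a representative of degree \<open>d + 1\<close>, and
    closedness of the ideal ends the approximation.\<close>
  have inj: "?f \<in> t4_ideal N" if 0: "t4.ev s.gen_value ?f = 0"
  proof (rule t4_ideal_closed)
    have "\<exists>r\<in>nc_over (tgens 4 N). r \<in> nc_deg d \<and> ?f - r \<in> t4_ideal N" for d
    proof (induction d)
      case 0
      show ?case using f by (intro bexI[of _ ?f]) (simp_all add: t4_ideal_0)
    next
      case (Suc d)
      then obtain r where r: "r \<in> nc_over (tgens 4 N)" "r \<in> nc_deg d" "?f - r \<in> t4_ideal N" by blast
      have "U_eq 4 N ?f r" using t4_ideal_iff_U_eq[OF N f r(1)] r(3) by blast
      then have "t4.ev s.gen_value r = 0" using s.ev_U_eq[OF _ f r(1)] 0 by simp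
      then have "- t4_class N r \<in> t4_fil (Suc d)"
        using tw.ev_twisted_near[OF r(1,2)] ev_class[OF r(1)] by simp
      then have "t4_class N r \<in> t4_fil (Suc d)" using t4.fil_uminus by fastforce
      then obtain F where F: "t4_class N r = abs_t4_ring F" "\<And>M. F M \<in> nc_deg (Suc d)"
        unfolding t4_fil_def mem_Collect_eq by blast
      then have "r - F N \<in> t4_ideal N"
        unfolding t4_class_def abs_t4_ring_eq_iff by (auto dest: spec[of _ N])
      from nc_restrict_t4_ideal[OF N this]
      have "r - nc_restrict (tgens 4 N) (F N) \<in> t4_ideal N"
        by (simp add: nc_restrict_diff nc_restrict_id[OF r(1)])
      from t4_ideal_add[OF r(3) this] have "?f - nc_restrict (tgens 4 N) (F N) \<in> t4_ideal N" by simp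
      then show ?case
        using nc_restrict_deg[OF F(2)] by (intro bexI[of _ "nc_restrict (tgens 4 N) (F N)"]) simp_all
    qed
    then show "\<exists>e\<in>t4_ideal N. ?f - e \<in> nc_deg d" for d
      by (metis (no_types, lifting) add_diff_cancel_left' diff_add_cancel)
  qed
  have "mixed_pentagon N (twist_mult 1 g' g) (twist_mult N h' h) \<longleftrightarrow>
      t4.left_at h' (cx 2) tw.y' tw.b' tw.c' tw.d' = t4.right_at g' h' (cx 2) tw.y' tw.b' tw.c' tw.d'"
    unfolding mixed_pentagon_iff_class[OF twist_mult_exp[OF h' h(1)] one.twist_mult_exp[OF g' g1]]
    by (rule tw.pentagon_twist_mult_iff[OF h' g'])
  also have "\<dots> \<longleftrightarrow> mixed_pentagon N g' h'"
  proof
    assume "t4.left_at h' (cx 2) tw.y' tw.b' tw.c' tw.d' = t4.right_at g' h' (cx 2) tw.y' tw.b' tw.c' tw.d'"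
    then have "t4.ev s.gen_value ?f = 0"
      using s.ev_pentagon[OF h' g'] t4.chom_diff[OF s.continuous_hom_gen_value po] by simp
    then show "mixed_pentagon N g' h'"
      unfolding mixed_pentagon_iff t4_ideal_iff_U_eq[OF N po, symmetric] by (rule inj)
  qed (rule s.pentagon_at[OF h' g'])
  finally show ?thesis .
qed

lemma mixed_pentagon_1: "mixed_pentagon N 1 (1 :: 'k::field_char_0 ab_series)"
  unfolding mixed_pentagon_iff_class[OF exp_1 one.exp_1] t4.left_at_def t4.right_at_def t4.hev_def by simp

end

section \<open>Linear coefficients\<close>

lemma nc_coeff_nc_subst_single:
  assumes "finite X" "f \<in> nc_over X" "l0 \<in> X" "\<And>l. l \<in> X \<Longrightarrow> l \<noteq> l0 \<Longrightarrow> nc_coeff (\<phi> l) [t] = 0"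
  shows "nc_coeff (nc_subst \<phi> f) [t] = nc_coeff f [l0] * nc_coeff (\<phi> l0) [t]"
proof -
  let ?S = "{w. nc_coeff f w \<noteq> 0 \<and> length w \<le> length [t]}"
  have "?S \<subseteq> words X 2" using assms(2) by (auto simp: words_def nc_over_def)
  then have fin: "finite ?S" using finite_words[OF assms(1)] finite_subset by blast
  have "nc_coeff f w * nc_coeff (prod_list (map \<phi> w)) [t]
      = (if w = [l0] then nc_coeff f [l0] * nc_coeff (\<phi> l0) [t] else 0)" if w: "w \<in> ?S" for w
  proof (cases w)
    case (Cons l v)
    then have v: "w = [l]" using w by simp
    then have "l \<in> X" using w assms(2) by (auto simp: nc_over_def)
    then show ?thesis using assms(4)[of l] by (auto simp: v)
  qed (simp add: nc_coeff_one)
  then have "nc_coeff (nc_subst \<phi> f) [t] = (\<Sum>w\<in>?S. if w = [l0] then nc_coeff f [l0] * nc_coeff (\<phi> l0) [t] else 0)"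
    unfolding nc_subst_def nc_coeff_Abs by (intro sum.cong refl)
  also have "\<dots> = nc_coeff f [l0] * nc_coeff (\<phi> l0) [t]"
    by (subst sum.delta[OF fin]) auto
  finally show ?thesis .
qed

lemma nc_coeff_hsub_LA:
  assumes "f \<in> nc_over (ab_letters N)" "\<And>i. nc_coeff (Y i) [t] = 0"
  shows "nc_coeff (hsub f X Y) [t] = nc_coeff f [LA] * nc_coeff X [t]"
  unfolding hsub_eq_nc_subst
  by (subst nc_coeff_nc_subst_single[OF finite_ab_letters assms(1) LA_in_ab_letters])
     (use assms(2) in \<open>auto simp: ab_assign_def split: ab.splits\<close>)

lemma nc_coeff_hsub_Nil: "nc_coeff (hsub f X Y) [] = nc_coeff f []"
  by (simp add: hsub_eq_nc_subst nc_coeff_nc_subst_Nil)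

lemma U_eq_coeff:
  assumes "N \<ge> 1" "U_eq 4 N f g" "f \<in> nc_over (tgens 4 N)" "g \<in> nc_over (tgens 4 N)"
  shows "nc_coeff f [T1 i] = nc_coeff (g :: (tgen, 'k::field_char_0) ncs) [T1 i]"
  using t4_ideal_iff_U_eq[OF assms(1,3,4)] assms(2) t4_ideal_coeff(2)[of "f - g" N i] by simp

lemma t_coeff: "nc_coeff (t1 i) [T1 j] = (if i = j then 1 else 0)" "nc_coeff (tt N a i' j') [T1 j] = 0"
    "nc_coeff (ttsum N i' j') [T1 j] = 0"
  by (auto simp: t1_def tt_def ttsum_def nc_coeff_sum nc_coeff_var)

context level
begin

text \<open>Compare the coefficients of t^{12}: it enters the first argument of one factor on the
  left and of two factors on the right, so the coefficient of \<open>A\<close> equals its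
  double.\<close>

lemma mixed_pentagon_LA:
  fixes g h :: "'k::field_char_0 ab_series"
  assumes h: "h \<in> exp_t03 N" and g: "g \<in> exp_t03 1" and "mixed_pentagon N g h"
  shows "nc_coeff h [LA] = 0"
proof -
  have "nc_coeff (pentagon_left N h) [T1 2] = nc_coeff (pentagon_right N g h) [T1 2]"
    using assms(3) unfolding mixed_pentagon_iff by (rule U_eq_coeff[OF N _ pentagon_over[OF h g]])
  then show ?thesis
    unfolding pentagon_left_def pentagon_right_def gsub_def
    by (simp add: nc_coeff_mult_single nc_coeff_mult_Nil nc_coeff_hsub_Nil h one.exp_Nil[OF g] t_coeff
        nc_coeff_hsub_LA[OF exp_over[OF h]] nc_coeff_hsub_LA[OF one.exp_over[OF g]])
qed

text \<open>Conjugation by a series with constant term 1 leaves linear terms alone, so this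
  coefficient is an additive character of the group, and its vanishing cuts out the kernel.\<close>

lemma nc_coeff_twist_mult_LB:
  fixes f h :: "'k::field_char_0 ab_series"
  assumes f: "f \<in> exp_t03 N" and h: "h \<in> exp_t03 N"
  shows "nc_coeff (twist_mult N f h) [LB 0] = nc_coeff h [LB 0] + nc_coeff f [LB 0]"
proof -
  have ad: "nc_coeff (ad u x) [t] = nc_coeff x [t]" if "u \<in> exp_t03 N" "nc_coeff x [] = 0" for u x :: "'k ab_series" and t
    using that exp_rinv[OF that(1)] by (simp add: ad_def nc_coeff_mult_single nc_coeff_mult_Nil)
  have B: "nc_coeff (sB N i :: 'k ab_series) [] = 0" "nc_coeff (sB N 0 :: 'k ab_series) [LB 0] = 1"
    "0 \<le> i \<Longrightarrow> i < int N \<Longrightarrow> nc_coeff (sB N i :: 'k ab_series) [LB 0] = (if i = 0 then 1 else 0)" for i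
    by (auto simp: sB_def nc_coeff_var)
  have "nc_coeff (twist N h f) [LB 0] = nc_coeff f [LB 0] *
      nc_coeff (ab_assign sA (\<lambda>i. ad (tau N i (rinv h)) (sB N i)) (LB 0)) [LB 0]"
    unfolding twist_eq hsub_eq_nc_subst
    by (rule nc_coeff_nc_subst_single[OF finite_ab_letters exp_over[OF f]])
       (use N in \<open>auto simp: ab_assign_def ad tau_exp exp_rinv h B sA_def nc_coeff_var split: ab.splits if_splits\<close>)
  then show ?thesis
    using f h by (simp add: twist_mult_def nc_coeff_mult_single ad tau_exp exp_rinv B twist_exp)
qed

end

text \<open>In g(A,B) g(B,A) = 1 the coefficient of \<open>B\<close> is the sum of the two linear
  coefficients of \<open>g\<close>.\<close>

lemma two_cycle_LB:
  fixes g :: "'k::field_char_0 ab_series"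
  assumes g: "g \<in> exp_t03 1" and tc: "two_cycle g" and A: "nc_coeff g [LA] = 0"
  shows "nc_coeff g [LB 0] = 0"
proof -
  have "nc_coeff (g * swap_AB g) [LB 0] = 0"
    using tc g by (simp add: two_cycle_def nc_coeff_one)
  moreover have "nc_coeff (swap_AB g) [LB 0] = nc_coeff g [LA] * nc_coeff (sB 1 0 :: 'k ab_series) [LB 0]"
    unfolding swap_AB_def by (rule nc_coeff_hsub_LA[OF one.exp_over[OF g]]) (simp add: sA_def nc_coeff_var)
  ultimately show ?thesis
    using A g one.exp_Nil[OF swap_AB_exp[OF g]] by (simp add: nc_coeff_mult_single)
qed

text \<open>The middle factor on the right has first argument t^{12} + t^{13} in GRT_1 and t^{12} +
  t^{13} + t^{23} in the mixed pentagon. The extra t^{23} commutes with both arguments, and the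
  vanishing coefficient of \<open>A\<close> absorbs it.\<close>

lemma GRT1_iff_mixed:
  fixes g :: "'k::field_char_0 ab_series"
  shows "g \<in> GRT1 \<longleftrightarrow> g \<in> exp_t03 1 \<and> two_cycle g \<and> hexagon g \<and> special_action 1 g \<and> mixed_pentagon 1 g g"
proof -
  let ?l = "pentagon_left 1 g" and ?r = "gsub g (tt 1 0 2 3) (tt 1 0 3 4) * gsub g (t1 2 + t1 3) (tt 1 0 2 4 + tt 1 0 3 4) *
      gsub g (t1 2) (tt 1 0 2 3)"
  have tt: "tt 1 a i j = (tt 1 0 i j :: (tgen, 'k) ncs)" for a i j by (simp add: tt_def)
  have ts: "ttsum 1 i j = (tt 1 0 i j :: (tgen, 'k) ncs)" for i j by (simp add: ttsum_def int_upto_one)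
  have fn: "(\<lambda>a. tt 1 a 2 3 + tt 1 a 2 4) = (\<lambda>_. tt 1 0 2 3 + tt 1 0 2 4 :: (tgen, 'k) ncs)"
    "(\<lambda>a. tt 1 a 3 4) = (\<lambda>_. tt 1 0 3 4 :: (tgen, 'k) ncs)" "(\<lambda>a. tt 1 a 2 3) = (\<lambda>_. tt 1 0 2 3 :: (tgen, 'k) ncs)"
    "(\<lambda>a. tt 1 a 2 4 + tt 1 a 3 4) = (\<lambda>_. tt 1 0 2 4 + tt 1 0 3 4 :: (tgen, 'k) ncs)"
    by (simp_all add: fun_eq_iff tt_def)
  have l: "gsub g (t1 2) (tt 1 0 2 3 + tt 1 0 2 4) * gsub g (t1 3 + tt 1 0 2 3) (tt 1 0 3 4) = ?l"
    unfolding pentagon_left_def gsub_def ts fn ..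
  have over: "?l \<in> nc_over (tgens 4 1)" "?r \<in> nc_over (tgens 4 1)" if g: "g \<in> exp_t03 1"
    using one.pentagon_over(1)[OF g g] one.exp_over[OF g] unfolding gsub_def
    by (auto intro!: nc_over_mult hsub_over[of g 1] nc_over_add one.t_over)
  have main: "U_eq 4 1 ?l ?r \<longleftrightarrow> mixed_pentagon 1 g g" if g: "g \<in> exp_t03 1" and A: "nc_coeff g [LA] = 0"
  proof -
    interpret u: t4_system t4_fil "\<lambda>c :: 'k. abs_t4_ring (\<lambda>_. nc_const c)" 1 "t4_class 1 (t1 2)" "t4_class 1 (t1 3)"
      "t4_class 1 (t1 4)" "\<lambda>a. t4_class 1 (tt 1 a 2 3)" "\<lambda>a. t4_class 1 (tt 1 a 2 4)" "\<lambda>a. t4_class 1 (tt 1 a 3 4)"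
      by (rule one.t4_system_class)
    let ?z = "t4_class 1 (tt 1 0 2 3) :: 'k t4_ring"
    have z: "commutes ?z (t4_class 1 (t1 2) + t4_class 1 (t1 3))"
      using u.xyb[of 0] by (simp add: int_upto_one commutes_def distrib_left distrib_right)
    have z': "commutes ?z (t4_class 1 (tt 1 0 2 4) + t4_class 1 (tt 1 0 3 4))"
      by (rule u.bcd(1)) simp
    note e = t4.chom_hsub[OF one.exp_over[OF g] continuous_hom_t4_class[of UNIV]]
    have "t4_class 1 (hsub g (t1 2 + t1 3 + tt 1 0 2 3) (\<lambda>_. tt 1 0 2 4 + tt 1 0 3 4))
        = t4_class 1 (hsub g (t1 2 + t1 3) (\<lambda>_. tt 1 0 2 4 + tt 1 0 3 4))"
      by (simp add: e t4_class_add) (rule one.t4.hev_add_commuting; simp add: g A z z' t4.fil_add)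
    then have "t4_class 1 (pentagon_right 1 g g) = t4_class 1 ?r"
      unfolding pentagon_right_def gsub_def ts fn t4_class_mult by simp
    then have "t4_class 1 ?l = t4_class 1 ?r \<longleftrightarrow> t4_class 1 ?l = t4_class 1 (pentagon_right 1 g g)"
      by simp
    then show ?thesis
      unfolding t4_class_eq_iff mixed_pentagon_iff
      using t4_ideal_iff_U_eq[OF order_refl over[OF g]] t4_ideal_iff_U_eq[OF order_refl one.pentagon_over[OF g g]] by blast
  qed
  \<comment> \<open>Here the vanishing has to be read off from the GRT_1 form of the pentagon, since
    the passage to the mixed form already uses it.\<close>
  have A: "nc_coeff g [LA] = 0" if g: "g \<in> exp_t03 1" and U: "U_eq 4 1 ?l ?r"
  proof -
    have "nc_coeff ?l [T1 2] = nc_coeff ?r [T1 2]"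
      by (rule U_eq_coeff[OF order_refl U over[OF g]])
    then show ?thesis
      unfolding pentagon_left_def gsub_def
      by (simp add: nc_coeff_mult_single nc_coeff_mult_Nil nc_coeff_hsub_Nil one.exp_Nil[OF g] t_coeff
          nc_coeff_hsub_LA[OF one.exp_over[OF g]])
  qed
  show ?thesis
    unfolding GRT1_iff l using main A one.mixed_pentagon_LA by blast
qed

lemma GRT1_conditions: "g \<in> GRT1 \<Longrightarrow> GRT_conditions g"
  unfolding GRT1_iff_mixed GRT_conditions_def using one.mixed_pentagon_LA two_cycle_LB by blast

section \<open>Closure under products and inverses\<close>

context level
begin

lemma GRTM_iff:
  "(g, h) \<in> GRTM N \<longleftrightarrow> g \<in> GRT1 \<and> h \<in> exp_t03 N \<and> nc_coeff h [LB 0] = 0 \<and>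
    mixed_pentagon N g h \<and> octagon N h \<and> special_action N h"
  by (simp add: GRTM_def)

lemma GRT1_exp: "g \<in> GRT1 \<Longrightarrow> g \<in> exp_t03 1"
  by (simp add: GRT1_iff_mixed)

lemma GRTM_mult_eq:
  fixes g g' h h' :: "'k::field_char_0 ab_series"
  assumes "g \<in> exp_t03 1" "g' \<in> exp_t03 1"
  shows "GRTM_mult N (g', h') (g, h) = (twist_mult 1 g' g, twist_mult N h' h)"
proof -
  have "ad (tau 1 i (rinv g)) (sB 1 i) = ad (rinv g) (sB 1 0)" for i
    by (subst sB_one) (simp add: tau_one assms one.exp_rinv)
  then have "gsub g' sA (nc_Ad (nc_inv g) (sB 1 0)) = twist 1 g g'"
    by (simp add: gsub_def one.twist_eq nc_Ad_eq_ad nc_inv_eq_rinv)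
  then show ?thesis
    using assms by (simp add: GRTM_mult_def twist_mult_def twist_def gsub_AB)
qed

lemma GRT1_twist_mult_iff:
  fixes g g' :: "'k::field_char_0 ab_series"
  assumes g: "g \<in> GRT1" and g': "g' \<in> exp_t03 1"
  shows "twist_mult 1 g' g \<in> GRT1 \<longleftrightarrow> g' \<in> GRT1"
proof -
  have g1: "g \<in> exp_t03 1" "two_cycle g" "hexagon g" "special_action 1 g" "mixed_pentagon 1 g g" "nc_coeff g [LA] = 0"
    using g GRT1_conditions[OF g] by (simp_all add: GRT1_iff_mixed GRT_conditions_def)
  note oct = octagon_one[OF g1(1)]
  show ?thesis
    unfolding GRT1_iff_mixed two_cycle_twist_mult_iff[OF g' g1(1,2)] hexagon_twist_mult_iff[OF g' g1(1,3,4)]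
      one.special_twist_mult_iff(2)[OF g1(1) oct g1(4) g']
      one.mixed_pentagon_twist_mult_iff[OF GRT1_conditions[OF g] g1(1,6) oct g1(4,5) g' g']
    using one.twist_mult_exp[OF g' g1(1)] g' by blast
qed

text \<open>Only \<open>(g, h)\<close> is required to be a solution; \<open>(g', h')\<close> is any
  group-like pair. One direction gives closure under products, the other places inverses in the
  set.\<close>

lemma GRTM_twist_mult_iff:
  fixes g g' h h' :: "'k::field_char_0 ab_series"
  assumes gh: "(g, h) \<in> GRTM N" and g': "g' \<in> exp_t03 1" and h': "h' \<in> exp_t03 N"
  shows "(twist_mult 1 g' g, twist_mult N h' h) \<in> GRTM N \<longleftrightarrow> (g', h') \<in> GRTM N"
proof -
  have g: "g \<in> GRT1" and h: "h \<in> exp_t03 N" "nc_coeff h [LB 0] = 0" "mixed_pentagon N g h" "octagon N h" "special_action N h"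
    using gh by (simp_all add: GRTM_iff)
  have A: "nc_coeff h [LA] = 0" by (rule mixed_pentagon_LA[OF h(1) GRT1_exp[OF g] h(3)])
  show ?thesis
    unfolding GRTM_iff GRT1_twist_mult_iff[OF g g'] special_twist_mult_iff[OF h(1,4,5) h']
      mixed_pentagon_twist_mult_iff[OF GRT1_conditions[OF g] h(1) A h(4,5,3) h' g'] nc_coeff_twist_mult_LB[OF h' h(1)] h(2)
    using twist_mult_exp[OF h' h(1)] h' by simp
qed

lemma GRTM_1: "(1, 1) \<in> (GRTM N :: ('k::field_char_0 ab_series \<times> 'k ab_series) set)"
proof -
  have "(1 :: 'k ab_series) \<in> GRT1"
    unfolding GRT1_iff_mixed two_cycle_def hexagon_def one.flip_ratio_def
    by (simp add: one.exp_1 one.mixed_pentagon_1 one.special_action_1 one.endo_1[OF endo_swap_AB]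
        one.endo_1[OF endo_B_to_C] one.endo_1[OF one.endo_flip])
  then show ?thesis
    by (simp add: GRTM_iff nc_coeff_one mixed_pentagon_1 octagon_1 special_action_1)
qed

end

theorem propositionA2:
  fixes N :: nat
  assumes "N \<ge> 1"
  shows "group (GRTM_group N :: ('k::field_char_0 ab_series \<times> 'k ab_series) monoid)"
proof -
  interpret level N by unfold_locales (rule assms)
  let ?G = "GRTM_group N :: ('k ab_series \<times> 'k ab_series) monoid"
  have e: "g \<in> exp_t03 1" "h \<in> exp_t03 N" if "(g, h) \<in> GRTM N" for g h :: "'k ab_series"
    using that GRT1_exp by (auto simp: GRTM_iff)
  have m: "GRTM_mult N (g', h') (g, h) = (twist_mult 1 g' g, twist_mult N h' h)"
    if "(g, h) \<in> GRTM N" "(g', h') \<in> GRTM N" for g g' h h' :: "'k ab_series"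
    using that e by (intro GRTM_mult_eq) blast+
  have closed: "(twist_mult 1 g' g, twist_mult N h' h) \<in> GRTM N"
    if "(g, h) \<in> GRTM N" "(g', h') \<in> GRTM N" for g g' h h' :: "'k ab_series"
    using GRTM_twist_mult_iff[OF that(1) e[OF that(2)]] that(2) by simp
  show ?thesis
  proof (rule groupI)
    fix p q assume "p \<in> carrier ?G" "q \<in> carrier ?G"
    then show "p \<otimes>\<^bsub>?G\<^esub> q \<in> carrier ?G"
      by (cases p, cases q) (simp add: GRTM_group_def m closed)
  next
    show "\<one>\<^bsub>?G\<^esub> \<in> carrier ?G" by (simp add: GRTM_group_def GRTM_1)
  next
    fix p q r assume "p \<in> carrier ?G" "q \<in> carrier ?G" "r \<in> carrier ?G"
    then show "p \<otimes>\<^bsub>?G\<^esub> q \<otimes>\<^bsub>?G\<^esub> r = p \<otimes>\<^bsub>?G\<^esub> (q \<otimes>\<^bsub>?G\<^esub> r)"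
      by (cases p, cases q, cases r)
        (simp add: GRTM_group_def m closed twist_mult_assoc[OF e(2) e(2) e(2)] one.twist_mult_assoc[OF e(1) e(1) e(1)])
  next
    fix p assume "p \<in> carrier ?G"
    then show "\<one>\<^bsub>?G\<^esub> \<otimes>\<^bsub>?G\<^esub> p = p"
      by (cases p) (simp add: GRTM_group_def m GRTM_1 e one.twist_mult_1)
  next
    fix p assume p: "p \<in> carrier ?G"
    obtain g h where gh: "p = (g, h)" by (cases p)
    then have G: "(g, h) \<in> GRTM N" using p by (simp add: GRTM_group_def)
    obtain x z where x: "x \<in> exp_t03 1" "twist_mult 1 x g = 1" and z: "z \<in> exp_t03 N" "twist_mult N z h = 1"
      using one.twist_mult_left_inverse[OF e(1)[OF G]] twist_mult_left_inverse[OF e(2)[OF G]] by blast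
    \<comment> \<open>The inverse is so far only a group-like pair; its product with
      \<open>p\<close> is the solution (1, 1), and the equivalence transfers this to the pair
      itself.\<close>
    have "(1, 1) \<in> (GRTM N :: ('k ab_series \<times> 'k ab_series) set)" by (rule GRTM_1)
    then have "(x, z) \<in> GRTM N"
      using GRTM_twist_mult_iff[OF G x(1) z(1)] x z by simp
    then show "\<exists>q\<in>carrier ?G. q \<otimes>\<^bsub>?G\<^esub> p = \<one>\<^bsub>?G\<^esub>"
      using G x z by (intro bexI[of _ "(x, z)"]) (simp_all add: GRTM_group_def gh m)
  qed
qed

end
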